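(* Let $\bm{A}\in\mathbb{R}^{d\times n}$, $k$ a positive integer and $\varepsilon\in(0,1)$. For any $0<\delta<1$ there is an algorithm that computes $\bm{U}\in\mathbb{R}^{d\times k}_{\ge 0}$ with $\bm{U}^T\bm{U}=\bm{I}_k$ such that $$\|\bm{A}-\bm{U}\bm{U}^T\bm{A}\|_F^2\le(1+\varepsilon)\mathrm{OPT}+O(\delta\|\bm{A}\|_F^2)$$ in time $O(dk^2/\varepsilon)\cdot(1/\delta)^{O(k^2/\varepsilon)}$.
   Context: $\mathbb{R}^{d\times k}_{\ge0}$ denotes $d\times k$ matrices with nonnegative entries. $\mathrm{OPT}=\min\{\|\bm{A}-\bm{U}\bm{U}^T\bm{A}\|_F^2:\bm{U}\in\mathbb{R}^{d\times k}_{\ge0},\ \bm{U}^T\bm{U}=\bm{I}_k\}$ (projective non-negative matrix factorization).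
   Formalization: Assumes k ≤ d (otherwise no U with U^T U = I_k exists), and the time bound gains an additive term O(nd)·(k/(εδ))^{O(1)}, since a bound independent of n is impossible: an algorithm that reads O(1) entries of A misses its only nonzero column. *)

theory Defs
  imports Complex_Main "Jordan_Normal_Form.Matrix"
begin

section \<open>Projective non-negative matrix factorization\<close>

text \<open>Squared Frobenius norm.\<close>

definition frob_sq :: "real mat \<Rightarrow> real" where
  "frob_sq M = (\<Sum>i<dim_row M. \<Sum>j<dim_col M. (M $$ (i, j))\<^sup>2)"

definition pnmf_feasible :: "nat \<Rightarrow> nat \<Rightarrow> real mat set" where
  "pnmf_feasible d k =
     {U \<in> carrier_mat d k. (\<forall>i<d. \<forall>j<k. 0 \<le> U $$ (i, j)) \<and> transpose_mat U * U = 1\<^sub>m k}"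

definition pnmf_cost :: "real mat \<Rightarrow> real mat \<Rightarrow> real" where
  "pnmf_cost A U = frob_sq (A - U * transpose_mat U * A)"

text \<open>The feasible set is compact, and nonempty iff \<open>k \<le> d\<close>; in that case the infimum
  is attained, so it is the minimum.\<close>

definition pnmf_opt :: "real mat \<Rightarrow> nat \<Rightarrow> real" where
  "pnmf_opt A k = (INF U \<in> pnmf_feasible (dim_row A) k. pnmf_cost A U)"


section \<open>Real RAM programs and their running time\<close>

text \<open>
  A unit-cost real RAM, given as a small imperative language. The memory consists of integer
  registers and of two-dimensional arrays of exact real numbers, addressed by integer
  expressions. Real numbers are produced only from the input and from integers, by
  \<open>+ - * / sqrt\<close>, and can only be compared; there is no rounding of reals to integers, and
  programs contain no real constants. Integer arithmetic is restricted to addition and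
  truncated subtraction, so that integers cannot be used to encode large amounts of data.
\<close>

datatype nexp =
    NConst nat
  | NVar string
  | NAdd nexp nexp
  | NSub nexp nexp

datatype rexp =
    RNat nexp
  | RCell string nexp nexp
  | RAdd rexp rexp
  | RSub rexp rexp
  | RMul rexp rexp
  | RDiv rexp rexp
  | RSqrt rexp

datatype bexp =
    NLess nexp nexp
  | RLess rexp rexp
  | BNot bexp
  | BAnd bexp bexp

datatype com =
    Skip
  | NAssign string nexp
  | RAssign string nexp nexp rexp
  | Seq com com
  | Cond bexp com com
  | While bexp com

record state =
  nvar :: "string \<Rightarrow> nat"
  cell :: "string \<Rightarrow> nat \<Rightarrow> nat \<Rightarrow> real"

fun nval :: "nexp \<Rightarrow> state \<Rightarrow> nat" where
  "nval (NConst m) s = m"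
| "nval (NVar x) s = nvar s x"
| "nval (NAdd a b) s = nval a s + nval b s"
| "nval (NSub a b) s = nval a s - nval b s"

fun rval :: "rexp \<Rightarrow> state \<Rightarrow> real" where
  "rval (RNat a) s = real (nval a s)"
| "rval (RCell x a b) s = cell s x (nval a s) (nval b s)"
| "rval (RAdd a b) s = rval a s + rval b s"
| "rval (RSub a b) s = rval a s - rval b s"
| "rval (RMul a b) s = rval a s * rval b s"
| "rval (RDiv a b) s = rval a s / rval b s"
| "rval (RSqrt a) s = sqrt (rval a s)"

fun bval :: "bexp \<Rightarrow> state \<Rightarrow> bool" where
  "bval (NLess a b) s \<longleftrightarrow> nval a s < nval b s"
| "bval (RLess a b) s \<longleftrightarrow> rval a s < rval b s"
| "bval (BNot b) s \<longleftrightarrow> \<not> bval b s"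
| "bval (BAnd a b) s \<longleftrightarrow> bval a s \<and> bval b s"

text \<open>Every node of an expression (operation, memory access, constant) costs one step.\<close>

fun ncost :: "nexp \<Rightarrow> nat" where
  "ncost (NConst m) = 1"
| "ncost (NVar x) = 1"
| "ncost (NAdd a b) = 1 + ncost a + ncost b"
| "ncost (NSub a b) = 1 + ncost a + ncost b"

fun rcost :: "rexp \<Rightarrow> nat" where
  "rcost (RNat a) = 1 + ncost a"
| "rcost (RCell x a b) = 1 + ncost a + ncost b"
| "rcost (RAdd a b) = 1 + rcost a + rcost b"
| "rcost (RSub a b) = 1 + rcost a + rcost b"
| "rcost (RMul a b) = 1 + rcost a + rcost b"
| "rcost (RDiv a b) = 1 + rcost a + rcost b"
| "rcost (RSqrt a) = 1 + rcost a"

fun bcost :: "bexp \<Rightarrow> nat" where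
  "bcost (NLess a b) = 1 + ncost a + ncost b"
| "bcost (RLess a b) = 1 + rcost a + rcost b"
| "bcost (BNot b) = 1 + bcost b"
| "bcost (BAnd a b) = 1 + bcost a + bcost b"

definition set_nvar :: "string \<Rightarrow> nat \<Rightarrow> state \<Rightarrow> state" where
  "set_nvar x v s = s\<lparr>nvar := (nvar s)(x := v)\<rparr>"

definition set_cell :: "string \<Rightarrow> nat \<Rightarrow> nat \<Rightarrow> real \<Rightarrow> state \<Rightarrow> state" where
  "set_cell x i j v s = s\<lparr>cell := (cell s)(x := (cell s x)(i := (cell s x i)(j := v)))\<rparr>"

text \<open>\<open>runs c s T s'\<close>: started in \<open>s\<close>, the program \<open>c\<close> halts in \<open>s'\<close> after exactly \<open>T\<close> steps.\<close>

inductive runs :: "com \<Rightarrow> state \<Rightarrow> nat \<Rightarrow> state \<Rightarrow> bool" where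
  runs_Skip: "runs Skip s 1 s"
| runs_NAssign: "runs (NAssign x a) s (1 + ncost a) (set_nvar x (nval a s) s)"
| runs_RAssign: "runs (RAssign x a b e) s (1 + ncost a + ncost b + rcost e)
      (set_cell x (nval a s) (nval b s) (rval e s) s)"
| runs_Seq: "runs c1 s T1 s1 \<Longrightarrow> runs c2 s1 T2 s2 \<Longrightarrow> runs (Seq c1 c2) s (T1 + T2) s2"
| runs_CondT: "bval b s \<Longrightarrow> runs c1 s T s1 \<Longrightarrow> runs (Cond b c1 c2) s (1 + bcost b + T) s1"
| runs_CondF: "\<not> bval b s \<Longrightarrow> runs c2 s T s1 \<Longrightarrow> runs (Cond b c1 c2) s (1 + bcost b + T) s1"
| runs_WhileF: "\<not> bval b s \<Longrightarrow> runs (While b c) s (1 + bcost b) s"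
| runs_WhileT: "bval b s \<Longrightarrow> runs c s T1 s1 \<Longrightarrow> runs (While b c) s1 T2 s2 \<Longrightarrow>
      runs (While b c) s (1 + bcost b + T1 + T2) s2"

inductive_cases runs_SkipE: "runs Skip s T s'"
inductive_cases runs_NAssignE: "runs (NAssign x a) s T s'"
inductive_cases runs_RAssignE: "runs (RAssign x a b e) s T s'"
inductive_cases runs_SeqE: "runs (Seq c1 c2) s T s'"
inductive_cases runs_CondE: "runs (Cond b c1 c2) s T s'"
inductive_cases runs_WhileE: "runs (While b c) s T s'"

lemma runs_deterministic:
  "runs c s T s' \<Longrightarrow> runs c s T' s'' \<Longrightarrow> T' = T \<and> s'' = s'"
proof (induction arbitrary: T' s'' rule: runs.induct)
  case (runs_Skip s)
  from runs_Skip.prems show ?case by (rule runs_SkipE) simp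
next
  case (runs_NAssign x a s)
  from runs_NAssign.prems show ?case by (rule runs_NAssignE) simp
next
  case (runs_RAssign x a b e s)
  from runs_RAssign.prems show ?case by (rule runs_RAssignE) simp
next
  case (runs_Seq c1 s T1 s1 c2 T2 s2)
  from runs_Seq.prems obtain U1 U2 r1
    where "T' = U1 + U2" "runs c1 s U1 r1" "runs c2 r1 U2 s''" by (rule runs_SeqE)
  with runs_Seq.IH(1)[of U1 r1] runs_Seq.IH(2)[of U2 s''] show ?case by simp
next
  case (runs_CondT b s c1 T s1 c2)
  from runs_CondT.prems obtain U where "T' = 1 + bcost b + U" "runs c1 s U s''"
    by (rule runs_CondE) (use runs_CondT.hyps(1) in simp_all)
  with runs_CondT.IH[of U s''] show ?case by simp
next
  case (runs_CondF b s c2 T s1 c1)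
  from runs_CondF.prems obtain U where "T' = 1 + bcost b + U" "runs c2 s U s''"
    by (rule runs_CondE) (use runs_CondF.hyps(1) in simp_all)
  with runs_CondF.IH[of U s''] show ?case by simp
next
  case (runs_WhileF b s c)
  from runs_WhileF.prems show ?case by (rule runs_WhileE) (use runs_WhileF.hyps in simp_all)
next
  case (runs_WhileT b s c T1 s1 T2 s2)
  from runs_WhileT.prems obtain U1 U2 r1
    where "T' = 1 + bcost b + U1 + U2" "runs c s U1 r1" "runs (While b c) r1 U2 s''"
    by (rule runs_WhileE) (use runs_WhileT.hyps(1) in simp_all)
  with runs_WhileT.IH(1)[of U1 r1] runs_WhileT.IH(2)[of U2 s''] show ?case by simp
qed


section \<open>Input and output conventions\<close>

text \<open>All memory not holding part of the input is initially zero.\<close>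

definition input_state :: "real mat \<Rightarrow> nat \<Rightarrow> real \<Rightarrow> real \<Rightarrow> state" where
  "input_state A k \<epsilon> \<delta> =
     \<lparr>nvar = (\<lambda>_. 0)(''d'' := dim_row A, ''n'' := dim_col A, ''k'' := k),
      cell = (\<lambda>_ _ _. 0)
        (''A'' := \<lambda>i j. if i < dim_row A \<and> j < dim_col A then A $$ (i, j) else 0,
         ''eps'' := \<lambda>i j. if i = 0 \<and> j = 0 then \<epsilon> else 0,
         ''delta'' := \<lambda>i j. if i = 0 \<and> j = 0 then \<delta> else 0)\<rparr>"

definition output_mat :: "nat \<Rightarrow> nat \<Rightarrow> state \<Rightarrow> real mat" where
  "output_mat d k s = mat d k (\<lambda>(i, j). cell s ''U'' i j)"

end

theory Submission
  imports Defs "HOL-Library.FuncSet"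
begin

text \<open>
  For orthonormal \<open>U\<close> the cost is \<open>\<parallel>A\<parallel>\<^sup>2 - \<parallel>U\<^sup>T A\<parallel>\<^sup>2\<close>, and nonnegative orthonormal columns have
  disjoint supports. First the columns of \<open>A\<close> are streamed into a buffer \<open>B\<close> of \<open>m = O(k / \<epsilon>)\<close>
  columns, in the manner of Frequent Directions: Jacobi rotations, which preserve \<open>B B\<^sup>T\<close>, make
  the buffer nearly orthogonal; a full buffer is shrunk by the smallest squared column norm. Then
  \<open>0 \<le> A A\<^sup>T - B B\<^sup>T\<close>, and on any \<open>k\<close>-dimensional subspace this difference has trace at most
  \<open>\<epsilon>\<close> times the cost plus \<open>O(\<delta> \<parallel>A\<parallel>\<^sup>2)\<close>. Columns of tiny norm are overwritten, so that a logarithmic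
  potential bounds the number of rotations linearly in \<open>n\<close>.

  Next, if \<open>c\<^sub>j\<close> is the direction of \<open>B\<^sup>T u\<^sub>j\<close>, then for given \<open>c\<^sub>1, \<dots>, c\<^sub>k\<close> the best \<open>U\<close> assigns each
  row \<open>i\<close> to a column maximising \<open>(B c\<^sub>j)\<^sub>i\<close>. All choices of the \<open>c\<^sub>j\<close> are enumerated up to precision
  \<open>\<delta>\<close>, as integer points in an \<open>l\<^sub>1\<close> ball of radius \<open>m k / \<delta>\<close>; there are \<open>(1 / \<delta>)\<^bsup>O(m k)\<^esup>\<close> of them.
  Zero columns of the best assignment found are repaired at the end without loss.
\<close>

section \<open>Weakest preconditions with running times\<close>

text \<open>A running time of d k^2/\<epsilon> (1/\<delta>)^O(k^2/\<epsilon>) does not allow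
  enumerating vectors c_j of length n, hence the compression to O(k/\<epsilon>) columns.
  Eigenvectors cannot in general be computed exactly by field operations and square roots; but
  pairwise cosines of at most 1/m already give Bessel's inequality up to a factor 2, which the
  leading 2 in m = 2k + 2k/\<epsilon> absorbs. The threshold under which columns are overwritten
  bounds the logarithms from below, so the number of rotations does not depend on the size of the
  entries of \<open>A\<close>. The ball replaces a cube for the sake of the count: unit vectors have
  l_1 norm at most sqrt m, so 2km coordinates share the budget N m k with N about 1/\<delta>, on
  average O(1/\<delta>) each. A cube around the same points needs side length about N sqrt m and
  would put a factor log m into the exponent. The remaining constant per coordinate is absorbed into
  a power of 1/\<delta>. This needs \<delta> bounded away from 1; for \<delta> \<ge> 1/2 every
  feasible matrix is good enough. Reading \<open>A\<close> and sketching are paid by a separate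
  term, polynomial in n, d and k/(\<epsilon>\<delta>).\<close>

definition wp :: "com \<Rightarrow> state \<Rightarrow> (nat \<Rightarrow> state \<Rightarrow> bool) \<Rightarrow> bool" where
  "wp c s Q \<longleftrightarrow> (\<exists>t s'. runs c s t s' \<and> Q t s')"

lemma nvar_set_nvar [simp]: "nvar (set_nvar x v s) = (nvar s)(x := v)"
  and cell_set_nvar [simp]: "cell (set_nvar x v s) = cell s"
  and nvar_set_cell [simp]: "nvar (set_cell a i j r s) = nvar s"
  and cell_set_cell [simp]:
    "cell (set_cell a i j r s) = (cell s)(a := (cell s a)(i := (cell s a i)(j := r)))"
  by (simp_all add: set_nvar_def set_cell_def)

lemma wp_mono: "wp c s Q \<Longrightarrow> (\<And>t s'. Q t s' \<Longrightarrow> Q' t s') \<Longrightarrow> wp c s Q'"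
  unfolding wp_def by blast

text \<open>This rule and the next four are equivalences, so the simplifier computes the condition
  and the exact step count of loop-free code.\<close>

lemma wp_Skip [simp]: "wp Skip s Q \<longleftrightarrow> Q 1 s"
  unfolding wp_def by (metis runs_Skip runs_deterministic)

lemma wp_NAssign [simp]:
  "wp (NAssign x a) s Q \<longleftrightarrow> Q (1 + ncost a) (set_nvar x (nval a s) s)"
  unfolding wp_def by (auto elim!: runs_NAssignE intro: runs_NAssign[simplified])

lemma wp_RAssign [simp]:
  "wp (RAssign x a b e) s Q \<longleftrightarrow>
     Q (1 + ncost a + ncost b + rcost e) (set_cell x (nval a s) (nval b s) (rval e s) s)"
  unfolding wp_def by (auto elim!: runs_RAssignE intro: runs_RAssign[simplified])

lemma wp_Seq [simp]:
  "wp (Seq c1 c2) s Q \<longleftrightarrow> wp c1 s (\<lambda>t1 s1. wp c2 s1 (\<lambda>t2 s2. Q (t1 + t2) s2))"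
  unfolding wp_def by (blast elim: runs_SeqE intro: runs_Seq)

lemma wp_Cond [simp]:
  "wp (Cond b c1 c2) s Q \<longleftrightarrow>
     (if bval b s then wp c1 s (\<lambda>t. Q (1 + bcost b + t)) else wp c2 s (\<lambda>t. Q (1 + bcost b + t)))"
  unfolding wp_def
  by (auto elim!: runs_CondE intro: runs_CondT[simplified] runs_CondF[simplified])

lemma wp_Seq_bound:
  assumes "wp c1 s (\<lambda>t s1. t \<le> W1 \<and> G s1)"
    and "\<And>s1. G s1 \<Longrightarrow> wp c2 s1 (\<lambda>t s2. t \<le> W2 \<and> H s2)"
    and "W1 + W2 \<le> W"
  shows "wp (Seq c1 c2) s (\<lambda>t s2. t \<le> W \<and> H s2)"
  unfolding wp_Seq
proof (rule wp_mono[OF assms(1)], elim conjE)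
  fix t1 s1 assume "t1 \<le> W1" "G s1"
  then show "wp c2 s1 (\<lambda>t2 s2. t1 + t2 \<le> W \<and> H s2)"
    by (intro wp_mono[OF assms(2)]) (use assms(3) in auto)
qed

section \<open>Frame conditions: the registers and arrays a program may change\<close>

primrec nmods :: "com \<Rightarrow> string set" where
  "nmods Skip = {}"
| "nmods (NAssign x a) = {x}"
| "nmods (RAssign x a b e) = {}"
| "nmods (Seq c1 c2) = nmods c1 \<union> nmods c2"
| "nmods (Cond b c1 c2) = nmods c1 \<union> nmods c2"
| "nmods (While b c) = nmods c"

primrec rmods :: "com \<Rightarrow> string set" where
  "rmods Skip = {}"
| "rmods (NAssign x a) = {}"
| "rmods (RAssign x a b e) = {x}"
| "rmods (Seq c1 c2) = rmods c1 \<union> rmods c2"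
| "rmods (Cond b c1 c2) = rmods c1 \<union> rmods c2"
| "rmods (While b c) = rmods c"

definition eqx :: "string set \<Rightarrow> string set \<Rightarrow> state \<Rightarrow> state \<Rightarrow> bool" where
  "eqx X Y s s' \<longleftrightarrow>
     (\<forall>x. x \<notin> X \<longrightarrow> nvar s' x = nvar s x) \<and> (\<forall>a. a \<notin> Y \<longrightarrow> cell s' a = cell s a)"

lemma eqx_refl [simp]: "eqx X Y s s"
  by (simp add: eqx_def)

lemma eqx_trans: "eqx X Y s s' \<Longrightarrow> eqx X Y s' s'' \<Longrightarrow> eqx X Y s s''"
  by (simp add: eqx_def)

lemma runs_eqx: "runs c s t s' \<Longrightarrow> eqx (nmods c) (rmods c) s s'"
  by (induction rule: runs.induct) (auto simp: eqx_def)

lemma wp_frame: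
  assumes "wp c s Q"
  shows "wp c s (\<lambda>t s'. Q t s' \<and> eqx (nmods c) (rmods c) s s')"
  using assms runs_eqx unfolding wp_def by blast

text \<open>A single natural-valued variant gives both termination and the time: it allows at most
  \<open>m\<close> iterations, each paid with \<open>W\<close> plus the guard, and the failing test
  at the end is paid once more.\<close>

lemma wp_While_bound:
  fixes M :: "state \<Rightarrow> nat"
  assumes "I s" and "M s \<le> m"
    and step: "\<And>s. I s \<Longrightarrow> bval b s \<Longrightarrow> wp c s (\<lambda>t s'. t \<le> W \<and> I s' \<and> M s' < M s)"
  shows "wp (While b c) s
     (\<lambda>t s'. t \<le> m * (W + 1 + bcost b) + 1 + bcost b \<and> I s' \<and> \<not> bval b s')"
  using assms(1,2)
proof (induction m arbitrary: s)
  case 0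
  have "\<not> bval b s"
  proof
    assume "bval b s"
    from step[OF 0(1) this] 0(2) show False unfolding wp_def by auto
  qed
  then show ?case
    unfolding wp_def using runs_WhileF[of b s c] 0(1) by auto
next
  case (Suc m)
  show ?case
  proof (cases "bval b s")
    case False
    then show ?thesis
      unfolding wp_def using runs_WhileF[of b s c] Suc.prems(1) by fastforce
  next
    case True
    obtain t1 s1 where 1: "runs c s t1 s1" "t1 \<le> W" "I s1" "M s1 < M s"
      using step[OF Suc.prems(1) True] unfolding wp_def by blast
    obtain t2 s2 where 2: "runs (While b c) s1 t2 s2"
      "t2 \<le> m * (W + 1 + bcost b) + 1 + bcost b" "I s2" "\<not> bval b s2"
      using Suc.IH[OF 1(3)] 1(4) Suc.prems(2) unfolding wp_def by force
    have "1 + bcost b + t1 + t2 \<le> Suc m * (W + 1 + bcost b) + 1 + bcost b"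
      using 1(2) 2(2) by simp
    with runs_WhileT[OF True 1(1) 2(1)] 2(3,4) show ?thesis
      unfolding wp_def by blast
  qed
qed

definition For :: "string \<Rightarrow> string \<Rightarrow> com \<Rightarrow> com" where
  "For x N body = Seq (NAssign x (NConst 0)) (While (NLess (NVar x) (NVar N))
     (Seq body (NAssign x (NAdd (NVar x) (NConst 1)))))"

lemma nmods_For [simp]: "nmods (For x N body) = insert x (nmods body)"
  and rmods_For [simp]: "rmods (For x N body) = rmods body"
  by (simp_all add: For_def)

text \<open>The loop index is an argument of the invariant, and \<open>ins\<close> says that the
  invariant does not read the counter register, so the increment preserves it. An iteration pays 4
  steps for the guard and 4 for the increment on top of \<open>W\<close>; the 6 are the initial
  assignment and the failing test.\<close>

lemma wp_For:
  assumes N: "nvar s N = n" and fresh: "x \<notin> nmods body" "N \<notin> nmods body" "x \<noteq> N"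
    and ins: "\<And>i s1 v. I i s1 \<Longrightarrow> I i (set_nvar x v s1)"
    and base: "I 0 s"
    and step: "\<And>i s1. i < n \<Longrightarrow> eqx (insert x (nmods body)) (rmods body) s s1 \<Longrightarrow>
      nvar s1 x = i \<Longrightarrow> I i s1 \<Longrightarrow> wp body s1 (\<lambda>t s2. t \<le> W \<and> I (Suc i) s2)"
  shows "wp (For x N body) s
     (\<lambda>t s'. t \<le> n * (W + 8) + 6 \<and> I n s' \<and> eqx (insert x (nmods body)) (rmods body) s s')"
proof -
  let ?J = "\<lambda>s1. nvar s1 x \<le> n \<and> I (nvar s1 x) s1 \<and> eqx (insert x (nmods body)) (rmods body) s s1"
  let ?c = "Seq body (NAssign x (NAdd (NVar x) (NConst 1)))"
  let ?s0 = "set_nvar x 0 s"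
  have "wp (While (NLess (NVar x) (NVar N)) ?c) ?s0
     (\<lambda>t s'. t \<le> n * (W + 4 + 1 + bcost (NLess (NVar x) (NVar N))) + 1
        + bcost (NLess (NVar x) (NVar N)) \<and> ?J s' \<and> \<not> bval (NLess (NVar x) (NVar N)) s')"
  proof (rule wp_While_bound[where M = "\<lambda>s1. n - nvar s1 x"])
    show "?J ?s0" using base ins by (auto simp: eqx_def)
    show "n - nvar ?s0 x \<le> n" by simp
    fix s1 assume J: "?J s1" and b: "bval (NLess (NVar x) (NVar N)) s1"
    have Ns: "nvar s1 N = n" using J N fresh by (auto simp: eqx_def)
    then have lt: "nvar s1 x < n" using b by simp
    have "wp body s1 (\<lambda>t s2. (t \<le> W \<and> I (Suc (nvar s1 x)) s2) \<and> eqx (nmods body) (rmods body) s1 s2)"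
      by (rule wp_frame, rule step) (use lt J in auto)
    then show "wp ?c s1 (\<lambda>t s'. t \<le> W + 4 \<and> ?J s' \<and> n - nvar s' x < n - nvar s1 x)"
    proof (simp only: wp_Seq, elim wp_mono, elim conjE)
      fix t s2
      assume "t \<le> W" and I2: "I (Suc (nvar s1 x)) s2" and e: "eqx (nmods body) (rmods body) s1 s2"
      have x2: "nvar s2 x = nvar s1 x" using e fresh by (simp add: eqx_def)
      show "wp (NAssign x (NAdd (NVar x) (NConst 1))) s2
        (\<lambda>t2 s2. t + t2 \<le> W + 4 \<and> ?J s2 \<and> n - nvar s2 x < n - nvar s1 x)"
        using \<open>t \<le> W\<close> ins[OF I2] x2 lt J e by (auto simp: eqx_def)
    qed
  qed
  then show ?thesis
    unfolding For_def wp_Seq wp_NAssign nval.simps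
  proof (rule wp_mono, elim conjE)
    fix t s'
    assume t: "t \<le> n * (W + 4 + 1 + bcost (NLess (NVar x) (NVar N))) + 1 + bcost (NLess (NVar x) (NVar N))"
      and J: "nvar s' x \<le> n" "I (nvar s' x) s'" "eqx (insert x (nmods body)) (rmods body) s s'"
      and b: "\<not> bval (NLess (NVar x) (NVar N)) s'"
    have "nvar s' N = n" using J N fresh by (auto simp: eqx_def)
    then have "nvar s' x = n" using J(1) b by simp
    moreover have "1 + ncost (NConst 0) + t \<le> n * (W + 8) + 6"
      using t by (simp add: algebra_simps)
    ultimately show "1 + ncost (NConst 0) + t \<le> n * (W + 8) + 6 \<and> I n s' \<and>
        eqx (insert x (nmods body)) (rmods body) s s'"
      using J by simp
  qed
qed

definition SumLoop :: "string \<Rightarrow> string \<Rightarrow> string \<Rightarrow> rexp \<Rightarrow> com" where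
  "SumLoop a x N e = Seq (RAssign a (NConst 0) (NConst 0) (RNat (NConst 0)))
     (For x N (RAssign a (NConst 0) (NConst 0) (RAdd (RCell a (NConst 0) (NConst 0)) e)))"

lemma nmods_SumLoop [simp]: "nmods (SumLoop a x N e) = {x}"
  and rmods_SumLoop [simp]: "rmods (SumLoop a x N e) = {a}"
  by (auto simp add: SumLoop_def)

lemma wp_SumLoop:
  assumes N: "nvar s N = n" and "x \<noteq> N"
    and E: "\<And>i s1. i < n \<Longrightarrow> eqx {x} {a} s s1 \<Longrightarrow> nvar s1 x = i \<Longrightarrow> rval e s1 = E i"
  shows "wp (SumLoop a x N e) s
     (\<lambda>t s'. t \<le> n * (rcost e + 15) + 11 \<and> cell s' a 0 0 = (\<Sum>i<n. E i) \<and> eqx {x} {a} s s')"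
proof -
  let ?b = "RAssign a (NConst 0) (NConst 0) (RAdd (RCell a (NConst 0) (NConst 0)) e)"
  let ?s = "set_cell a 0 0 0 s"
  have "wp (For x N ?b) ?s (\<lambda>t s'. t \<le> n * ((rcost e + 7) + 8) + 6 \<and>
      cell s' a 0 0 = (\<Sum>i<n. E i) \<and> eqx (insert x (nmods ?b)) (rmods ?b) ?s s')"
    by (rule wp_For[where I = "\<lambda>i s'. cell s' a 0 0 = (\<Sum>i<i. E i)"])
      (use assms in \<open>auto simp: eqx_def\<close>)
  then show ?thesis
    unfolding SumLoop_def wp_Seq wp_RAssign
    by simp (erule wp_mono, auto simp: eqx_def algebra_simps)
qed

section \<open>Captured energy\<close>

definition dot :: "nat \<Rightarrow> (nat \<Rightarrow> real) \<Rightarrow> (nat \<Rightarrow> real) \<Rightarrow> real" where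
  "dot d u v = (\<Sum>i<d. u i * v i)"

definition sq :: "nat \<Rightarrow> (nat \<Rightarrow> real) \<Rightarrow> real" where
  "sq d v = (\<Sum>i<d. (v i)\<^sup>2)"

abbreviation (input) column :: "(nat \<Rightarrow> nat \<Rightarrow> real) \<Rightarrow> nat \<Rightarrow> nat \<Rightarrow> real" where
  "column B p \<equiv> (\<lambda>i. B i p)"

text \<open>The quadratic form u^T B B^T u. Comparing two such forms for all \<open>u\<close> is the
  semidefinite order in which the sketch is compared with the input.\<close>

definition energy :: "nat \<Rightarrow> nat \<Rightarrow> (nat \<Rightarrow> nat \<Rightarrow> real) \<Rightarrow> (nat \<Rightarrow> real) \<Rightarrow> real" where
  "energy d m B u = (\<Sum>p<m. (dot d u (column B p))\<^sup>2)"

definition total_sq :: "nat \<Rightarrow> nat \<Rightarrow> (nat \<Rightarrow> nat \<Rightarrow> real) \<Rightarrow> real" where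
  "total_sq d m B = (\<Sum>p<m. sq d (column B p))"

lemma sq_nonneg [simp]: "0 \<le> sq d v"
  by (simp add: sq_def sum_nonneg)

lemma energy_nonneg [simp]: "0 \<le> energy d m B u"
  by (simp add: energy_def sum_nonneg)

lemma total_sq_nonneg [simp]: "0 \<le> total_sq d m B"
  by (simp add: total_sq_def sum_nonneg)

lemma dot_self: "dot d v v = sq d v"
  by (simp add: dot_def sq_def power2_eq_square)

lemma dot_commute: "dot d u v = dot d v u"
  by (simp add: dot_def mult.commute)

lemma dot_cong: "(\<And>i. i < d \<Longrightarrow> u i = u' i) \<Longrightarrow> (\<And>i. i < d \<Longrightarrow> v i = v' i) \<Longrightarrow> dot d u v = dot d u' v'"
  by (simp add: dot_def)

lemma sq_cong: "(\<And>i. i < d \<Longrightarrow> v i = v' i) \<Longrightarrow> sq d v = sq d v'"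
  by (simp add: sq_def)

lemma dot_add_right: "dot d u (\<lambda>i. v i + w i) = dot d u v + dot d u w"
  by (simp add: dot_def algebra_simps sum.distrib)

lemma dot_diff_right: "dot d u (\<lambda>i. v i - w i) = dot d u v - dot d u w"
  by (simp add: dot_def algebra_simps sum_subtractf)

lemma dot_scale_right: "dot d u (\<lambda>i. c * v i) = c * dot d u v"
  by (simp add: dot_def algebra_simps sum_distrib_left)

lemma sq_scale: "sq d (\<lambda>i. c * v i) = c\<^sup>2 * sq d v"
  by (simp add: sq_def algebra_simps sum_distrib_left power_mult_distrib)

lemma sq_diff: "sq d (\<lambda>i. v i - w i) = dot d v v - 2 * dot d v w + dot d w w"
  unfolding sq_def dot_def sum_distrib_left sum.distrib[symmetric] sum_subtractf[symmetric]
  by (intro sum.cong refl) (simp add: power2_eq_square algebra_simps)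

lemma dot_sum_right: "dot d u (\<lambda>i. \<Sum>p\<in>P. t p * B i p) = (\<Sum>p\<in>P. t p * dot d u (column B p))"
proof -
  have "dot d u (\<lambda>i. \<Sum>p\<in>P. t p * B i p) = (\<Sum>i<d. \<Sum>p\<in>P. t p * (u i * B i p))"
    unfolding dot_def by (simp add: sum_distrib_left algebra_simps)
  also have "\<dots> = (\<Sum>p\<in>P. t p * dot d u (column B p))"
    unfolding dot_def by (subst sum.swap) (simp add: sum_distrib_left)
  finally show ?thesis .
qed

lemma dot_sum_left: "dot d (\<lambda>i. \<Sum>p\<in>P. t p * B i p) v = (\<Sum>p\<in>P. t p * dot d (column B p) v)"
  unfolding dot_commute[of d _ v] by (rule dot_sum_right)

lemma dot_square_le: "(dot d u v)\<^sup>2 \<le> sq d u * sq d v"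
proof -
  let ?a = "sq d u" and ?b = "dot d u v" and ?c = "sq d v"
  have *: "0 \<le> s\<^sup>2 * ?a - 2 * s * t * ?b + t\<^sup>2 * ?c" for s t :: real
  proof -
    have "0 \<le> (\<Sum>i<d. (s * u i - t * v i)\<^sup>2)" by (simp add: sum_nonneg)
    also have "\<dots> = s\<^sup>2 * ?a - 2 * s * t * ?b + t\<^sup>2 * ?c"
      unfolding sq_def dot_def sum_distrib_left sum.distrib[symmetric] sum_subtractf[symmetric]
      by (intro sum.cong refl) (simp add: power2_eq_square algebra_simps)
    finally show ?thesis .
  qed
  show ?thesis
  proof (cases "?c = 0")
    case False
    then have "0 < ?c" using sq_nonneg[of d v] by linarith
    from *[of ?c ?b] have "0 \<le> ?c * (?a * ?c - ?b\<^sup>2)"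
      by (simp add: algebra_simps power2_eq_square)
    then show ?thesis using \<open>0 < ?c\<close> by (simp add: zero_le_mult_iff)
  next
    case True
    \<comment> \<open>With |v| = 0 the quadratic term in t vanishes; t = a + 1 makes the mixed term
      outweigh s^2 a, which forces the inner product b to be 0.\<close>
    from *[of ?b "?a + 1"] True have "0 \<le> - (?b\<^sup>2 * (?a + 2))"
      by (simp add: algebra_simps power2_eq_square)
    moreover have "0 < ?a + 2" using sq_nonneg[of d u] by linarith
    ultimately have "?b\<^sup>2 \<le> 0"
      by (simp add: mult_le_0_iff)
    then show ?thesis by (simp add: True)
  qed
qed

section \<open>Bessel's inequality for nearly orthogonal and for orthonormal columns\<close>

lemma twice_le_add_of_square_le:
  fixes a b c :: real
  assumes "0 \<le> a" "0 \<le> b" "c\<^sup>2 \<le> a * b"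
  shows "2 * c \<le> a + b"
proof -
  have "(2 * c)\<^sup>2 \<le> (a + b)\<^sup>2"
    using assms(3) sum_squares_ge_zero[of "a - b" 0] by (simp add: power2_eq_square algebra_simps)
  then show ?thesis using assms(1,2) by (meson add_nonneg_nonneg power2_le_imp_le)
qed

text \<open>The combination \<open>w\<close> of the columns with weights \<open>t\<close> satisfies
  <u, w> = s, where s is the sum to be bounded. In |w|^2 the diagonal terms give s; cosines of at
  most 1/m and the inequality of the means bound every other term by 1/(2m) of two diagonal ones,
  together at most s. So |w|^2 \<le> 2 s, and s^2 \<le> |u|^2 |w|^2 gives the claim. For orthogonal
  columns the constant 2 would be 1.\<close>

lemma near_orthogonal_bessel:
  assumes pos: "\<And>p. p < m \<Longrightarrow> 0 < sq d (column B p)"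
    and near: "\<And>p q. p < m \<Longrightarrow> q < m \<Longrightarrow> p \<noteq> q \<Longrightarrow>
      (real m)\<^sup>2 * (dot d (column B p) (column B q))\<^sup>2 \<le> sq d (column B p) * sq d (column B q)"
  shows "(\<Sum>p<m. (dot d u (column B p))\<^sup>2 / sq d (column B p)) \<le> 2 * sq d u"
proof -
  let ?x = "\<lambda>p. sq d (column B p)" and ?g = "\<lambda>p q. dot d (column B p) (column B q)"
  define t where "t p = dot d u (column B p) / ?x p" for p
  define w where "w i = (\<Sum>p<m. t p * B i p)" for i
  define s where "s = (\<Sum>p<m. (dot d u (column B p))\<^sup>2 / ?x p)"
  have s0: "0 \<le> s" unfolding s_def by (intro sum_nonneg) (simp)
  have tx: "(t p)\<^sup>2 * ?x p = (dot d u (column B p))\<^sup>2 / ?x p" if "p < m" for p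
    using pos[OF that] by (simp add: t_def power2_eq_square)
  have s_eq: "s = (\<Sum>p<m. (t p)\<^sup>2 * ?x p)"
    unfolding s_def using tx by simp
  have "dot d u w = s"
    unfolding w_def dot_sum_right s_def t_def by (simp add: power2_eq_square)
  have "sq d w = (\<Sum>p<m. \<Sum>q<m. t p * t q * ?g p q)"
  proof -
    have "sq d w = dot d w (\<lambda>i. \<Sum>p<m. t p * B i p)" by (simp add: dot_self w_def[abs_def])
    also have "\<dots> = (\<Sum>p<m. t p * dot d (column B p) (\<lambda>i. \<Sum>q<m. t q * B i q))"
      unfolding dot_sum_right dot_sum_left w_def[abs_def]
      by (intro sum.cong refl arg_cong2[where f = "(*)"] dot_commute)
    also have "\<dots> = (\<Sum>p<m. \<Sum>q<m. t p * t q * ?g p q)"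
      unfolding dot_sum_right by (simp add: sum_distrib_left mult.assoc)
    finally show ?thesis .
  qed
  also have "\<dots> \<le> (\<Sum>p<m. \<Sum>q<m. (if p = q then (t p)\<^sup>2 * ?x p else 0) +
      ((t p)\<^sup>2 * ?x p + (t q)\<^sup>2 * ?x q) / (2 * real m))"
  proof (intro sum_mono)
    fix p q assume "p \<in> {..<m}" "q \<in> {..<m}"
    then have pq: "p < m" "q < m" by auto
    then have m: "0 < real m" by simp
    show "t p * t q * ?g p q \<le> (if p = q then (t p)\<^sup>2 * ?x p else 0) +
      ((t p)\<^sup>2 * ?x p + (t q)\<^sup>2 * ?x q) / (2 * real m)"
    proof (cases "p = q")
      case True
      have "0 \<le> (t p)\<^sup>2 * ?x p / real m" by simp
      then show ?thesis using True by (simp add: dot_self power2_eq_square mult.assoc)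
    next
      case False
      have "(real m * (t p * t q * ?g p q))\<^sup>2 = (t p)\<^sup>2 * (t q)\<^sup>2 * ((real m)\<^sup>2 * (?g p q)\<^sup>2)"
        by (simp add: power_mult_distrib)
      also have "\<dots> \<le> (t p)\<^sup>2 * (t q)\<^sup>2 * (?x p * ?x q)"
        by (intro mult_left_mono near pq False) simp
      finally have "2 * (real m * (t p * t q * ?g p q)) \<le> (t p)\<^sup>2 * ?x p + (t q)\<^sup>2 * ?x q"
        by (intro twice_le_add_of_square_le) (simp_all add: ac_simps)
      then show ?thesis using False m by (simp add: field_simps)
    qed
  qed
  also have "\<dots> = s + (\<Sum>p<m. \<Sum>q<m. ((t p)\<^sup>2 * ?x p + (t q)\<^sup>2 * ?x q) / (2 * real m))"
    by (simp add: sum.distrib s_eq)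
  also have "(\<Sum>p<m. \<Sum>q<m. ((t p)\<^sup>2 * ?x p + (t q)\<^sup>2 * ?x q) / (2 * real m)) =
     (real m * s + real m * s) / (2 * real m)"
    by (simp add: sum.distrib s_eq sum_divide_distrib[symmetric] sum_distrib_left)
  also have "\<dots> \<le> s" using s0 by (cases "m = 0") (simp_all add: field_simps)
  finally have "sq d w \<le> 2 * s" by simp
  have "s * s \<le> sq d u * sq d w"
    using dot_square_le[of d u w] \<open>dot d u w = s\<close> by (simp add: power2_eq_square)
  also have "\<dots> \<le> sq d u * (2 * s)" by (intro mult_left_mono \<open>sq d w \<le> 2 * s\<close>) simp
  finally have "s * s \<le> (2 * sq d u) * s" by simp
  then have "s \<le> 2 * sq d u"
    using s0 by (cases "s = 0") (auto simp: mult_le_cancel_right)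
  then show ?thesis by (simp add: s_def)
qed

definition orthonormal :: "nat \<Rightarrow> nat \<Rightarrow> (nat \<Rightarrow> nat \<Rightarrow> real) \<Rightarrow> bool" where
  "orthonormal d k U \<longleftrightarrow>
     (\<forall>j<k. \<forall>l<k. dot d (column U j) (column U l) = (if j = l then 1 else 0))"

lemma orthonormal_sq: "orthonormal d k U \<Longrightarrow> j < k \<Longrightarrow> sq d (column U j) = 1"
  by (simp add: orthonormal_def dot_self[symmetric])

text \<open>Pythagoras, column by column: projecting onto an orthonormal family removes exactly the
  squared coefficients.\<close>

lemma projection_residual:
  assumes "orthonormal d k U"
  shows "(\<Sum>p<m. sq d (\<lambda>i. B i p - (\<Sum>l<k. dot d (column U l) (column B p) * U i l))) =
    total_sq d m B - (\<Sum>l<k. energy d m B (column U l))"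
proof -
  have "sq d (\<lambda>i. b i - (\<Sum>l<k. dot d (column U l) b * U i l)) =
      sq d b - (\<Sum>l<k. (dot d (column U l) b)\<^sup>2)" for b
  proof -
    let ?c = "\<lambda>l. dot d (column U l) b"
    let ?w = "\<lambda>i. \<Sum>l<k. ?c l * U i l"
    have bw: "dot d b ?w = (\<Sum>l<k. (?c l)\<^sup>2)"
      unfolding dot_sum_right by (simp add: power2_eq_square dot_commute[of d b])
    have "dot d (column U j) ?w = ?c j" if "j < k" for j
    proof -
      have "dot d (column U j) ?w = (\<Sum>l<k. if l = j then ?c l else 0)"
        unfolding dot_sum_right using assms that
        by (intro sum.cong) (auto simp: orthonormal_def)
      then show ?thesis using that by simp
    qed
    then have ww: "dot d ?w ?w = (\<Sum>l<k. (?c l)\<^sup>2)"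
      by (subst dot_sum_right) (simp add: power2_eq_square dot_commute[of d ?w])
    have "sq d (\<lambda>i. b i - ?w i) = dot d b b - 2 * dot d b ?w + dot d ?w ?w"
      by (rule sq_diff)
    then show ?thesis by (simp add: bw ww[unfolded dot_self] dot_self)
  qed
  then show ?thesis
    unfolding total_sq_def energy_def by (simp add: sum_subtractf sum.swap[of _ "{..<k}"])
qed

lemma energy_sum_le_total:
  assumes "orthonormal d k U"
  shows "(\<Sum>l<k. energy d m B (column U l)) \<le> total_sq d m B"
proof -
  have "0 \<le> (\<Sum>p<m. sq d (\<lambda>i. B i p - (\<Sum>l<k. dot d (column U l) (column B p) * U i l)))"
    by (simp add: sum_nonneg)
  then show ?thesis using projection_residual[OF assms, of B m] by simp
qed

section \<open>Sketching the columns\<close>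

text \<open>
  Here \<open>D\<close> is the total amount by which the squared column norms have been lowered
  in all shrinking steps so far, and \<open>f\<close> bounds the squared norm of a discarded column.
\<close>

definition fd_inv where
  "fd_inv d m a f c B D \<longleftrightarrow> 0 \<le> D \<and> (\<forall>u. energy d m B u \<le> energy d c a u) \<and>
     (\<forall>u. energy d c a u \<le> energy d m B u + (2 * D + real c * f) * sq d u) \<and>
     total_sq d m B + real m * D \<le> total_sq d c a"

definition fd_potential where
  "fd_potential d m B f = (\<Sum>p<m. ln (1 + sq d (column B p) / f))"

text \<open>
  A rotation lowers the potential by at least \<open>1 / (4 m\<^sup>2)\<close>, a shrinking step by at least \<open>ln 2\<close>,
  and inserting a column \<open>y\<close> raises it by at most \<open>\<parallel>y\<parallel>\<^sup>2 / f\<close>.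
\<close>

definition fd_measure where
  "fd_measure d n m a f c B = 4 * (real m)\<^sup>2 * fd_potential d m B f +
     (\<Sum>j=c..<n. 4 * (real m)\<^sup>2 * (sq d (column a j) / f) + 1)"

section \<open>The three moves on the buffer: inserting, rotating, shrinking\<close>

lemma sum_update1:
  fixes g :: "nat \<Rightarrow> real"
  assumes "p < m" "\<And>r. r < m \<Longrightarrow> r \<noteq> p \<Longrightarrow> g' r = g r"
  shows "sum g' {..<m} = sum g {..<m} - g p + g' p"
proof -
  have "sum g' ({..<m} - {p}) = sum g ({..<m} - {p})" using assms by (intro sum.cong) auto
  then show ?thesis using assms(1) by (simp add: sum.remove[of "{..<m}" p])
qed

lemma sum_update2:
  fixes g :: "nat \<Rightarrow> real"
  assumes "p < m" "q < m" "p \<noteq> q" "\<And>r. r < m \<Longrightarrow> r \<noteq> p \<Longrightarrow> r \<noteq> q \<Longrightarrow> g' r = g r"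
  shows "sum g' {..<m} = sum g {..<m} - g p - g q + g' p + g' q"
proof -
  have "sum (g(p := g' p)) {..<m} = sum g {..<m} - g p + (g(p := g' p)) p"
    by (rule sum_update1) (use assms in auto)
  moreover have "sum g' {..<m} = sum (g(p := g' p)) {..<m} - (g(p := g' p)) q + g' q"
    by (rule sum_update1) (use assms in auto)
  ultimately show ?thesis using assms(3) by simp
qed

lemma fd_potential_nonneg:
  assumes "0 < f" shows "0 \<le> fd_potential d m B f"
  unfolding fd_potential_def using assms by (intro sum_nonneg) simp

lemma fd_measure_nonneg:
  assumes "0 < f" shows "0 \<le> fd_measure d n m a f c B"
  unfolding fd_measure_def using fd_potential_nonneg[OF assms] assms
  by (intro add_nonneg_nonneg sum_nonneg mult_nonneg_nonneg) auto

lemma fd_inv_zero: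
  assumes "\<And>i p. i < d \<Longrightarrow> p < m \<Longrightarrow> B i p = 0"
  shows "fd_inv d m a f 0 B 0"
  using assms by (simp add: fd_inv_def energy_def total_sq_def sq_def dot_def)

lemma fd_measure_zero:
  assumes "\<And>i p. i < d \<Longrightarrow> p < m \<Longrightarrow> B i p = 0"
  shows "fd_measure d n m a f 0 B = 4 * (real m)\<^sup>2 * (total_sq d n a / f) + real n"
  using assms by (simp add: fd_measure_def fd_potential_def total_sq_def sq_def sum.distrib
      sum_distrib_left sum_divide_distrib atLeast0LessThan)

text \<open>By Cauchy-Schwarz the overwritten column contributes at most f |u|^2 to any energy,
  which is the growth of the slack from \<open>c\<close> to \<open>Suc c\<close>. The new column
  enters both sides equally, and discarding the old one cannot raise the energy or the trace of the
  buffer.\<close>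

lemma fd_inv_insert:
  assumes inv: "fd_inv d m a f c B D" and p: "p < m" "sq d (column B p) \<le> f"
    and new: "\<And>i. i < d \<Longrightarrow> B' i p = a i c"
    and old: "\<And>i q. i < d \<Longrightarrow> q < m \<Longrightarrow> q \<noteq> p \<Longrightarrow> B' i q = B i q"
  shows "fd_inv d m a f (Suc c) B' D"
proof -
  have en: "energy d m B' u = energy d m B u - (dot d u (column B p))\<^sup>2 + (dot d u (column a c))\<^sup>2" for u
  proof -
    have "dot d u (column B' q) = dot d u (column B q)" if "q < m" "q \<noteq> p" for q
      using old that by (intro dot_cong) auto
    moreover have "dot d u (column B' p) = dot d u (column a c)"
      using new by (intro dot_cong) auto
    ultimately show ?thesis
      unfolding energy_def by (subst sum_update1[OF p(1)]) auto
  qed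
  have tot: "total_sq d m B' = total_sq d m B - sq d (column B p) + sq d (column a c)"
  proof -
    have "sq d (column B' q) = sq d (column B q)" if "q < m" "q \<noteq> p" for q
      using old that by (intro sq_cong) auto
    moreover have "sq d (column B' p) = sq d (column a c)"
      using new by (intro sq_cong) auto
    ultimately show ?thesis
      unfolding total_sq_def by (subst sum_update1[OF p(1)]) auto
  qed
  have ea: "energy d (Suc c) a u = energy d c a u + (dot d u (column a c))\<^sup>2" for u
    by (simp add: energy_def)
  have ta: "total_sq d (Suc c) a = total_sq d c a + sq d (column a c)"
    by (simp add: total_sq_def)
  have drop: "(dot d u (column B p))\<^sup>2 \<le> f * sq d u" for u
    using dot_square_le[of d u "column B p"] mult_left_mono[OF p(2) sq_nonneg[of d u]]
    by (simp add: mult.commute)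
  have "energy d (Suc c) a u \<le> energy d m B' u + (2 * D + real (Suc c) * f) * sq d u" for u
  proof -
    have "energy d c a u \<le> energy d m B u + (2 * D + real c * f) * sq d u"
      using inv by (simp add: fd_inv_def)
    then show ?thesis using drop[of u] by (simp add: en ea algebra_simps)
  qed
  moreover have "energy d m B' u \<le> energy d (Suc c) a u" for u
  proof -
    have "energy d m B u \<le> energy d c a u" using inv by (simp add: fd_inv_def)
    then show ?thesis
      using zero_le_power2[of "dot d u (column B p)"] unfolding en ea by linarith
  qed
  moreover have "total_sq d m B' + real m * D \<le> total_sq d (Suc c) a"
  proof -
    have "total_sq d m B + real m * D \<le> total_sq d c a" using inv by (simp add: fd_inv_def)
    then show ?thesis using sq_nonneg[of d "column B p"] unfolding tot ta by linarith
  qed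
  ultimately show ?thesis using inv by (simp add: fd_inv_def)
qed

text \<open>The sum over the columns still to come holds a credit for column \<open>c\<close>: its
  first part covers the rise of the potential, by ln (1 + t) \<le> t, and its 1 pays for the step.
  Discarding the old column does not raise the potential.\<close>

lemma fd_measure_insert:
  assumes "0 < f" "p < m" "c < n"
    and new: "\<And>i. i < d \<Longrightarrow> B' i p = a i c"
    and old: "\<And>i q. i < d \<Longrightarrow> q < m \<Longrightarrow> q \<noteq> p \<Longrightarrow> B' i q = B i q"
  shows "fd_measure d n m a f (Suc c) B' + 1 \<le> fd_measure d n m a f c B"
proof -
  let ?x = "sq d (column B p)" and ?y = "sq d (column a c)"
  have "fd_potential d m B' f = fd_potential d m B f - ln (1 + ?x / f) + ln (1 + ?y / f)"
  proof -
    have "sq d (column B' q) = sq d (column B q)" if "q < m" "q \<noteq> p" for q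
      using old that by (intro sq_cong) auto
    moreover have "sq d (column B' p) = ?y"
      using new by (intro sq_cong) auto
    ultimately show ?thesis
      unfolding fd_potential_def by (subst sum_update1[OF \<open>p < m\<close>]) auto
  qed
  moreover have "0 \<le> ln (1 + ?x / f)" using \<open>0 < f\<close> by simp
  moreover have "ln (1 + ?y / f) \<le> ?y / f"
    using \<open>0 < f\<close> by (intro ln_add_one_self_le_self) simp
  ultimately have "fd_potential d m B' f \<le> fd_potential d m B f + ?y / f"
    by linarith
  then have "4 * (real m)\<^sup>2 * fd_potential d m B' f \<le> 4 * (real m)\<^sup>2 * (fd_potential d m B f + ?y / f)"
    by (intro mult_left_mono) auto
  then show ?thesis
    unfolding fd_measure_def using \<open>c < n\<close> by (simp add: sum.atLeast_Suc_lessThan algebra_simps)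
qed

text \<open>The buffer is multiplied from the right by a plane rotation, so B B^T is unchanged, and
  with it every energy and the trace.\<close>

lemma rotate_columns:
  assumes pq: "p < m" "q < m" "p \<noteq> q" and cs: "co\<^sup>2 + si\<^sup>2 = (1::real)"
    and p': "\<And>i. i < d \<Longrightarrow> B' i p = co * B i p + si * B i q"
    and q': "\<And>i. i < d \<Longrightarrow> B' i q = co * B i q - si * B i p"
    and old: "\<And>i r. i < d \<Longrightarrow> r < m \<Longrightarrow> r \<noteq> p \<Longrightarrow> r \<noteq> q \<Longrightarrow> B' i r = B i r"
  shows "energy d m B' u = energy d m B u" "total_sq d m B' = total_sq d m B"
    "sq d (column B' p) = co\<^sup>2 * sq d (column B p) + 2 * co * si * dot d (column B p) (column B q)
       + si\<^sup>2 * sq d (column B q)"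
    "sq d (column B' q) = co\<^sup>2 * sq d (column B q) - 2 * co * si * dot d (column B p) (column B q)
       + si\<^sup>2 * sq d (column B p)"
    "r < m \<Longrightarrow> r \<noteq> p \<Longrightarrow> r \<noteq> q \<Longrightarrow> sq d (column B' r) = sq d (column B r)"
proof -
  have pe: "dot d u (column B' p) = co * dot d u (column B p) + si * dot d u (column B q)"
    by (simp add: p' dot_add_right[symmetric] dot_scale_right[symmetric] cong: dot_cong)
  have qe: "dot d u (column B' q) = co * dot d u (column B q) - si * dot d u (column B p)"
    by (simp add: q' dot_diff_right[symmetric] dot_scale_right[symmetric] cong: dot_cong)
  have re: "dot d u (column B' r) = dot d u (column B r)" if "r < m" "r \<noteq> p" "r \<noteq> q" for r
    using old that by (intro dot_cong) auto
  have rs: "sq d (column B' r) = sq d (column B r)" if "r < m" "r \<noteq> p" "r \<noteq> q" for r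
    using old that by (intro sq_cong) auto
  then show "r < m \<Longrightarrow> r \<noteq> p \<Longrightarrow> r \<noteq> q \<Longrightarrow> sq d (column B' r) = sq d (column B r)" .
  show ps: "sq d (column B' p) = co\<^sup>2 * sq d (column B p)
       + 2 * co * si * dot d (column B p) (column B q) + si\<^sup>2 * sq d (column B q)"
    unfolding sq_def dot_def sum_distrib_left sum.distrib[symmetric]
    by (intro sum.cong refl) (simp add: p' power2_eq_square algebra_simps)
  show qs: "sq d (column B' q) = co\<^sup>2 * sq d (column B q)
       - 2 * co * si * dot d (column B p) (column B q) + si\<^sup>2 * sq d (column B p)"
    unfolding sq_def dot_def sum_distrib_left sum.distrib[symmetric] sum_subtractf[symmetric]
    by (intro sum.cong refl) (simp add: q' power2_eq_square algebra_simps)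
  let ?a = "dot d u (column B p)" and ?b = "dot d u (column B q)"
  have "(co * ?a + si * ?b)\<^sup>2 + (co * ?b - si * ?a)\<^sup>2 = (co\<^sup>2 + si\<^sup>2) * (?a\<^sup>2 + ?b\<^sup>2)"
    by (simp add: power2_eq_square algebra_simps)
  then show "energy d m B' u = energy d m B u"
    unfolding energy_def using cs re
    by (subst sum_update2[OF pq, where g = "\<lambda>r. (dot d u (column B r))\<^sup>2"]) (simp_all add: pe qe)
  have "sq d (column B' p) + sq d (column B' q) =
      (co\<^sup>2 + si\<^sup>2) * (sq d (column B p) + sq d (column B q))"
    unfolding ps qs by (simp add: algebra_simps)
  then show "total_sq d m B' = total_sq d m B"
    unfolding total_sq_def using cs rs
    by (subst sum_update2[OF pq, where g = "\<lambda>r. sq d (column B r)"]) simp_all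
qed

text \<open>The coefficients of the Jacobi rotation that diagonalises the Gram matrix of two columns.\<close>

lemma jacobi_rotation:
  fixes x y g :: real
  assumes "g \<noteq> 0"
  defines "w \<equiv> (y - x + sqrt ((x - y)\<^sup>2 + 4 * g\<^sup>2)) / 2"
  defines "r \<equiv> sqrt (g\<^sup>2 + w\<^sup>2)"
  shows "(g / r)\<^sup>2 + (w / r)\<^sup>2 = 1"
    and "((g / r)\<^sup>2 * x + 2 * (g / r) * (w / r) * g + (w / r)\<^sup>2 * y) *
      ((g / r)\<^sup>2 * y - 2 * (g / r) * (w / r) * g + (w / r)\<^sup>2 * x) = x * y - g\<^sup>2"
proof -
  have r2: "r\<^sup>2 = g\<^sup>2 + w\<^sup>2" unfolding r_def by simp
  have r0: "r \<noteq> 0" using assms(1) unfolding r_def by (simp add: add_nonneg_eq_0_iff)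
  show 1: "(g / r)\<^sup>2 + (w / r)\<^sup>2 = 1"
    using r0 by (simp add: power_divide add_divide_distrib[symmetric] r2[symmetric])
  have "2 * w - (y - x) = sqrt ((x - y)\<^sup>2 + 4 * g\<^sup>2)"
    unfolding w_def by (simp add: field_simps)
  then have "(2 * w - (y - x))\<^sup>2 = (x - y)\<^sup>2 + 4 * g\<^sup>2"
    by simp
  \<comment> \<open>This quadratic equation says that (g, w) is an eigenvector of the Gram matrix
    with rows (x, g) and (g, y), for the eigenvalue x + w.\<close>
  then have w2: "w\<^sup>2 = (y - x) * w + g\<^sup>2"
    by (simp add: power2_eq_square algebra_simps)
  define c s where "c = g / r" and "s = w / r"
  have "c\<^sup>2 * g + c * s * y - (s\<^sup>2 * g + c * s * x) = g * (g\<^sup>2 + w * (y - x) - w\<^sup>2) / r\<^sup>2"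
    unfolding c_def s_def using r0 by (simp add: power2_eq_square field_simps)
  also have "\<dots> = 0" by (simp add: w2)
  finally have z: "(c\<^sup>2 - s\<^sup>2) * g + c * s * (y - x) = 0" by (simp add: algebra_simps)
  \<comment> \<open>A rotation preserves the determinant of the Gram matrix. The second square is
    the inner product of the rotated columns, which vanishes by \<open>z\<close>, so the determinant
    is the product of the new squared norms.\<close>
  have "(c\<^sup>2 * x + 2 * c * s * g + s\<^sup>2 * y) * (c\<^sup>2 * y - 2 * c * s * g + s\<^sup>2 * x) =
      (c\<^sup>2 + s\<^sup>2)\<^sup>2 * (x * y - g\<^sup>2) + ((c\<^sup>2 - s\<^sup>2) * g + c * s * (y - x))\<^sup>2"
    by (simp add: power2_eq_square algebra_simps)
  then show "((g / r)\<^sup>2 * x + 2 * (g / r) * (w / r) * g + (w / r)\<^sup>2 * y) *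
      ((g / r)\<^sup>2 * y - 2 * (g / r) * (w / r) * g + (w / r)\<^sup>2 * x) = x * y - g\<^sup>2"
    using 1 z by (simp add: c_def s_def)
qed

text \<open>Keeping the sum of the two squared norms x, y and lowering their product by g^2 lowers P
  = (f + x) (f + y) by g^2 as well. Since x and y exceed \<open>f\<close>, P \<le> 4 x y \<le> 4 m^2
  g^2, so ln P falls by at least g^2 / P \<ge> 1 / (4 m^2). This estimate is the reason why columns
  of squared norm at most \<open>f\<close> are never rotated.\<close>

lemma fd_measure_rotate:
  assumes f: "0 < f" and pq: "p < m" "q < m" "p \<noteq> q"
    and xy: "f < sq d (column B p)" "f < sq d (column B q)"
    and corr: "sq d (column B p) * sq d (column B q) < (real m)\<^sup>2 * g\<^sup>2"
    and sum: "sq d (column B' p) + sq d (column B' q) = sq d (column B p) + sq d (column B q)"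
    and prod: "sq d (column B' p) * sq d (column B' q) = sq d (column B p) * sq d (column B q) - g\<^sup>2"
    and old: "\<And>r. r < m \<Longrightarrow> r \<noteq> p \<Longrightarrow> r \<noteq> q \<Longrightarrow> sq d (column B' r) = sq d (column B r)"
  shows "fd_measure d n m a f c B' + 1 \<le> fd_measure d n m a f c B"
proof -
  let ?x = "sq d (column B p)" and ?y = "sq d (column B q)"
  let ?x' = "sq d (column B' p)" and ?y' = "sq d (column B' q)"
  have m: "0 < real m" using pq by simp
  define P where "P = (f + ?x) * (f + ?y)"
  define P' where "P' = (f + ?x') * (f + ?y')"
  have P'_eq: "P' = P - g\<^sup>2"
  proof -
    have "P' = f * f + f * (?x' + ?y') + ?x' * ?y'" by (simp add: P'_def algebra_simps)
    also have "\<dots> = P - g\<^sup>2" unfolding sum prod P_def by (simp add: algebra_simps)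
    finally show ?thesis .
  qed
  have Ppos: "0 < P" unfolding P_def using f xy by (intro mult_pos_pos) auto
  have P'pos: "0 < P'" unfolding P'_def using f sq_nonneg by (intro mult_pos_pos add_pos_nonneg) auto
  have "P \<le> (2 * ?x) * (2 * ?y)" unfolding P_def using f xy by (intro mult_mono) auto
  also have "\<dots> \<le> 4 * ((real m)\<^sup>2 * g\<^sup>2)" using corr by simp
  finally have "P \<le> 4 * (real m)\<^sup>2 * g\<^sup>2" by simp
  then have ge: "1 \<le> 4 * (real m)\<^sup>2 * (g\<^sup>2 / P)" using Ppos by (simp add: field_simps)
  have ln_le: "ln P' \<le> ln P - g\<^sup>2 / P"
  proof -
    have "ln (P' / P) \<le> P' / P - 1" using Ppos P'pos by (intro ln_le_minus_one) simp
    moreover have "P' / P - 1 = - (g\<^sup>2 / P)" using Ppos by (simp add: P'_eq field_simps)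
    ultimately show ?thesis using Ppos P'pos by (simp add: ln_div)
  qed
  have split: "ln (1 + s / f) + ln (1 + t / f) = ln ((f + s) * (f + t)) - 2 * ln f"
    if "0 \<le> s" "0 \<le> t" for s t
  proof -
    have "1 + s / f = (f + s) / f" "1 + t / f = (f + t) / f" using f by (simp_all add: field_simps)
    then show ?thesis using f that by (simp add: ln_div ln_mult add_pos_nonneg)
  qed
  have "fd_potential d m B' f = fd_potential d m B f - (ln (1 + ?x / f) + ln (1 + ?y / f))
      + (ln (1 + ?x' / f) + ln (1 + ?y' / f))"
    unfolding fd_potential_def using old
    by (subst sum_update2[OF pq, where g = "\<lambda>r. ln (1 + sq d (column B r) / f)"]) simp_all
  also have "\<dots> = fd_potential d m B f - ln P + ln P'"
    by (simp add: split P_def P'_def)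
  finally have "fd_potential d m B' f \<le> fd_potential d m B f - g\<^sup>2 / P" using ln_le by simp
  then have "4 * (real m)\<^sup>2 * fd_potential d m B' f \<le> 4 * (real m)\<^sup>2 * (fd_potential d m B f - g\<^sup>2 / P)"
    by (intro mult_left_mono) auto
  then show ?thesis unfolding fd_measure_def using ge by (simp add: algebra_simps)
qed

text \<open>Lowering the squared norm of a column b by \<open>la\<close> multiplies <u, b>^2 by 1 -
  la / |b|^2; the total loss is the sum that Bessel's inequality controls.\<close>

lemma shrink_columns:
  assumes x: "\<And>p. p < m \<Longrightarrow> 0 < sq d (column B p)" and la: "\<And>p. p < m \<Longrightarrow> la \<le> sq d (column B p)"
    and B': "\<And>i p. i < d \<Longrightarrow> p < m \<Longrightarrow> B' i p = B i p * sqrt (1 - la / sq d (column B p))"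
  shows "p < m \<Longrightarrow> sq d (column B' p) = sq d (column B p) - la"
    "energy d m B' u = energy d m B u - la * (\<Sum>p<m. (dot d u (column B p))\<^sup>2 / sq d (column B p))"
proof -
  have s: "(sqrt (1 - la / sq d (column B p)))\<^sup>2 = 1 - la / sq d (column B p)" if "p < m" for p
    using x[OF that] la[OF that] by simp
  show "sq d (column B' p) = sq d (column B p) - la" if "p < m" for p
  proof -
    have "sq d (column B' p) = sq d (\<lambda>i. sqrt (1 - la / sq d (column B p)) * B i p)"
      using B' that by (intro sq_cong) auto
    also have "\<dots> = sq d (column B p) - la"
      unfolding sq_scale s[OF that] using x[OF that] by (simp add: field_simps)
    finally show ?thesis .
  qed
  have "(dot d u (column B' p))\<^sup>2 = (dot d u (column B p))\<^sup>2 - la * ((dot d u (column B p))\<^sup>2 / sq d (column B p))"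
    if "p < m" for p
  proof -
    have "dot d u (column B' p) = dot d u (\<lambda>i. sqrt (1 - la / sq d (column B p)) * B i p)"
      using B' that by (intro dot_cong) auto
    then show ?thesis
      unfolding dot_scale_right by (simp add: power_mult_distrib s[OF that] algebra_simps)
  qed
  then show "energy d m B' u = energy d m B u - la * (\<Sum>p<m. (dot d u (column B p))\<^sup>2 / sq d (column B p))"
    unfolding energy_def by (simp add: sum_subtractf sum_distrib_left)
qed

text \<open>The near-orthogonal Bessel inequality bounds the loss in each energy by 2 la |u|^2,
  whereas the trace falls by exactly m la; this gap makes shrinking affordable. The smallest column
  \<open>q\<close> becomes zero and its logarithm disappears from the potential.\<close>

lemma fd_shrink:
  assumes inv: "fd_inv d m a f c B D" and f: "0 < f" "f < la" and q: "q < m" "sq d (column B q) = la"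
    and la: "\<And>p. p < m \<Longrightarrow> la \<le> sq d (column B p)"
    and near: "\<And>p q. p < m \<Longrightarrow> q < m \<Longrightarrow> p \<noteq> q \<Longrightarrow>
      (real m)\<^sup>2 * (dot d (column B p) (column B q))\<^sup>2 \<le> sq d (column B p) * sq d (column B q)"
    and B': "\<And>i p. i < d \<Longrightarrow> p < m \<Longrightarrow> B' i p = B i p * sqrt (1 - la / sq d (column B p))"
  shows "fd_inv d m a f c B' (D + la)"
    and "fd_measure d n m a f c B' + 1 \<le> fd_measure d n m a f c B"
proof -
  have x: "0 < sq d (column B p)" if "p < m" for p using la[OF that] f by linarith
  have sh: "sq d (column B' p) = sq d (column B p) - la" if "p < m" for p
    by (rule shrink_columns(1)[of m d B la B']) (use x la B' that in auto)
  have she: "energy d m B' u = energy d m B u - la * (\<Sum>p<m. (dot d u (column B p))\<^sup>2 / sq d (column B p))" for u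
    by (rule shrink_columns(2)[of m d B la B']) (use x la B' in auto)
  let ?S = "\<lambda>u. \<Sum>p<m. (dot d u (column B p))\<^sup>2 / sq d (column B p)"
  have S2: "la * ?S u \<le> 2 * la * sq d u" for u
    using mult_left_mono[OF near_orthogonal_bessel[of m d B u, OF x near], of la] f by simp
  have S0: "0 \<le> la * ?S u" for u
    using f by (intro mult_nonneg_nonneg sum_nonneg) auto
  have "total_sq d m B' = total_sq d m B - real m * la"
    unfolding total_sq_def by (simp add: sh sum_subtractf)
  moreover have "energy d c a u \<le> energy d m B' u + (2 * (D + la) + real c * f) * sq d u" for u
  proof -
    have "energy d c a u \<le> energy d m B u + (2 * D + real c * f) * sq d u"
      using inv by (simp add: fd_inv_def)
    then show ?thesis using S2[of u] by (simp add: she algebra_simps)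
  qed
  moreover have "energy d m B' u \<le> energy d c a u" for u
  proof -
    have "energy d m B u \<le> energy d c a u" using inv by (simp add: fd_inv_def)
    then show ?thesis using S0[of u] by (simp add: she)
  qed
  ultimately show "fd_inv d m a f c B' (D + la)"
    using inv f by (simp add: fd_inv_def algebra_simps)
  let ?l = "\<lambda>p. ln (1 + sq d (column B p) / f)" and ?l' = "\<lambda>p. ln (1 + sq d (column B' p) / f)"
  have "?l' p \<le> ?l p" if "p < m" for p
    using sh[OF that] la[OF that] f
    by (subst ln_le_cancel_iff) (auto simp: divide_right_mono add_pos_nonneg)
  then have "(\<Sum>p\<in>{..<m} - {q}. ?l' p) \<le> (\<Sum>p\<in>{..<m} - {q}. ?l p)"
    by (intro sum_mono) auto
  moreover have "?l' q = 0" using sh[OF q(1)] q(2) by simp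
  \<comment> \<open>A crude bound that suffices: multiplied by 4 m^2 it is at least 1.\<close>
  moreover have "1 / 4 \<le> ?l q"
  proof -
    have "1 / 2 \<le> 1 - 1 / (1 + la / f)" using f by (simp add: field_simps)
    also have "\<dots> \<le> ln (1 + la / f)"
    proof -
      have "ln (1 / (1 + la / f)) \<le> 1 / (1 + la / f) - 1"
        using f by (intro ln_le_minus_one) (simp add: add_pos_pos)
      moreover have "0 < 1 + la / f" using f by (simp add: add_pos_pos)
      ultimately show ?thesis by (simp add: ln_div)
    qed
    finally show ?thesis using q by simp
  qed
  ultimately have "fd_potential d m B' f + 1 / 4 \<le> fd_potential d m B f"
    unfolding fd_potential_def using q(1) by (simp add: sum.remove[of "{..<m}" q])
  then have "4 * (real m)\<^sup>2 * (fd_potential d m B' f + 1 / 4) \<le> 4 * (real m)\<^sup>2 * fd_potential d m B f"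
    by (intro mult_left_mono) auto
  moreover have "1 \<le> (real m)\<^sup>2" using q(1) by simp
  ultimately show "fd_measure d n m a f c B' + 1 \<le> fd_measure d n m a f c B"
    unfolding fd_measure_def by (simp add: algebra_simps)
qed

text \<open>
  The trace drops by \<open>m\<close> times the shrinkage \<open>D\<close>, while the energy of any \<open>k\<close>-dimensional
  projection drops by at most \<open>2 k D\<close>; hence \<open>D\<close> is bounded by the cost of the projection.
\<close>

lemma fd_projection_energy:
  assumes inv: "fd_inv d m a f n B D" and U: "orthonormal d k U"
    and m: "2 * real k + 2 * real k / \<epsilon> \<le> real m" and "0 < \<epsilon>" "\<epsilon> < 1" "0 \<le> h"
    and f: "real k * (real n * f) \<le> h"
  defines "E \<equiv> (\<Sum>l<k. energy d n a (column U l))"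
  shows "E \<le> (\<Sum>l<k. energy d m B (column U l)) + \<epsilon> * (total_sq d n a - E) + 2 * h"
proof -
  let ?EB = "\<Sum>l<k. energy d m B (column U l)"
  have "energy d n a (column U l) \<le> energy d m B (column U l) + (2 * D + real n * f)" if "l < k" for l
    using inv orthonormal_sq[OF U that] unfolding fd_inv_def by (metis mult.right_neutral)
  then have "E \<le> (\<Sum>l<k. energy d m B (column U l) + (2 * D + real n * f))"
    unfolding E_def by (intro sum_mono) auto
  also have "\<dots> = ?EB + 2 * real k * D + real k * (real n * f)"
    by (simp add: sum.distrib algebra_simps)
  finally have 1: "E \<le> ?EB + 2 * real k * D + h" using f by linarith
  have D: "0 \<le> D" using inv by (simp add: fd_inv_def)
  have "?EB + real m * D \<le> total_sq d n a"
    using energy_sum_le_total[OF U, of m B] inv by (simp add: fd_inv_def)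
  \<comment> \<open>The first summand of the lower bound on m offsets the energy 2 k D lost by the
    projection; the second leaves 2 k D / \<epsilon>, which is therefore at most the cost plus
    \<open>h\<close>. This is the origin of m = 2 k + 2 k / \<epsilon>.\<close>
  moreover have "(2 * real k + 2 * real k / \<epsilon>) * D \<le> real m * D" by (intro mult_right_mono m D)
  ultimately have "2 * real k / \<epsilon> * D \<le> total_sq d n a - E + h"
    using 1 by (simp add: algebra_simps)
  then have "2 * real k * D \<le> \<epsilon> * (total_sq d n a - E + h)"
    using \<open>0 < \<epsilon>\<close> by (simp add: field_simps)
  moreover have "\<epsilon> * h \<le> h" using \<open>\<epsilon> < 1\<close> \<open>0 \<le> h\<close> by (simp add: mult_left_le_one_le mult_le_cancel_right2)
  ultimately show ?thesis using 1 by (simp add: algebra_simps)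
qed

section \<open>Enumeration of the coefficient grid\<close>

text \<open>Colexicographic order: the largest index at which two points differ decides. An odometer
  that carries from index 0 upwards runs through the grid in this order.\<close>

definition colex :: "nat \<Rightarrow> (nat \<Rightarrow> nat) \<Rightarrow> (nat \<Rightarrow> nat) \<Rightarrow> bool" where
  "colex Q z z' \<longleftrightarrow> (\<exists>q<Q. z q < z' q \<and> (\<forall>r<Q. q < r \<longrightarrow> z r = z' r))"

definition grid :: "nat \<Rightarrow> nat \<Rightarrow> (nat \<Rightarrow> nat) set" where
  "grid Q R = {z. (\<forall>q\<ge>Q. z q = 0) \<and> (\<Sum>q<Q. z q) \<le> R}"

lemma colex_irrefl: "\<not> colex Q z z"
  by (simp add: colex_def)

lemma colex_trans:
  assumes "colex Q x y" "colex Q y z" shows "colex Q x z"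
proof -
  from assms obtain p q where p: "p < Q" "x p < y p" "\<And>r. r < Q \<Longrightarrow> p < r \<Longrightarrow> x r = y r"
    and q: "q < Q" "y q < z q" "\<And>r. r < Q \<Longrightarrow> q < r \<Longrightarrow> y r = z r"
    unfolding colex_def by blast
  show ?thesis
  proof (cases "p < q")
    case True
    then show ?thesis unfolding colex_def using p q by (intro exI[of _ q]) auto
  next
    case False
    then consider "p = q" | "q < p" by linarith
    then show ?thesis
      by cases (use p q in \<open>auto simp: colex_def intro!: exI[of _ p]\<close>)
  qed
qed

lemma colex_total:
  assumes "z \<in> grid Q R" "y \<in> grid Q R"
  shows "z = y \<or> colex Q z y \<or> colex Q y z"
proof (cases "z = y")
  case False
  let ?D = "{q. q < Q \<and> z q \<noteq> y q}"
  have "?D \<noteq> {}"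
  proof
    assume D: "?D = {}"
    have "z q = y q" for q
      using D assms by (cases "q < Q") (auto simp: grid_def)
    then show False using False by auto
  qed
  then have M: "Max ?D \<in> ?D" by (intro Max_in) auto
  have "z r = y r" if "r < Q" "Max ?D < r" for r
  proof (rule ccontr)
    assume "z r \<noteq> y r"
    then have "r \<le> Max ?D" using that by (intro Max_ge) auto
    with that show False by simp
  qed
  then show ?thesis
    using M unfolding colex_def by (metis (mono_tags, lifting) mem_Collect_eq nat_neq_iff)
qed simp

lemma finite_grid: "finite (grid Q R)"
proof -
  have "grid Q R \<subseteq> {z. \<forall>q. (q \<in> {..<Q} \<longrightarrow> z q \<in> {..R}) \<and> (q \<notin> {..<Q} \<longrightarrow> z q = 0)}"
  proof
    fix z assume z: "z \<in> grid Q R"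
    have "z q \<le> R" if "q < Q" for q
      using z member_le_sum[of q "{..<Q}" z] that by (auto simp: grid_def)
    then show "z \<in> {z. \<forall>q. (q \<in> {..<Q} \<longrightarrow> z q \<in> {..R}) \<and> (q \<notin> {..<Q} \<longrightarrow> z q = 0)}"
      using z by (auto simp: grid_def)
  qed
  then show ?thesis by (rule finite_subset) (rule finite_set_of_finite_funs, auto)
qed

text \<open>
  Giving every grid point the weight \<open>t\<close> to the power of its coordinate sum, with
  \<open>t = N / (N + 1)\<close>, turns the sum over the grid into a product of geometric series.
\<close>

lemma card_grid_le:
  assumes N: "1 \<le> N" and R: "R \<le> N * Q"
  shows "real (card (grid Q R)) \<le> (3 * real (N + 1)) ^ Q"
proof -
  define t where "t = real N / real (N + 1)"
  have t: "0 < t" "t < 1" using N by (auto simp: t_def)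
  have t1: "1 - t = 1 / real (N + 1)" by (simp add: t_def field_simps)
  let ?F = "PiE {..<Q} (\<lambda>_. {..R})"
  let ?r = "\<lambda>z. restrict z {..<Q}"
  have inj: "inj_on ?r (grid Q R)"
  proof (rule inj_onI, rule ext)
    fix x y q assume xy: "x \<in> grid Q R" "y \<in> grid Q R" "?r x = ?r y"
    show "x q = y q"
    proof (cases "q < Q")
      case True
      then show ?thesis using fun_cong[OF xy(3), of q] by simp
    next
      case False
      then show ?thesis using xy(1,2) by (simp add: grid_def)
    qed
  qed
  have sub: "?r ` grid Q R \<subseteq> ?F"
  proof
    fix w assume "w \<in> ?r ` grid Q R"
    then obtain z where z: "z \<in> grid Q R" "w = ?r z" by auto
    have "z q \<le> R" if "q < Q" for q
      using z member_le_sum[of q "{..<Q}" z] that by (auto simp: grid_def)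
    then show "w \<in> ?F" by (auto simp: z(2))
  qed
  have "real (card (grid Q R)) * t ^ R = (\<Sum>z\<in>grid Q R. t ^ R)" by simp
  also have "\<dots> \<le> (\<Sum>z\<in>grid Q R. \<Prod>q<Q. t ^ (?r z q))"
  proof (rule sum_mono)
    fix z assume "z \<in> grid Q R"
    then have "t ^ R \<le> t ^ (\<Sum>q<Q. z q)"
      using t by (intro power_decreasing) (auto simp: grid_def)
    then show "t ^ R \<le> (\<Prod>q<Q. t ^ (?r z q))" by (simp add: power_sum)
  qed
  also have "\<dots> = (\<Sum>w\<in>?r ` grid Q R. \<Prod>q<Q. t ^ (w q))"
    by (simp only: sum.reindex[OF inj] o_def)
  also have "\<dots> \<le> (\<Sum>w\<in>?F. \<Prod>q<Q. t ^ (w q))"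
    using t by (intro sum_mono2 sub finite_PiE) (auto intro!: prod_nonneg)
  also have "\<dots> = (\<Prod>q<Q. \<Sum>y\<in>{..R}. t ^ y)"
    by (rule prod_sum_PiE[symmetric]) auto
  \<comment> \<open>Each geometric series is at most 1 / (1 - t) = N + 1. A larger t would worsen
    this factor, a smaller one the factor 1 / t^R.\<close>
  also have "\<dots> \<le> (\<Prod>q<Q. real (N + 1))"
  proof (intro prod_mono conjI sum_nonneg)
    have "(\<Sum>y\<in>{..R}. t ^ y) = (1 - t ^ Suc R) / (1 - t)"
      using sum_gp0[of t R] t by simp
    also have "\<dots> \<le> 1 / (1 - t)" using t by (intro divide_right_mono) auto
    finally show "(\<Sum>y\<in>{..R}. t ^ y) \<le> real (N + 1)" by (simp add: t1)
  qed (use t in auto)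
  finally have "real (card (grid Q R)) * t ^ R \<le> real (N + 1) ^ Q" by simp
  \<comment> \<open>As R \<le> N Q, it is enough that t^N \<ge> 1/3, which is (1 + 1/N)^N \<le> e
    \<le> 3.\<close>
  moreover have "1 / 3 ^ Q \<le> t ^ R"
  proof -
    have "(1 / t) ^ N \<le> exp (1 / real N) ^ N"
    proof (rule power_mono)
      have "1 / t = 1 + 1 / real N" using N by (simp add: t_def field_simps)
      also have "\<dots> \<le> exp (1 / real N)" by simp
      finally show "1 / t \<le> exp (1 / real N)" .
    qed (use t in auto)
    also have "\<dots> = exp 1" using N by (simp add: exp_of_nat_mult[symmetric])
    also have "\<dots> \<le> 3" by (rule exp_le)
    finally have "1 / t ^ N \<le> 3" by (simp add: power_divide)
    then have "1 / 3 \<le> t ^ N" using t by (simp add: field_simps)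
    then have "(1 / 3) ^ Q \<le> (t ^ N) ^ Q" by (intro power_mono) auto
    also have "\<dots> = t ^ (N * Q)" by (simp add: power_mult)
    also have "\<dots> \<le> t ^ R" using t R by (intro power_decreasing) auto
    finally show ?thesis by (simp add: power_divide)
  qed
  then have "real (card (grid Q R)) * (1 / 3 ^ Q) \<le> real (card (grid Q R)) * t ^ R"
    by (intro mult_left_mono) auto
  ultimately have "real (card (grid Q R)) * (1 / 3 ^ Q) \<le> real (N + 1) ^ Q" by linarith
  then have "real (card (grid Q R)) \<le> 3 ^ Q * real (N + 1) ^ Q" by (simp add: field_simps)
  then show ?thesis by (simp only: power_mult_distrib)
qed

section \<open>Odometer steps through the grid\<close>

definition bump :: "nat \<Rightarrow> (nat \<Rightarrow> nat) \<Rightarrow> nat \<Rightarrow> nat" where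
  "bump q z i = (if i < q then 0 else if i = q then Suc (z i) else z i)"

lemma sum_bump:
  assumes "q < Q"
  shows "(\<Sum>i<Q. bump q z i) = Suc (\<Sum>i=q..<Q. z i)"
proof -
  have "(\<Sum>i<Q. bump q z i) = (\<Sum>i\<in>{..<q}. bump q z i) + (\<Sum>i=q..<Q. bump q z i)"
    using assms by (metis atLeast0LessThan less_imp_le sum.atLeastLessThan_concat zero_le)
  also have "\<dots> = Suc (\<Sum>i=q..<Q. z i)"
    using assms by (simp add: bump_def sum.atLeast_Suc_lessThan)
  finally show ?thesis .
qed

lemma bump_in_grid:
  assumes z: "z \<in> grid Q R" and q: "q < Q" "(\<Sum>i=q..<Q. z i) < R"
  shows "bump q z \<in> grid Q R" "colex Q z (bump q z)"
proof -
  show "bump q z \<in> grid Q R"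
    using z q sum_bump[OF q(1), of z] by (auto simp: grid_def bump_def)
  show "colex Q z (bump q z)"
    using q(1) by (auto simp: colex_def bump_def intro!: exI[of _ q])
qed

lemma tail_sum_le:
  assumes "y \<in> grid Q R" shows "(\<Sum>i=r..<Q. y i) \<le> R"
proof -
  have "(\<Sum>i=r..<Q. y i) \<le> (\<Sum>i<Q. y i)" by (intro sum_mono2) auto
  then show ?thesis using assms by (simp add: grid_def)
qed

text \<open>Here \<open>t\<close> is the index deciding that \<open>y\<close> lies above
  \<open>z\<close>, so the tail sum of \<open>z\<close> from \<open>t\<close> is strictly below that
  of \<open>y\<close>, which is at most R. Hence points above \<open>z\<close> are decided only at
  indices where the tail of \<open>z\<close> is not saturated.\<close>

lemma colex_saturated:
  assumes y: "y \<in> grid Q R" and t: "t < Q" "z t < y t" "\<And>r. r < Q \<Longrightarrow> t < r \<Longrightarrow> z r = y r"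
  shows "(\<Sum>i=t..<Q. z i) \<noteq> R"
proof -
  have "(\<Sum>i=t..<Q. z i) < (\<Sum>i=t..<Q. y i)"
  proof (rule sum_strict_mono_ex1)
    show "\<forall>i\<in>{t..<Q}. z i \<le> y i" using t by (metis atLeastLessThan_iff le_eq_less_or_eq)
  qed (use t in auto)
  then show ?thesis using tail_sum_le[OF y, of t] by linarith
qed

text \<open>By \<open>colex_saturated\<close>, a point above \<open>z\<close> is decided at some t
  \<ge> q. If t > q, or if the digit at q rises by more than one, it lies above
  \<open>bump q z\<close>. If that digit rises by exactly one, the point agrees with
  \<open>bump q z\<close> from q on, and below q the bumped point has the least digits possible,
  namely zeros.\<close>

lemma bump_is_successor:
  assumes y: "y \<in> grid Q R" "colex Q z y" and z: "z \<in> grid Q R" and q: "q < Q"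
    and sat: "\<And>r. r < q \<Longrightarrow> (\<Sum>i=r..<Q. z i) = R"
  shows "y = bump q z \<or> colex Q (bump q z) y"
proof -
  from y(2) obtain t where t: "t < Q" "z t < y t" "\<And>r. r < Q \<Longrightarrow> t < r \<Longrightarrow> z r = y r"
    unfolding colex_def by blast
  have "\<not> t < q" using colex_saturated[OF y(1) t] sat by blast
  then consider "q < t" | "t = q" "Suc (z q) < y q" | "t = q" "y q = Suc (z q)"
    using t(2) by fastforce
  then show ?thesis
  proof cases
    case 1
    then have "colex Q (bump q z) y"
      unfolding colex_def using t by (intro exI[of _ t]) (auto simp: bump_def)
    then show ?thesis ..
  next
    case 2
    then have "colex Q (bump q z) y"
      unfolding colex_def using t by (intro exI[of _ t]) (auto simp: bump_def)
    then show ?thesis ..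
  next
    case 3
    show ?thesis
    proof (cases "\<exists>r<q. 0 < y r")
      case False
      have "y i = bump q z i" for i
        using False 3 t y(1) z q by (cases "i < Q") (auto simp: bump_def grid_def)
      then show ?thesis by auto
    next
      case True
      let ?D = "{r. r < q \<and> 0 < y r}"
      have M: "Max ?D \<in> ?D" using True by (intro Max_in) auto
      have "y r = 0" if "r < q" "Max ?D < r" for r
      proof (rule ccontr)
        assume "y r \<noteq> 0"
        then have "r \<le> Max ?D" using that by (intro Max_ge) auto
        with that show False by simp
      qed
      then have "colex Q (bump q z) y"
        unfolding colex_def using M t 3 q
        by (intro exI[of _ "Max ?D"]) (auto simp: bump_def not_less le_less)
      then show ?thesis ..
    qed
  qed
qed

lemma saturated_is_last:
  assumes "y \<in> grid Q R" and "\<And>r. r < Q \<Longrightarrow> (\<Sum>i=r..<Q. z i) = R"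
  shows "\<not> colex Q z y"
  using colex_saturated[OF assms(1)] assms(2) unfolding colex_def by blast

section \<open>Assigning rows to columns\<close>

text \<open>What remains of nonnegative orthonormal columns once the unit norms are dropped; a
  column may even be zero.\<close>

definition scattered :: "nat \<Rightarrow> nat \<Rightarrow> (nat \<Rightarrow> nat \<Rightarrow> real) \<Rightarrow> bool" where
  "scattered d k Y \<longleftrightarrow> (\<forall>i<d. \<forall>j<k. 0 \<le> Y i j) \<and>
     (\<forall>i<d. \<forall>j<k. \<forall>l<k. j \<noteq> l \<longrightarrow> Y i j = 0 \<or> Y i l = 0)"

text \<open>Zero columns contribute \<open>0 / 0 = 0\<close>.\<close>

definition captured :: "nat \<Rightarrow> nat \<Rightarrow> nat \<Rightarrow> (nat \<Rightarrow> nat \<Rightarrow> real) \<Rightarrow> (nat \<Rightarrow> nat \<Rightarrow> real) \<Rightarrow> real" where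
  "captured d m k B Y = (\<Sum>j<k. energy d m B (column Y j) / sq d (column Y j))"

text \<open>The value \<open>v\<close> is the positive part of the maximum of row i of
  \<open>G\<close>, placed in a column where the maximum is attained. If no entry of the row is
  positive, the row of \<open>Y\<close> is zero and \<open>l\<close> is arbitrary.\<close>

definition assigns :: "nat \<Rightarrow> nat \<Rightarrow> (nat \<Rightarrow> nat \<Rightarrow> real) \<Rightarrow> (nat \<Rightarrow> nat \<Rightarrow> real) \<Rightarrow> bool" where
  "assigns d k G Y \<longleftrightarrow> (\<forall>i<d. \<exists>l<k. \<exists>v\<ge>0. (\<forall>j<k. Y i j = (if j = l then v else 0)) \<and>
     (\<forall>j<k. G i j \<le> v) \<and> (0 < v \<longrightarrow> v = G i l))"

lemma assigns_scattered: "assigns d k G Y \<Longrightarrow> scattered d k Y"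
  unfolding assigns_def scattered_def by (metis order_refl)

lemma scattered_row_sum:
  fixes c :: real and k :: nat
  assumes "\<And>j l. j < k \<Longrightarrow> l < k \<Longrightarrow> j \<noteq> l \<Longrightarrow> \<not> (P j \<and> P l)" and "0 \<le> c"
  shows "(\<Sum>j<k. if P j then c else 0) \<le> c"
proof (cases "\<exists>j<k. P j")
  case True
  then obtain j where j: "j < k" "P j" by blast
  have "(\<Sum>l<k. if P l then c else 0) = (\<Sum>l<k. if l = j then c else 0)"
    using assms(1) j by (intro sum.cong) auto
  then show ?thesis using j by simp
next
  case False
  then show ?thesis using assms(2) by simp
qed

text \<open>Let v_i be the one possibly nonzero entry of row i of \<open>Y\<close>. Cauchy-Schwarz
  on the support of u_j bounds <u_j, g_j>^2 by the sum of v_i^2 over that support. The supports are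
  disjoint, so the sum over j is at most the squared norm of \<open>Y\<close>. Conversely, |y_j|^2 =
  <y_j, g_j> = <C_j, B^T y_j> \<le> s |B^T y_j|, so |y_j|^2 is at most s^2 times the energy captured
  by column j. The factor \<open>th\<close> measures how well C_j is aligned with B^T u_j.\<close>

lemma captured_assigns_ge:
  assumes Y: "assigns d k G Y"
    and G: "\<And>i j. i < d \<Longrightarrow> j < k \<Longrightarrow> G i j = (\<Sum>p<m. C p j * B i p)"
    and C: "\<And>j. j < k \<Longrightarrow> (\<Sum>p<m. (C p j)\<^sup>2) \<le> s\<^sup>2" and s: "0 < s" and th: "0 \<le> th"
    and U: "scattered d k U" "\<And>j. j < k \<Longrightarrow> sq d (column U j) = 1"
    and UG: "\<And>j. j < k \<Longrightarrow> th * s * sqrt (energy d m B (column U j)) \<le> dot d (column U j) (column G j)"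
  shows "th\<^sup>2 * (\<Sum>j<k. energy d m B (column U j)) \<le> captured d m k B Y"
proof -
  define v where "v i = (\<Sum>j<k. Y i j)" for i
  have v: "0 \<le> v i" "\<And>j. j < k \<Longrightarrow> G i j \<le> v i" "(v i)\<^sup>2 = (\<Sum>j<k. (Y i j)\<^sup>2)"
    "\<And>j. j < k \<Longrightarrow> Y i j * G i j = (Y i j)\<^sup>2" if "i < d" for i
  proof -
    obtain l w where lw: "l < k" "0 \<le> w" "\<And>j. j < k \<Longrightarrow> Y i j = (if j = l then w else 0)"
      "\<And>j. j < k \<Longrightarrow> G i j \<le> w" "0 < w \<Longrightarrow> w = G i l"
      using Y[unfolded assigns_def, rule_format, OF \<open>i < d\<close>] by auto
    have vw: "v i = w" unfolding v_def using lw by simp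
    show "0 \<le> v i" "\<And>j. j < k \<Longrightarrow> G i j \<le> v i" using lw vw by auto
    have "(\<Sum>j<k. (Y i j)\<^sup>2) = (\<Sum>j<k. if j = l then w\<^sup>2 else 0)"
      using lw(3) by (intro sum.cong) auto
    then show "(v i)\<^sup>2 = (\<Sum>j<k. (Y i j)\<^sup>2)" using lw(1) vw by simp
    show "Y i j * G i j = (Y i j)\<^sup>2" if "j < k" for j
      using lw(2,3,5) that by (cases "w = 0") (auto simp: power2_eq_square)
  qed
  have "th\<^sup>2 * s\<^sup>2 * (\<Sum>j<k. energy d m B (column U j)) = (\<Sum>j<k. (th * s * sqrt (energy d m B (column U j)))\<^sup>2)"
    by (simp add: power_mult_distrib sum_distrib_left)
  also have "\<dots> \<le> (\<Sum>j<k. \<Sum>i<d. if 0 < U i j then (v i)\<^sup>2 else 0)"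
  proof (rule sum_mono)
    fix j assume "j \<in> {..<k}"
    then have j: "j < k" by simp
    let ?w = "\<lambda>i. if 0 < U i j then v i else 0"
    have "dot d (column U j) (column G j) \<le> dot d (column U j) ?w"
      unfolding dot_def
    proof (intro sum_mono)
      fix i assume "i \<in> {..<d}"
      then have i: "i < d" by simp
      show "U i j * G i j \<le> U i j * ?w i"
      proof (cases "0 < U i j")
        case True
        then show ?thesis using v(2)[OF i j] by simp
      next
        case False
        moreover have "0 \<le> U i j" using U(1) i j by (simp add: scattered_def)
        ultimately show ?thesis by simp
      qed
    qed
    with UG[OF j] have "th * s * sqrt (energy d m B (column U j)) \<le> dot d (column U j) ?w" by linarith
    then have "(th * s * sqrt (energy d m B (column U j)))\<^sup>2 \<le> (dot d (column U j) ?w)\<^sup>2"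
      using th s by (intro power_mono) auto
    also have "\<dots> \<le> sq d (column U j) * sq d ?w" by (rule dot_square_le)
    also have "\<dots> = (\<Sum>i<d. if 0 < U i j then (v i)\<^sup>2 else 0)"
      unfolding U(2)[OF j] by (auto simp: sq_def intro!: sum.cong)
    finally show "(th * s * sqrt (energy d m B (column U j)))\<^sup>2 \<le>
      (\<Sum>i<d. if 0 < U i j then (v i)\<^sup>2 else 0)" .
  qed
  also have "\<dots> = (\<Sum>i<d. \<Sum>j<k. if 0 < U i j then (v i)\<^sup>2 else 0)" by (rule sum.swap)
  also have "\<dots> \<le> (\<Sum>i<d. (v i)\<^sup>2)"
    using U(1) by (intro sum_mono scattered_row_sum) (fastforce simp: scattered_def)+
  also have "\<dots> = (\<Sum>i<d. \<Sum>j<k. (Y i j)\<^sup>2)" using v(3) by simp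
  also have "\<dots> = (\<Sum>j<k. sq d (column Y j))" unfolding sq_def by (rule sum.swap)
  also have "\<dots> \<le> (\<Sum>j<k. s\<^sup>2 * (energy d m B (column Y j) / sq d (column Y j)))"
  proof (rule sum_mono)
    fix j assume "j \<in> {..<k}"
    then have j: "j < k" by simp
    let ?y = "sq d (column Y j)"
    have "?y = dot d (column Y j) (column G j)"
      unfolding sq_def dot_def using v(4) j by simp
    also have "\<dots> = dot d (column Y j) (\<lambda>i. \<Sum>p<m. C p j * B i p)"
      using G j by (intro dot_cong) auto
    also have "\<dots> = dot m (\<lambda>p. C p j) (\<lambda>p. dot d (column Y j) (column B p))"
      unfolding dot_sum_right by (simp add: dot_def)
    finally have "?y\<^sup>2 \<le> sq m (\<lambda>p. C p j) * energy d m B (column Y j)"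
      using dot_square_le[of m "\<lambda>p. C p j"] by (simp add: energy_def sq_def)
    also have "\<dots> \<le> s\<^sup>2 * energy d m B (column Y j)"
      using C[OF j] by (intro mult_right_mono) (auto simp: sq_def)
    finally have le: "?y\<^sup>2 \<le> s\<^sup>2 * energy d m B (column Y j)" .
    show "?y \<le> s\<^sup>2 * (energy d m B (column Y j) / ?y)"
    proof (cases "?y = 0")
      case False
      then have "0 < ?y" using sq_nonneg[of d "column Y j"] by linarith
      then show ?thesis using le by (simp add: field_simps power2_eq_square)
    qed simp
  qed
  also have "\<dots> = s\<^sup>2 * captured d m k B Y" by (simp add: captured_def sum_distrib_left)
  finally show ?thesis using s by (simp add: mult.assoc mult.left_commute[of _ "s\<^sup>2"])
qed

text \<open>Grid coordinates are natural numbers, so a signed coefficient is a difference of two of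
  them: column j owns the block of length m starting at j m, and its negative parts lie
  \<open>H\<close> further on.\<close>

definition coef :: "nat \<Rightarrow> nat \<Rightarrow> (nat \<Rightarrow> nat) \<Rightarrow> nat \<Rightarrow> nat \<Rightarrow> real" where
  "coef m H z p j = real (z (j * m + p)) - real (z (j * m + p + H))"

lemma sum_abs_le_sqrt:
  assumes "(\<Sum>p<m. (c p)\<^sup>2) \<le> 1"
  shows "(\<Sum>p<m. \<bar>c p\<bar>) \<le> sqrt (real m)"
proof (rule real_le_rsqrt)
  have "(\<Sum>p<m. \<bar>c p\<bar>)\<^sup>2 \<le> (\<Sum>p<m. (c p)\<^sup>2) * real m"
    using dot_square_le[of m "\<lambda>p. \<bar>c p\<bar>" "\<lambda>_. 1"] by (simp add: dot_def sq_def)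
  also have "\<dots> \<le> 1 * real m" using assms by (intro mult_right_mono) auto
  finally show "(\<Sum>p<m. \<bar>c p\<bar>)\<^sup>2 \<le> real m" by simp
qed

text \<open>
  The unit vector \<open>c\<close> along the coordinates of \<open>B\<^sup>T u\<close> is scaled by \<open>N \<surd>m\<close> and rounded towards
  zero; positive and negative parts are stored in the two halves of the grid point.
\<close>

lemma grid_net:
  assumes m: "0 < m" and N: "0 < N" and U: "\<And>j. j < k \<Longrightarrow> sq d (column U j) = 1"
  defines "s \<equiv> real N * sqrt (real m)"
  obtains z where "z \<in> grid (k * m + k * m) (N * m * k)"
    and "\<And>j. j < k \<Longrightarrow> (\<Sum>p<m. (coef m (k * m) z p j)\<^sup>2) \<le> s\<^sup>2"
    and "\<And>j. j < k \<Longrightarrow> (1 - 1 / real N) * s * sqrt (energy d m B (column U j)) \<le>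
      dot d (column U j) (\<lambda>i. \<Sum>p<m. coef m (k * m) z p j * B i p)"
proof -
  define e where "e j = sqrt (energy d m B (column U j))" for j
  define c where "c j p = dot d (column U j) (column B p) / e j" for j p
  define z where "z q = (if q < k * m then nat \<lfloor>c (q div m) (q mod m) * s\<rfloor>
     else if q < k * m + k * m then nat \<lfloor>- c ((q - k * m) div m) ((q - k * m) mod m) * s\<rfloor> else 0)" for q
  have s: "0 < s" using m N by (simp add: s_def)
  have e2: "(e j)\<^sup>2 = (\<Sum>p<m. (dot d (column U j) (column B p))\<^sup>2)" for j
    unfolding e_def by (simp add: energy_def sum_nonneg)
  \<comment> \<open>Since x / 0 = 0, a column u_j orthogonal to all columns of \<open>B\<close>
    yields the zero vector instead of a unit vector.\<close>
  have c2: "(\<Sum>p<m. (c j p)\<^sup>2) = (if e j = 0 then 0 else 1)" for j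
    unfolding c_def by (auto simp: power_divide sum_divide_distrib[symmetric] e2[symmetric])
  then have c1: "(\<Sum>p<m. \<bar>c j p\<bar>) \<le> sqrt (real m)" for j
    by (intro sum_abs_le_sqrt) simp
  have idx: "j * m + p < k * m" if "j < k" "p < m" for j p
  proof -
    have "j * m + p < Suc j * m" using that by simp
    also have "\<dots> \<le> k * m" using that by (intro mult_le_mono1) simp
    finally show ?thesis .
  qed
  have z1: "z (j * m + p) = nat \<lfloor>c j p * s\<rfloor>" if "j < k" "p < m" for j p
    using idx[OF that] that by (simp add: z_def)
  have z2: "z (j * m + p + k * m) = nat \<lfloor>- c j p * s\<rfloor>" if "j < k" "p < m" for j p
    using idx[OF that] that by (simp add: z_def)
  \<comment> \<open>\<open>nat\<close> sends at least one of the two floors to 0, so the difference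
    is x rounded towards zero: not larger than x in modulus, and off by at most 1.\<close>
  have rnd: "\<bar>real (nat \<lfloor>x\<rfloor>) - real (nat \<lfloor>- x\<rfloor>)\<bar> \<le> \<bar>x\<bar>"
    "x * y - \<bar>y\<bar> \<le> (real (nat \<lfloor>x\<rfloor>) - real (nat \<lfloor>- x\<rfloor>)) * y"
    "real (nat \<lfloor>x\<rfloor>) + real (nat \<lfloor>- x\<rfloor>) \<le> \<bar>x\<bar>" for x y :: real
  proof -
    show "\<bar>real (nat \<lfloor>x\<rfloor>) - real (nat \<lfloor>- x\<rfloor>)\<bar> \<le> \<bar>x\<bar>" "real (nat \<lfloor>x\<rfloor>) + real (nat \<lfloor>- x\<rfloor>) \<le> \<bar>x\<bar>"
      by (cases "0 \<le> x"; linarith)+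
    have "\<bar>x - (real (nat \<lfloor>x\<rfloor>) - real (nat \<lfloor>- x\<rfloor>))\<bar> \<le> 1"
      by (cases "0 \<le> x"; linarith)
    then have "\<bar>x - (real (nat \<lfloor>x\<rfloor>) - real (nat \<lfloor>- x\<rfloor>))\<bar> * \<bar>y\<bar> \<le> 1 * \<bar>y\<bar>"
      by (intro mult_right_mono) auto
    then show "x * y - \<bar>y\<bar> \<le> (real (nat \<lfloor>x\<rfloor>) - real (nat \<lfloor>- x\<rfloor>)) * y"
      unfolding abs_mult[symmetric] by (simp add: algebra_simps abs_le_iff)
  qed
  have cf: "coef m (k * m) z p j = real (nat \<lfloor>c j p * s\<rfloor>) - real (nat \<lfloor>- (c j p * s)\<rfloor>)"
    if "j < k" "p < m" for j p
    using z1[OF that] z2[OF that] by (simp add: coef_def)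
  have blk: "(\<Sum>q<k * m. f q) = (\<Sum>j<k. \<Sum>p<m. f (j * m + p))" for f :: "nat \<Rightarrow> nat"
  proof -
    have "(\<Sum>p<m. f (j * m + p)) = sum f {j * m..<j * m + m}" for j
      using sum.shift_bounds_nat_ivl[of f 0 "j * m" m] by (simp add: atLeast0LessThan add.commute)
    then show ?thesis using sum.nat_group[of f m k] by simp
  qed
  have "(\<Sum>q<k * m + k * m. z q) = (\<Sum>q<k * m. z q) + (\<Sum>q<k * m. z (q + k * m))"
    using sum.atLeastLessThan_concat[of 0 "k * m" "k * m + k * m" z]
      sum.shift_bounds_nat_ivl[of z 0 "k * m" "k * m"]
    by (simp add: atLeast0LessThan)
  also have "\<dots> = (\<Sum>j<k. \<Sum>p<m. z (j * m + p) + z (j * m + p + k * m))"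
    unfolding blk by (simp add: sum.distrib)
  finally have "real (\<Sum>q<k * m + k * m. z q) =
      (\<Sum>j<k. \<Sum>p<m. real (nat \<lfloor>c j p * s\<rfloor>) + real (nat \<lfloor>- (c j p * s)\<rfloor>))"
    using z1 z2 by simp
  also have "\<dots> \<le> (\<Sum>j<k. \<Sum>p<m. \<bar>c j p * s\<bar>)"
    by (intro sum_mono rnd)
  also have "\<dots> = (\<Sum>j<k. s * (\<Sum>p<m. \<bar>c j p\<bar>))"
    using s by (simp add: abs_mult sum_distrib_left mult.commute)
  \<comment> \<open>A unit vector has l_1 norm at most sqrt m, so each block needs at most s sqrt m
    = N m; this fixes the radius N m k.\<close>
  also have "\<dots> \<le> (\<Sum>j<k. s * sqrt (real m))"
    using s by (intro sum_mono mult_left_mono c1) auto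
  also have "\<dots> = real (N * m * k)" by (simp add: s_def)
  finally have "(\<Sum>q<k * m + k * m. z q) \<le> N * m * k" by linarith
  then have 1: "z \<in> grid (k * m + k * m) (N * m * k)"
    by (simp add: grid_def z_def)
  have 2: "(\<Sum>p<m. (coef m (k * m) z p j)\<^sup>2) \<le> s\<^sup>2" if j: "j < k" for j
  proof -
    have "(\<Sum>p<m. (coef m (k * m) z p j)\<^sup>2) \<le> (\<Sum>p<m. (c j p * s)\<^sup>2)"
      using rnd(1) by (intro sum_mono) (simp add: cf j abs_le_square_iff[symmetric])
    also have "\<dots> = s\<^sup>2 * (\<Sum>p<m. (c j p)\<^sup>2)"
      by (simp add: power_mult_distrib sum_distrib_left mult.commute)
    also have "\<dots> \<le> s\<^sup>2" by (simp add: c2)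
    finally show ?thesis .
  qed
  have 3: "(1 - 1 / real N) * s * e j \<le> dot d (column U j) (\<lambda>i. \<Sum>p<m. coef m (k * m) z p j * B i p)"
    if j: "j < k" for j
  proof (cases "e j = 0")
    case True
    then have "dot d (column U j) (column B p) = 0" if "p < m" for p
      using e2[of j] that by (simp add: sum_nonneg_eq_0_iff)
    then show ?thesis using True by (simp add: dot_sum_right)
  next
    case False
    then have e0: "0 < e j" by (simp add: e_def less_le)
    \<comment> \<open>Rounding costs at most the l_1 norm of c, hence at most sqrt m = s / N. This
      is the factor 1 - 1/N.\<close>
    have "s - sqrt (real m) \<le> (\<Sum>p<m. c j p * s * c j p) - (\<Sum>p<m. \<bar>c j p\<bar>)"
      using c1[of j] c2[of j] False
      by (simp add: sum_distrib_left[symmetric] power2_eq_square[symmetric] mult.commute[of _ s]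
          mult.assoc)
    also have "\<dots> = (\<Sum>p<m. c j p * s * c j p - \<bar>c j p\<bar>)" by (simp add: sum_subtractf)
    also have "\<dots> \<le> (\<Sum>p<m. coef m (k * m) z p j * c j p)"
      by (intro sum_mono) (use rnd(2) cf j in auto)
    finally have "(s - sqrt (real m)) * e j \<le> (\<Sum>p<m. coef m (k * m) z p j * c j p) * e j"
      using e0 by (intro mult_right_mono) auto
    also have "\<dots> = dot d (column U j) (\<lambda>i. \<Sum>p<m. coef m (k * m) z p j * B i p)"
      unfolding dot_sum_right using False by (simp add: c_def sum_distrib_right)
    finally have "(s - sqrt (real m)) * e j \<le> dot d (column U j) (\<lambda>i. \<Sum>p<m. coef m (k * m) z p j * B i p)" .
    moreover have "(1 - 1 / real N) * s = s - sqrt (real m)" using N by (simp add: s_def field_simps)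
    ultimately show ?thesis by simp
  qed
  show ?thesis by (rule that[OF 1 2 3[unfolded e_def]])
qed

section \<open>Repairing zero columns\<close>

text \<open>Row \<open>r\<close> can be withdrawn from its column without emptying it: for scattered
  \<open>Y\<close>, the row is zero or its column has another nonzero entry.\<close>

definition free_row :: "nat \<Rightarrow> nat \<Rightarrow> (nat \<Rightarrow> nat \<Rightarrow> real) \<Rightarrow> nat \<Rightarrow> bool" where
  "free_row d k Y r \<longleftrightarrow> (\<forall>l<k. 0 < Y r l \<longrightarrow> (Y r l)\<^sup>2 < sq d (column Y l))"

lemma sq_ge_entry: "i < d \<Longrightarrow> (v i)\<^sup>2 \<le> sq d v"
  unfolding sq_def by (rule member_le_sum) auto

text \<open>If no row were free, each row would hold the only nonzero entry of some column. Distinct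
  rows would own distinct columns, none of them the zero column \<open>j\<close>, so there would be
  at most k - 1 rows, contrary to k \<le> d.\<close>

lemma free_row_exists:
  assumes Y: "scattered d k Y" and j: "j < k" "sq d (column Y j) = 0" and "k \<le> d"
  shows "\<exists>r<d. free_row d k Y r"
proof (rule ccontr)
  assume "\<not> ?thesis"
  then have "\<forall>r. \<exists>l. r < d \<longrightarrow> l < k \<and> 0 < Y r l \<and> sq d (column Y l) \<le> (Y r l)\<^sup>2"
    unfolding free_row_def by (metis not_less)
  then obtain f where f: "\<And>r. r < d \<Longrightarrow> f r < k" "\<And>r. r < d \<Longrightarrow> 0 < Y r (f r)"
    "\<And>r. r < d \<Longrightarrow> sq d (column Y (f r)) \<le> (Y r (f r))\<^sup>2" by metis
  have "inj_on f {..<d}"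
  proof (rule inj_onI, rule ccontr)
    fix r t assume rt: "r \<in> {..<d}" "t \<in> {..<d}" "f r = f t" "r \<noteq> t"
    have "(\<Sum>i\<in>{r, t}. (Y i (f r))\<^sup>2) \<le> sq d (column Y (f r))"
      unfolding sq_def using rt by (intro sum_mono2) auto
    moreover have "0 < (Y t (f r))\<^sup>2" using f(2)[of t] rt by simp
    moreover have "sq d (column Y (f r)) \<le> (Y r (f r))\<^sup>2" using f(3)[of r] rt by simp
    ultimately show False using rt(4) by (subst (asm) sum.insert) (simp_all del: zero_less_power2)
  qed
  moreover have "f ` {..<d} \<subseteq> {..<k} - {j}"
  proof
    fix l assume "l \<in> f ` {..<d}"
    then obtain r where r: "r < d" "l = f r" by auto
    have "0 < (Y r (f r))\<^sup>2" using f(2)[OF r(1)] by simp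
    then have "l \<noteq> j" using sq_ge_entry[OF r(1), of "column Y (f r)"] j(2) r(2) by auto
    then show "l \<in> {..<k} - {j}" using f(1) r by auto
  qed
  ultimately have "card {..<d} \<le> card ({..<k} - {j})" by (intro card_inj_on_le[of f]) auto
  then show False using j(1) \<open>k \<le> d\<close> by simp
qed

text \<open>Cauchy-Schwarz in the plane for the vectors (a / sqrt S, b) and (sqrt S, t).\<close>

lemma split_square_le:
  fixes a b t S :: real
  assumes "0 < S"
  shows "(a + t * b)\<^sup>2 / (S + t\<^sup>2) \<le> a\<^sup>2 / S + b\<^sup>2"
proof -
  have "(a\<^sup>2 / S + b\<^sup>2) * (S + t\<^sup>2) - (a + t * b)\<^sup>2 = (t * a / S - b)\<^sup>2 * S"
    using assms by (simp add: field_simps power2_eq_square)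
  moreover have "0 \<le> (t * a / S - b)\<^sup>2 * S" using assms by simp
  moreover have "0 < S + t\<^sup>2" using assms by (simp add: add_pos_nonneg)
  ultimately show ?thesis by (simp add: pos_divide_le_eq)
qed

text \<open>
  Splitting a vector into two vectors with disjoint supports cannot decrease the captured
  energy, because the original vector lies in the span of the two parts.
\<close>

lemma repair_column:
  assumes Y: "scattered d k Y" and r: "r < d" "free_row d k Y r" and j: "j < k" "sq d (column Y j) = 0"
    and Y': "\<And>i l. i < d \<Longrightarrow> l < k \<Longrightarrow> Y' i l = (if i = r then (if l = j then 1 else 0) else Y i l)"
  shows "scattered d k Y'" "captured d m k B Y \<le> captured d m k B Y'"
    "l < k \<Longrightarrow> l = j \<or> 0 < sq d (column Y l) \<Longrightarrow> 0 < sq d (column Y' l)"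
proof -
  show "scattered d k Y'" using Y by (auto simp: scattered_def Y')
  let ?E = "energy d m B (\<lambda>i. if i = r then 1 else 0)"
  have Yj: "Y i j = 0" if "i < d" for i
    using sq_ge_entry[OF that, of "column Y j"] j(2) by simp
  have dr: "dot d (\<lambda>i. if i = r then 1 else 0) v = v r" for v
    using r(1) by (simp add: dot_def if_distrib[where f = "\<lambda>x. x * _"] cong: if_cong)
  have sqY: "sq d (column Y l) = sq d (column Y' l) + (Y r l)\<^sup>2" if "l < k" "l \<noteq> j" for l
    unfolding sq_def by (subst sum_update1[of r d "\<lambda>i. (Y' i l)\<^sup>2"]) (use r(1) that in \<open>auto simp: Y'\<close>)
  have dotY: "dot d (column Y l) v = dot d (column Y' l) v + Y r l * v r" if "l < k" "l \<noteq> j" for l v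
    unfolding dot_def by (subst sum_update1[of r d "\<lambda>i. Y' i l * v i"]) (use r(1) that in \<open>auto simp: Y'\<close>)
  have dotj: "dot d (column Y' j) v = v r" for v
    using Yj j(1) by (subst dr[symmetric], intro dot_cong) (auto simp: Y')
  have sqj: "sq d (column Y' j) = 1"
    using dotj[of "column Y' j"] r(1) j(1) by (simp add: dot_self Y')
  have pos: "0 < sq d (column Y' l)" if "l < k" "l \<noteq> j" "0 < sq d (column Y l)" for l
  proof (cases "0 < Y r l")
    case True
    then have "(Y r l)\<^sup>2 < sq d (column Y l)" using r(2) that(1) by (simp add: free_row_def)
    then show ?thesis using sqY[OF that(1,2)] by simp
  next
    case False
    then have "Y r l = 0" using Y r(1) that(1) by (auto simp: scattered_def less_le)
    then show ?thesis using sqY[OF that(1,2)] that(3) by simp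
  qed
  then show "l < k \<Longrightarrow> l = j \<or> 0 < sq d (column Y l) \<Longrightarrow> 0 < sq d (column Y' l)"
    using sqj by (cases "l = j") auto
  let ?t = "\<lambda>Y l. energy d m B (column Y l) / sq d (column Y l)"
  have part: "?t Y l \<le> ?t Y' l + (if 0 < Y r l then ?E else 0)" if l: "l < k" "l \<noteq> j" for l
  proof (cases "0 < Y r l")
    case False
    then have "Y r l = 0" using Y r(1) l(1) by (auto simp: scattered_def less_le)
    then show ?thesis using sqY[OF l] dotY[OF l] by (simp add: energy_def)
  next
    case True
    have S: "0 < sq d (column Y' l)"
      using True r(2) sqY[OF l] l(1) unfolding free_row_def by fastforce
    have "?t Y l = (\<Sum>p<m. (dot d (column Y' l) (column B p) + Y r l * B r p)\<^sup>2 /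
        (sq d (column Y' l) + (Y r l)\<^sup>2))"
      by (simp add: energy_def dotY[OF l] sqY[OF l] sum_divide_distrib)
    also have "\<dots> \<le> (\<Sum>p<m. (dot d (column Y' l) (column B p))\<^sup>2 / sq d (column Y' l) + (B r p)\<^sup>2)"
      by (intro sum_mono split_square_le S)
    also have "\<dots> = ?t Y' l + ?E"
      by (simp add: energy_def dr sum.distrib sum_divide_distrib)
    finally show ?thesis using True by simp
  qed
  have "captured d m k B Y = (\<Sum>l\<in>{..<k} - {j}. ?t Y l)"
    unfolding captured_def using j by (simp add: sum.remove[of "{..<k}" j])
  also have "\<dots> \<le> (\<Sum>l\<in>{..<k} - {j}. ?t Y' l + (if 0 < Y r l then ?E else 0))"
    by (intro sum_mono) (use part in auto)
  also have "\<dots> = (\<Sum>l\<in>{..<k} - {j}. ?t Y' l) + (\<Sum>l<k. if 0 < Y r l then ?E else 0)"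
    using j(1) Yj[OF r(1)] by (simp add: sum.distrib sum.remove[of "{..<k}" j])
  \<comment> \<open>Row \<open>r\<close> meets at most one column, so its energy \<open>?E\<close>
    is charged at most once; the new column \<open>j\<close>, the unit vector of row
    \<open>r\<close>, has exactly this energy.\<close>
  also have "\<dots> \<le> (\<Sum>l\<in>{..<k} - {j}. ?t Y' l) + ?E"
    using Y r(1) by (intro add_left_mono scattered_row_sum) (fastforce simp: scattered_def)+
  also have "?E = ?t Y' j" unfolding sqj by (simp add: energy_def dotj dr)
  also have "(\<Sum>l\<in>{..<k} - {j}. ?t Y' l) + ?t Y' j = captured d m k B Y'"
    unfolding captured_def using j(1) by (simp add: sum.remove[of "{..<k}" j])
  finally show "captured d m k B Y \<le> captured d m k B Y'" .
qed

text \<open>Dividing by the norm turns energy over squared norm into plain energy, and disjoint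
  supports supply the orthogonality.\<close>

lemma normalise_columns:
  assumes Y: "scattered d k Y" and pos: "\<And>j. j < k \<Longrightarrow> 0 < sq d (column Y j)"
    and U: "\<And>i j. i < d \<Longrightarrow> j < k \<Longrightarrow> U i j = Y i j / sqrt (sq d (column Y j))"
  shows "orthonormal d k U" "scattered d k U"
    "(\<Sum>j<k. energy d m B (column U j)) = captured d m k B Y"
proof -
  have dotU: "dot d (column U j) v = dot d (column Y j) v / sqrt (sq d (column Y j))" if "j < k" for j v
    unfolding dot_def using U that by (simp add: sum_divide_distrib)
  have "dot d (column U j) (column U l) = (if j = l then 1 else 0)" if "j < k" "l < k" for j l
  proof (cases "j = l")
    case True
    have "dot d (column U j) (column U j) = dot d (column Y j) (column Y j) / sq d (column Y j)"
      using pos[OF that(1)] by (simp add: dotU[OF that(1)] dot_commute[of d _ "column U j"])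
    then show ?thesis using True pos[OF that(1)] by (simp add: dot_self)
  next
    case False
    then have "Y i j * Y i l = 0" if "i < d" for i
      using Y \<open>j < k\<close> \<open>l < k\<close> that unfolding scattered_def by (metis mult_eq_0_iff)
    then have "U i j * U i l = 0" if "i < d" for i
      using U \<open>j < k\<close> \<open>l < k\<close> that by fastforce
    then show ?thesis using False unfolding dot_def by (auto intro!: sum.neutral)
  qed
  then show "orthonormal d k U" by (simp add: orthonormal_def)
  show "scattered d k U" using Y unfolding scattered_def by (simp add: U) metis
  show "(\<Sum>j<k. energy d m B (column U j)) = captured d m k B Y"
    unfolding captured_def energy_def
    using pos by (intro sum.cong refl) (simp add: dotU power_divide sum_divide_distrib)
qed

text \<open>A vanishing sum of nonnegative products has only vanishing terms.\<close>

lemma orthonormal_nonneg_scattered: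
  assumes "orthonormal d k U" "\<And>i j. i < d \<Longrightarrow> j < k \<Longrightarrow> 0 \<le> U i j"
  shows "scattered d k U"
proof -
  have "U i j = 0 \<or> U i l = 0" if "i < d" "j < k" "l < k" "j \<noteq> l" for i j l
  proof -
    have "(\<Sum>i<d. U i j * U i l) = 0" using assms(1) that by (simp add: orthonormal_def dot_def)
    then have "U i j * U i l = 0"
      using assms(2) that by (subst (asm) sum_nonneg_eq_0_iff) auto
    then show ?thesis by simp
  qed
  then show ?thesis using assms(2) by (simp add: scattered_def)
qed

section \<open>Matrices\<close>

abbreviation (input) entries :: "real mat \<Rightarrow> nat \<Rightarrow> nat \<Rightarrow> real" where
  "entries M \<equiv> (\<lambda>i j. M $$ (i, j))"

lemma frob_sq_total: "A \<in> carrier_mat d n \<Longrightarrow> frob_sq A = total_sq d n (entries A)"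
  unfolding frob_sq_def total_sq_def sq_def by (subst sum.swap) auto

lemma gram_entry:
  assumes "U \<in> carrier_mat d k" "j < k" "l < k"
  shows "(transpose_mat U * U) $$ (j, l) = dot d (column (entries U) j) (column (entries U) l)"
  using assms by (simp add: scalar_prod_def dot_def atLeast0LessThan)

lemma pnmf_feasible_iff:
  "U \<in> pnmf_feasible d k \<longleftrightarrow> U \<in> carrier_mat d k \<and> (\<forall>i<d. \<forall>j<k. 0 \<le> U $$ (i, j)) \<and>
     orthonormal d k (entries U)"
proof (cases "U \<in> carrier_mat d k")
  case True
  have "transpose_mat U * U = 1\<^sub>m k \<longleftrightarrow> orthonormal d k (entries U)"
  proof
    assume eq: "transpose_mat U * U = 1\<^sub>m k"
    show "orthonormal d k (entries U)"
      unfolding orthonormal_def gram_entry[OF True, symmetric, simplified] eq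
      using gram_entry[OF True] eq by auto
  next
    assume "orthonormal d k (entries U)"
    then show "transpose_mat U * U = 1\<^sub>m k"
      using True gram_entry[OF True] by (intro eq_matI) (auto simp: orthonormal_def)
  qed
  then show ?thesis using True by (simp add: pnmf_feasible_def)
qed (simp add: pnmf_feasible_def)

text \<open>Bracketing the product as U (U^T A) shows each column of the difference to be the
  residual of an orthogonal projection, so that Pythagoras applies.\<close>

lemma pnmf_cost_eq:
  assumes A: "A \<in> carrier_mat d n" and U: "U \<in> carrier_mat d k" "orthonormal d k (entries U)"
  shows "pnmf_cost A U = total_sq d n (entries A) - (\<Sum>l<k. energy d n (entries A) (column (entries U) l))"
proof -
  have ent: "(A - U * transpose_mat U * A) $$ (i, j) = A $$ (i, j) -
      (\<Sum>l<k. dot d (column (entries U) l) (column (entries A) j) * U $$ (i, l))"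
    if "i < d" "j < n" for i j
  proof -
    have "U * transpose_mat U * A = U * (transpose_mat U * A)"
      using A U by (intro assoc_mult_mat) auto
    then have "(U * transpose_mat U * A) $$ (i, j) = (\<Sum>l<k. U $$ (i, l) * (\<Sum>r<d. U $$ (r, l) * A $$ (r, j)))"
      using that A U by (simp add: scalar_prod_def atLeast0LessThan)
    then show ?thesis using that A U by (simp add: dot_def mult.commute)
  qed
  have "pnmf_cost A U = (\<Sum>i<d. \<Sum>j<n. (A $$ (i, j) -
      (\<Sum>l<k. dot d (column (entries U) l) (column (entries A) j) * U $$ (i, l)))\<^sup>2)"
  proof -
    have "dim_row (A - U * transpose_mat U * A) = d" "dim_col (A - U * transpose_mat U * A) = n"
      using A U by auto
    then show ?thesis
      unfolding pnmf_cost_def frob_sq_def 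
      by (intro sum.cong refl arg_cong[where f = "\<lambda>x. x\<^sup>2"] ent) auto
  qed
  also have "\<dots> = (\<Sum>j<n. sq d (\<lambda>i. A $$ (i, j) -
      (\<Sum>l<k. dot d (column (entries U) l) (column (entries A) j) * U $$ (i, l))))"
    unfolding sq_def by (rule sum.swap)
  also have "\<dots> = total_sq d n (entries A) - (\<Sum>l<k. energy d n (entries A) (column (entries U) l))"
    by (rule projection_residual[OF U(2)])
  finally show ?thesis .
qed

section \<open>From captured energy to the approximation guarantee\<close>

lemma pnmf_cost_nonneg: "0 \<le> pnmf_cost A U"
  by (simp add: pnmf_cost_def frob_sq_def sum_nonneg)

lemma pnmf_feasible_nonempty: "k \<le> d \<Longrightarrow> pnmf_feasible d k \<noteq> {}"
proof -
  assume kd: "k \<le> d"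
  have "mat d k (\<lambda>(i, j). if i = j then 1 else 0) \<in> pnmf_feasible d k"
    using kd unfolding pnmf_feasible_iff orthonormal_def dot_def
    by (auto simp: if_distrib[where f = "\<lambda>x. x * _"] cong: if_cong)
  then show ?thesis by blast
qed

text \<open>A bound against every feasible \<open>V\<close>, each with its own cost, passes to the
  infimum; k \<le> d ensures that this infimum ranges over a nonempty set.\<close>

lemma pnmf_opt_bound:
  assumes A: "dim_row A = d" and "k \<le> d" "0 < \<epsilon>"
    and le: "\<And>V. V \<in> pnmf_feasible d k \<Longrightarrow> x \<le> (1 + \<epsilon>) * pnmf_cost A V + c"
  shows "x \<le> (1 + \<epsilon>) * pnmf_opt A k + c"
proof -
  have "(x - c) / (1 + \<epsilon>) \<le> pnmf_opt A k"
    unfolding pnmf_opt_def A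
  proof (rule cINF_greatest[OF pnmf_feasible_nonempty[OF \<open>k \<le> d\<close>]])
    fix V assume "V \<in> pnmf_feasible d k"
    then show "(x - c) / (1 + \<epsilon>) \<le> pnmf_cost A V"
      using le[of V] \<open>0 < \<epsilon>\<close> by (simp add: field_simps)
  qed
  then show ?thesis using \<open>0 < \<epsilon>\<close> by (simp add: field_simps)
qed

lemma pnmf_opt_nonneg: "dim_row A = d \<Longrightarrow> k \<le> d \<Longrightarrow> 0 \<le> pnmf_opt A k"
  unfolding pnmf_opt_def
  by (rule cINF_greatest) (auto simp: pnmf_feasible_nonempty pnmf_cost_nonneg)

text \<open>Write E_A and E_B for the energies in the input and in the sketch. Each competitor
  \<open>V\<close> has its own grid point, whose assignment captures at least (1 - 1/N)^2 E_B(V);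
  hence E_B(U) \<ge> E_B(V) - 2 \<delta> |A|^2. Passing to E_A is free for \<open>U\<close>, since
  the sketch only underestimates, and costs \<epsilon> times the cost of \<open>V\<close> plus 2
  \<delta> |A|^2 for \<open>V\<close>. The two losses add up to the constant 4.\<close>

lemma sketch_cost_bound:
  assumes A: "A \<in> carrier_mat d n" and k: "0 < k" "k \<le> d"
    and eps: "0 < \<epsilon>" "\<epsilon> < 1" and del: "0 < \<delta>" and N: "1 \<le> real N * \<delta>"
    and inv: "fd_inv d m (entries A) f n B D"
    and m: "2 * real k + 2 * real k / \<epsilon> \<le> real m"
    and f: "real k * (real n * f) \<le> \<delta> * frob_sq A"
    and best: "\<And>z. z \<in> grid (k * m + k * m) (N * m * k) \<Longrightarrow>
      \<exists>Y. assigns d k (\<lambda>i j. \<Sum>p<m. coef m (k * m) z p j * B i p) Y \<and> captured d m k B Y \<le> E"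
    and U: "U \<in> pnmf_feasible d k" "E \<le> (\<Sum>j<k. energy d m B (column (entries U) j))"
  shows "pnmf_cost A U \<le> (1 + \<epsilon>) * pnmf_opt A k + 4 * (\<delta> * frob_sq A)"
proof (rule pnmf_opt_bound)
  show "dim_row A = d" using A by simp
  fix V assume V: "V \<in> pnmf_feasible d k"
  let ?F = "frob_sq A"
  have F: "?F = total_sq d n (entries A)" by (rule frob_sq_total[OF A])
  have F0: "0 \<le> ?F" by (simp add: F)
  let ?EA = "\<lambda>U. \<Sum>l<k. energy d n (entries A) (column (entries U) l)"
  let ?EB = "\<lambda>U. \<Sum>l<k. energy d m B (column (entries U) l)"
  have Vo: "orthonormal d k (entries V)" and Uo: "orthonormal d k (entries U)"
    and Vc: "V \<in> carrier_mat d k" and Uc: "U \<in> carrier_mat d k"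
    using V U(1) by (simp_all add: pnmf_feasible_iff)
  have "0 \<le> 2 * real k / \<epsilon>" using eps by simp
  then have m0: "0 < m" using m k by (cases "m = 0") auto
  have N0: "0 < N" using N by (cases "N = 0") auto
  obtain z where z: "z \<in> grid (k * m + k * m) (N * m * k)"
    "\<And>j. j < k \<Longrightarrow> (\<Sum>p<m. (coef m (k * m) z p j)\<^sup>2) \<le> (real N * sqrt (real m))\<^sup>2"
    "\<And>j. j < k \<Longrightarrow> (1 - 1 / real N) * (real N * sqrt (real m)) * sqrt (energy d m B (column (entries V) j)) \<le>
      dot d (column (entries V) j) (\<lambda>i. \<Sum>p<m. coef m (k * m) z p j * B i p)"
    using grid_net[OF m0 N0, of k d "entries V" B] orthonormal_sq[OF Vo] by blast
  obtain Y where Y: "assigns d k (\<lambda>i j. \<Sum>p<m. coef m (k * m) z p j * B i p) Y"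
    "captured d m k B Y \<le> E" using best[OF z(1)] by blast
  have "(1 - 1 / real N)\<^sup>2 * ?EB V \<le> captured d m k B Y"
  proof (rule captured_assigns_ge[OF Y(1) _ z(2)])
    show "scattered d k (entries V)"
      using V by (intro orthonormal_nonneg_scattered) (auto simp: pnmf_feasible_iff)
  qed (use m0 N0 z(3) orthonormal_sq[OF Vo] in auto)
  then have 1: "(1 - 1 / real N)\<^sup>2 * ?EB V \<le> ?EB U" using Y(2) U(2) by linarith
  have EBA: "energy d m B u \<le> energy d n (entries A) u" for u
    using inv by (simp add: fd_inv_def)
  have 2: "?EB U \<le> ?EA U" "?EB V \<le> ?EA V" by (intro sum_mono EBA)+
  have "?EB V \<le> ?F" using 2(2) energy_sum_le_total[OF Vo, of n "entries A"] F by linarith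
  have dN: "1 / real N \<le> \<delta>" using N N0 by (simp add: field_simps)
  have "?EB V - 2 * \<delta> * ?F \<le> (1 - 1 / real N)\<^sup>2 * ?EB V"
  proof -
    have "1 - 2 * \<delta> \<le> (1 - 1 / real N)\<^sup>2"
    proof -
      have "1 - 2 * \<delta> \<le> 1 - 2 * (1 / real N)" using dN by linarith
      also have "\<dots> \<le> 1 - 2 * (1 / real N) + (1 / real N)\<^sup>2" by simp
      also have "\<dots> = (1 - 1 / real N)\<^sup>2" by (simp add: power2_eq_square algebra_simps)
      finally show ?thesis .
    qed
    then have "(1 - 2 * \<delta>) * ?EB V \<le> (1 - 1 / real N)\<^sup>2 * ?EB V"
      by (intro mult_right_mono sum_nonneg) auto
    moreover have "2 * \<delta> * ?EB V \<le> 2 * \<delta> * ?F" using \<open>?EB V \<le> ?F\<close> del by simp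
    ultimately show ?thesis by (simp add: algebra_simps)
  qed
  then have 3: "?EB V \<le> ?EA U + 2 * (\<delta> * ?F)" using 1 2(1) by linarith
  have "?EA V \<le> ?EB V + \<epsilon> * (total_sq d n (entries A) - ?EA V) + 2 * (\<delta> * ?F)"
    using del F0 eps by (intro fd_projection_energy[OF inv Vo m _ _ _ f]) auto
  then show "pnmf_cost A U \<le> (1 + \<epsilon>) * pnmf_cost A V + 4 * (\<delta> * ?F)"
    unfolding pnmf_cost_eq[OF A Uc Uo] pnmf_cost_eq[OF A Vc Vo]
    using 3 by (simp add: algebra_simps)
qed (use k eps in auto)

section \<open>The sketching program\<close>

text \<open>Reals live only in arrays, so a real variable is the entry (0, 0) of an array, and a
  vector is row 0.\<close>

abbreviation "scalar a \<equiv> RCell a (NConst 0) (NConst 0)"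
abbreviation "row0 a x \<equiv> RCell a (NConst 0) (NVar x)"
abbreviation "ent a x y \<equiv> RCell a (NVar x) (NVar y)"
abbreviation "put a e \<equiv> RAssign a (NConst 0) (NConst 0) e"
abbreviation "nat_lit c \<equiv> RNat (NConst c)"

definition DotLoop :: "string \<Rightarrow> string \<Rightarrow> string \<Rightarrow> string \<Rightarrow> string \<Rightarrow> com" where
  "DotLoop a b p c q = SumLoop a ''i'' ''d'' (RMul (ent b ''i'' p) (ent c ''i'' q))"

lemma nmods_DotLoop [simp]: "nmods (DotLoop a b p c q) = {''i''}"
  and rmods_DotLoop [simp]: "rmods (DotLoop a b p c q) = {a}"
  by (simp_all add: DotLoop_def)

lemma wp_DotLoop:
  assumes "nvar s ''d'' = d" "a \<noteq> b" "a \<noteq> c" "p \<noteq> ''i''" "q \<noteq> ''i''"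
  shows "wp (DotLoop a b p c q) s (\<lambda>t s'. t \<le> d * 22 + 11 \<and>
     cell s' a 0 0 = dot d (column (cell s b) (nvar s p)) (column (cell s c) (nvar s q)) \<and>
     eqx {''i''} {a} s s')"
proof -
  have "wp (DotLoop a b p c q) s (\<lambda>t s'. t \<le> d * (rcost (RMul (ent b ''i'' p) (ent c ''i'' q)) + 15) + 11 \<and>
     cell s' a 0 0 = (\<Sum>i<d. cell s b i (nvar s p) * cell s c i (nvar s q)) \<and> eqx {''i''} {a} s s')"
    unfolding DotLoop_def
    by (rule wp_SumLoop) (use assms in \<open>auto simp: eqx_def\<close>)
  then show ?thesis by (simp add: dot_def)
qed

definition frob_com :: com where
  "frob_com = Seq (put ''F'' (nat_lit 0)) (For ''j'' ''n''
     (Seq (DotLoop ''t'' ''A'' ''j'' ''A'' ''j'') (put ''F'' (RAdd (scalar ''F'') (scalar ''t'')))))"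

lemma wp_frob_com:
  assumes d: "nvar s ''d'' = d" and n: "nvar s ''n'' = n"
  shows "wp frob_com s (\<lambda>t s'. t \<le> n * (d * 22 + 40) + 20 \<and>
     cell s' ''F'' 0 0 = total_sq d n (cell s ''A'') \<and> eqx {''i'', ''j''} {''t'', ''F''} s s')"
proof -
  let ?b = "Seq (DotLoop ''t'' ''A'' ''j'' ''A'' ''j'') (put ''F'' (RAdd (scalar ''F'') (scalar ''t'')))"
  let ?s = "set_cell ''F'' 0 0 0 s"
  have "wp (For ''j'' ''n'' ?b) ?s (\<lambda>t s'. t \<le> n * ((d * 22 + 25) + 8) + 6 \<and>
     cell s' ''F'' 0 0 = total_sq d n (cell s ''A'') \<and> eqx (insert ''j'' (nmods ?b)) (rmods ?b) ?s s')"
  proof (rule wp_For[where I = "\<lambda>j s'. cell s' ''F'' 0 0 = total_sq d j (cell s ''A'')"])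
    fix j s1
    assume e: "eqx (insert ''j'' (nmods ?b)) (rmods ?b) ?s s1" and j: "nvar s1 ''j'' = j"
      and I: "cell s1 ''F'' 0 0 = total_sq d j (cell s ''A'')"
    have "nvar s1 ''d'' = d" using e d by (simp add: eqx_def)
    note D = wp_DotLoop[OF this, of "''t''" "''A''" "''A''" "''j''" "''j''"]
    show "wp ?b s1 (\<lambda>t s2. t \<le> d * 22 + 25 \<and> cell s2 ''F'' 0 0 = total_sq d (Suc j) (cell s ''A''))"
      unfolding wp_Seq
      by (rule wp_mono[OF D]) (use e I j in \<open>auto simp: eqx_def total_sq_def dot_self\<close>)
  qed (use n in \<open>auto simp: total_sq_def\<close>)
  then show ?thesis
    unfolding frob_com_def wp_Seq wp_RAssign
    by simp (erule wp_mono, auto simp: eqx_def algebra_simps)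
qed

definition colnorms :: "string \<Rightarrow> string \<Rightarrow> string \<Rightarrow> string \<Rightarrow> com" where
  "colnorms b x p m = For p m (Seq (DotLoop ''t'' b p b p) (RAssign x (NConst 0) (NVar p) (scalar ''t'')))"

lemma nmods_colnorms [simp]: "nmods (colnorms b x p m) = {p, ''i''}"
  and rmods_colnorms [simp]: "rmods (colnorms b x p m) = {''t'', x}"
  by (auto simp: colnorms_def)

lemma wp_colnorms:
  assumes d: "nvar s ''d'' = d" and m: "nvar s mv = m"
    and ne: "b \<noteq> ''t''" "b \<noteq> x" "x \<noteq> ''t''" "p \<noteq> ''i''" "p \<noteq> ''d''" "mv \<noteq> p" "mv \<noteq> ''i''"
  shows "wp (colnorms b x p mv) s (\<lambda>t s'. t \<le> m * (d * 22 + 25) + 6 \<and>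
     (\<forall>r<m. cell s' x 0 r = sq d (column (cell s b) r)) \<and> eqx {p, ''i''} {''t'', x} s s')"
proof -
  let ?b = "Seq (DotLoop ''t'' b p b p) (RAssign x (NConst 0) (NVar p) (scalar ''t''))"
  have "wp (For p mv ?b) s (\<lambda>t s'. t \<le> m * ((d * 22 + 17) + 8) + 6 \<and>
     (\<forall>r<m. cell s' x 0 r = sq d (column (cell s b) r)) \<and> eqx (insert p (nmods ?b)) (rmods ?b) s s')"
  proof (rule wp_For[where I = "\<lambda>j s'. \<forall>r<j. cell s' x 0 r = sq d (column (cell s b) r)"])
    fix j s1
    assume e: "eqx (insert p (nmods ?b)) (rmods ?b) s s1" and j: "nvar s1 p = j"
      and I: "\<forall>r<j. cell s1 x 0 r = sq d (column (cell s b) r)"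
    have "nvar s1 ''d'' = d" using e d ne by (simp add: eqx_def)
    note D = wp_DotLoop[OF this, of "''t''" b b p p]
    show "wp ?b s1 (\<lambda>t s2. t \<le> d * 22 + 17 \<and> (\<forall>r<Suc j. cell s2 x 0 r = sq d (column (cell s b) r)))"
      unfolding wp_Seq
      by (rule wp_mono[OF D]) (use e I j ne in \<open>auto simp: eqx_def dot_self less_Suc_eq\<close>)
  qed (use m ne in auto)
  then show ?thesis
    unfolding colnorms_def by (rule wp_mono) (auto simp: eqx_def algebra_simps)
qed

section \<open>One iteration of the sketching loop\<close>

definition argmin_com :: com where
  "argmin_com = Seq (NAssign ''mp'' (NConst 0)) (For ''p'' ''m''
     (Cond (RLess (row0 ''X'' ''p'') (row0 ''X'' ''mp'')) (NAssign ''mp'' (NVar ''p'')) Skip))"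

lemma wp_argmin_com:
  assumes m: "nvar s ''m'' = m" "0 < m"
  shows "wp argmin_com s (\<lambda>t s'. t \<le> m * 20 + 10 \<and> nvar s' ''mp'' < m \<and>
     (\<forall>p<m. cell s ''X'' 0 (nvar s' ''mp'') \<le> cell s ''X'' 0 p) \<and> eqx {''p'', ''mp''} {} s s')"
proof -
  let ?b = "Cond (RLess (row0 ''X'' ''p'') (row0 ''X'' ''mp'')) (NAssign ''mp'' (NVar ''p'')) Skip"
  let ?s = "set_nvar ''mp'' 0 s"
  have "wp (For ''p'' ''m'' ?b) ?s (\<lambda>t s'. t \<le> m * (10 + 8) + 6 \<and>
     (nvar s' ''mp'' < m \<and> (\<forall>p<m. cell s ''X'' 0 (nvar s' ''mp'') \<le> cell s ''X'' 0 p)) \<and>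
     eqx (insert ''p'' (nmods ?b)) (rmods ?b) ?s s')"
  proof (rule wp_For[where I = "\<lambda>j s'. nvar s' ''mp'' < m \<and>
      (\<forall>p<j. cell s ''X'' 0 (nvar s' ''mp'') \<le> cell s ''X'' 0 p)"])
    fix j s1
    assume j: "j < m" "nvar s1 ''p'' = j" and e: "eqx (insert ''p'' (nmods ?b)) (rmods ?b) ?s s1"
      and I: "nvar s1 ''mp'' < m \<and> (\<forall>p<j. cell s ''X'' 0 (nvar s1 ''mp'') \<le> cell s ''X'' 0 p)"
    show "wp ?b s1 (\<lambda>t s2. t \<le> 10 \<and> nvar s2 ''mp'' < m \<and>
        (\<forall>p<Suc j. cell s ''X'' 0 (nvar s2 ''mp'') \<le> cell s ''X'' 0 p))"
      using j e I by (auto simp: eqx_def less_Suc_eq intro: order_trans[OF less_imp_le])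
  qed (use m in auto)
  then show ?thesis
    unfolding argmin_com_def wp_Seq wp_NAssign
    by simp (erule wp_mono, auto simp: eqx_def algebra_simps)
qed

text \<open>The cosine of the two columns exceeds 1/m in modulus; the squared form without division
  is what \<open>pair_test\<close> evaluates. Pairs with a column of squared norm at most
  \<open>f\<close> are exempt, because rotating them need not lower the potential enough.\<close>

definition correlated :: "nat \<Rightarrow> nat \<Rightarrow> real \<Rightarrow> (nat \<Rightarrow> nat \<Rightarrow> real) \<Rightarrow> nat \<Rightarrow> nat \<Rightarrow> bool" where
  "correlated d m f B p q \<longleftrightarrow> f < sq d (column B p) \<and> f < sq d (column B q) \<and>
     sq d (column B p) * sq d (column B q) < (real m)\<^sup>2 * (dot d (column B p) (column B q))\<^sup>2"

definition pair_test :: bexp where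
  "pair_test = BAnd (RLess (scalar ''f'') (row0 ''X'' ''p'')) (BAnd (RLess (scalar ''f'') (row0 ''X'' ''q''))
     (RLess (RMul (row0 ''X'' ''p'') (row0 ''X'' ''q''))
        (RMul (RMul (RNat (NVar ''m'')) (RNat (NVar ''m''))) (RMul (scalar ''g'') (scalar ''g'')))))"

definition pair_body :: com where
  "pair_body = Seq (DotLoop ''g'' ''B'' ''p'' ''B'' ''q'')
     (Cond pair_test (Seq (NAssign ''bad'' (NConst 1)) (Seq (NAssign ''bp'' (NVar ''p''))
        (Seq (NAssign ''bq'' (NVar ''q'')) (put ''gb'' (scalar ''g''))))) Skip)"

definition pairs_com :: com where
  "pairs_com = Seq (NAssign ''bad'' (NConst 0)) (For ''p'' ''m'' (For ''q'' ''p'' pair_body))"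

definition pair_found where
  "pair_found d m f B s \<longleftrightarrow> nvar s ''bad'' = 1 \<and> nvar s ''bp'' < m \<and> nvar s ''bq'' < nvar s ''bp'' \<and>
     correlated d m f B (nvar s ''bp'') (nvar s ''bq'') \<and>
     cell s ''gb'' 0 0 = dot d (column B (nvar s ''bp'')) (column B (nvar s ''bq''))"

lemma mods_pair_body [simp]:
  "nmods pair_body = {''i'', ''bad'', ''bp'', ''bq''}" "rmods pair_body = {''g'', ''gb''}"
  by (auto simp: pair_body_def)

lemma pair_found_set_nvar [simp]:
  "x \<notin> {''bad'', ''bp'', ''bq''} \<Longrightarrow> pair_found d m f B (set_nvar x v s) = pair_found d m f B s"
  by (auto simp: pair_found_def)

lemma wp_pair_body:
  assumes s: "nvar s ''d'' = d" "nvar s ''m'' = m" "cell s ''B'' = B" "cell s ''f'' 0 0 = f"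
    and X: "\<And>p. p < m \<Longrightarrow> cell s ''X'' 0 p = sq d (column B p)"
    and pq: "nvar s ''p'' = p" "nvar s ''q'' = q" "p < m" "q < p"
  shows "wp pair_body s (\<lambda>t s'. t \<le> d * 22 + 70 \<and>
     (if correlated d m f B p q then pair_found d m f B s'
      else nvar s' ''bad'' = nvar s ''bad'' \<and> (pair_found d m f B s \<longrightarrow> pair_found d m f B s')))"
  unfolding pair_body_def wp_Seq
proof (rule wp_mono[OF wp_DotLoop[OF s(1)]], goal_cases)
  case (5 t s1)
  then have e: "eqx {''i''} {''g''} s s1" and t: "t \<le> d * 22 + 11"
    and g: "cell s1 ''g'' 0 0 = dot d (column B p) (column B q)"
    using pq s by auto
  have "bval pair_test s1 \<longleftrightarrow> correlated d m f B p q"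
    using e g s pq X by (simp add: pair_test_def correlated_def eqx_def power2_eq_square)
  moreover have "bcost pair_test \<le> 40" by (simp add: pair_test_def)
  ultimately show ?case
    using e g t pq by (auto simp: pair_found_def eqx_def)
qed auto

text \<open>Loops have no early exit, so all pairs are tested and the last correlated one is kept.
  By symmetry of the condition the pairs with q < p suffice.\<close>

lemma wp_pairs_com:
  assumes s: "nvar s ''d'' = d" "nvar s ''m'' = m" "cell s ''B'' = B" "cell s ''f'' 0 0 = f"
    and X: "\<And>p. p < m \<Longrightarrow> cell s ''X'' 0 p = sq d (column B p)"
  shows "wp pairs_com s (\<lambda>t s'. t \<le> m * (m * (d * 22 + 80) + 14) + 8 \<and>
     (nvar s' ''bad'' = 0 \<and> (\<forall>p<m. \<forall>q<p. \<not> correlated d m f B p q) \<or> pair_found d m f B s') \<and>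
     eqx {''i'', ''p'', ''q'', ''bad'', ''bp'', ''bq''} {''g'', ''gb''} s s')"
proof -
  let ?c = "\<lambda>p q. correlated d m f B p q"
  let ?in = "For ''q'' ''p'' pair_body"
  let ?s = "set_nvar ''bad'' 0 s"
  have "wp (For ''p'' ''m'' ?in) ?s (\<lambda>t s'. t \<le> m * ((m * (d * 22 + 78) + 6) + 8) + 6 \<and>
     (nvar s' ''bad'' = 0 \<and> (\<forall>p<m. \<forall>q<p. \<not> ?c p q) \<or> pair_found d m f B s') \<and>
     eqx (insert ''p'' (nmods ?in)) (rmods ?in) ?s s')"
  proof (rule wp_For[where I = "\<lambda>j s'. nvar s' ''bad'' = 0 \<and> (\<forall>p<j. \<forall>q<p. \<not> ?c p q) \<or> pair_found d m f B s'"],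
      goal_cases)
    case (7 p s1)
    have "wp ?in s1 (\<lambda>t s2. t \<le> p * ((d * 22 + 70) + 8) + 6 \<and>
        (nvar s2 ''bad'' = 0 \<and> (\<forall>p'<p. \<forall>q<p'. \<not> ?c p' q) \<and> (\<forall>q<p. \<not> ?c p q) \<or> pair_found d m f B s2) \<and>
        eqx (insert ''q'' (nmods pair_body)) (rmods pair_body) s1 s2)"
    proof (rule wp_For[where I = "\<lambda>j s'. nvar s' ''bad'' = 0 \<and> (\<forall>p'<p. \<forall>q<p'. \<not> ?c p' q) \<and>
         (\<forall>q<j. \<not> ?c p q) \<or> pair_found d m f B s'"], goal_cases)
      case (7 q s2)
      show ?case
        by (rule wp_mono[OF wp_pair_body[where d = d and m = m and B = B and f = f and p = p and q = q]])
          (use 7 \<open>p < m\<close> \<open>nvar s1 ''p'' = p\<close> \<open>eqx _ _ ?s s1\<close> s X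
            in \<open>auto simp: eqx_def less_Suc_eq split: if_splits\<close>)
    qed (use 7 in \<open>simp_all add: eqx_def\<close>)
    moreover have "p * ((d * 22 + 70) + 8) + 6 \<le> m * (d * 22 + 78) + 6"
      using mult_le_mono1[of p m "d * 22 + 78"] 7(1) by (simp add: algebra_simps)
    ultimately show ?case
      by (elim wp_mono) (auto simp: less_Suc_eq intro: order_trans)
  qed (use s in auto)
  then show ?thesis
    unfolding pairs_com_def wp_Seq wp_NAssign
    by simp (erule wp_mono, auto simp: eqx_def algebra_simps)
qed

definition rotate_com :: com where
  "rotate_com =
     Seq (put ''W'' (RDiv (RAdd (RSub (row0 ''X'' ''bq'') (row0 ''X'' ''bp''))
            (RSqrt (RAdd (RMul (RSub (row0 ''X'' ''bp'') (row0 ''X'' ''bq'')) (RSub (row0 ''X'' ''bp'') (row0 ''X'' ''bq'')))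
               (RMul (nat_lit 4) (RMul (scalar ''gb'') (scalar ''gb'')))))) (nat_lit 2)))
    (Seq (put ''rr'' (RSqrt (RAdd (RMul (scalar ''gb'') (scalar ''gb'')) (RMul (scalar ''W'') (scalar ''W'')))))
    (Seq (put ''co'' (RDiv (scalar ''gb'') (scalar ''rr'')))
    (Seq (put ''si'' (RDiv (scalar ''W'') (scalar ''rr'')))
    (For ''i'' ''d'' (Seq (put ''t'' (ent ''B'' ''i'' ''bp''))
       (Seq (RAssign ''B'' (NVar ''i'') (NVar ''bp'')
          (RAdd (RMul (scalar ''co'') (scalar ''t'')) (RMul (scalar ''si'') (ent ''B'' ''i'' ''bq''))))
       (RAssign ''B'' (NVar ''i'') (NVar ''bq'')
          (RSub (RMul (scalar ''co'') (ent ''B'' ''i'' ''bq'')) (RMul (scalar ''si'') (scalar ''t''))))))))))"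

lemma wp_rotate_com:
  assumes s: "nvar s ''d'' = d" "cell s ''B'' = B" "cell s ''gb'' 0 0 = g"
    and pq: "nvar s ''bp'' = p" "nvar s ''bq'' = q" "p \<noteq> q"
    and X: "cell s ''X'' 0 p = x" "cell s ''X'' 0 q = y"
  defines "w \<equiv> (y - x + sqrt ((x - y)\<^sup>2 + 4 * g\<^sup>2)) / 2"
  defines "r \<equiv> sqrt (g\<^sup>2 + w\<^sup>2)"
  shows "wp rotate_com s (\<lambda>t s'. t \<le> d * 60 + 120 \<and>
     cell s' ''B'' = (\<lambda>i j. if i < d \<and> j = p then g / r * B i p + w / r * B i q
       else if i < d \<and> j = q then g / r * B i q - w / r * B i p else B i j) \<and>
     eqx {''i''} {''W'', ''rr'', ''co'', ''si'', ''t'', ''B''} s s')"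
proof -
  let ?b = "Seq (put ''t'' (ent ''B'' ''i'' ''bp''))
       (Seq (RAssign ''B'' (NVar ''i'') (NVar ''bp'')
          (RAdd (RMul (scalar ''co'') (scalar ''t'')) (RMul (scalar ''si'') (ent ''B'' ''i'' ''bq''))))
       (RAssign ''B'' (NVar ''i'') (NVar ''bq'')
          (RSub (RMul (scalar ''co'') (ent ''B'' ''i'' ''bq'')) (RMul (scalar ''si'') (scalar ''t'')))))"
  define s1 where "s1 = set_cell ''si'' 0 0 (w / r) (set_cell ''co'' 0 0 (g / r)
     (set_cell ''rr'' 0 0 r (set_cell ''W'' 0 0 w s)))"
  let ?R = "\<lambda>l i j. if i < l \<and> j = p then g / r * B i p + w / r * B i q
       else if i < l \<and> j = q then g / r * B i q - w / r * B i p else B i j"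
  have "wp (For ''i'' ''d'' ?b) s1 (\<lambda>t s'. t \<le> d * (45 + 8) + 6 \<and> cell s' ''B'' = ?R d \<and>
     eqx (insert ''i'' (nmods ?b)) (rmods ?b) s1 s')"
  proof (rule wp_For[where I = "\<lambda>l s'. cell s' ''B'' = ?R l"], goal_cases)
    case (7 i s2)
    then show ?case using pq by (auto simp: eqx_def s1_def less_Suc_eq fun_eq_iff)
  qed (use s in \<open>auto simp: s1_def\<close>)
  then show ?thesis
    unfolding rotate_com_def wp_Seq wp_RAssign
    using s pq X
    by (simp add: w_def[symmetric] r_def[symmetric] power2_eq_square[symmetric] s1_def[symmetric])
      (erule wp_mono, auto simp: eqx_def s1_def)
qed

definition shrink_com :: com where
  "shrink_com = For ''p'' ''m'' (For ''i'' ''d'' (RAssign ''B'' (NVar ''i'') (NVar ''p'')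
     (RMul (ent ''B'' ''i'' ''p'') (RSqrt (RSub (nat_lit 1) (RDiv (row0 ''X'' ''mp'') (row0 ''X'' ''p'')))))))"

lemma wp_shrink_com:
  assumes s: "nvar s ''d'' = d" "nvar s ''m'' = m" "cell s ''B'' = B" "nvar s ''mp'' = mp"
  shows "wp shrink_com s (\<lambda>t s'. t \<le> m * (d * 30 + 14) + 6 \<and>
     cell s' ''B'' = (\<lambda>i r. if r < m \<and> i < d then B i r * sqrt (1 - cell s ''X'' 0 mp / cell s ''X'' 0 r)
       else B i r) \<and> eqx {''i'', ''p''} {''B''} s s')"
proof -
  let ?a = "RAssign ''B'' (NVar ''i'') (NVar ''p'')
     (RMul (ent ''B'' ''i'' ''p'') (RSqrt (RSub (nat_lit 1) (RDiv (row0 ''X'' ''mp'') (row0 ''X'' ''p'')))))"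
  let ?v = "\<lambda>i r. B i r * sqrt (1 - cell s ''X'' 0 mp / cell s ''X'' 0 r)"
  let ?in = "For ''i'' ''d'' ?a"
  have "wp (For ''p'' ''m'' ?in) s (\<lambda>t s'. t \<le> m * ((d * (22 + 8) + 6) + 8) + 6 \<and>
     cell s' ''B'' = (\<lambda>i r. if r < m \<and> i < d then ?v i r else B i r) \<and>
     eqx (insert ''p'' (nmods ?in)) (rmods ?in) s s')"
  proof (rule wp_For[where I = "\<lambda>p s'. cell s' ''B'' = (\<lambda>i r. if r < p \<and> i < d then ?v i r else B i r)"],
      goal_cases)
    case (7 p s1)
    have "wp ?in s1 (\<lambda>t s2. t \<le> d * (22 + 8) + 6 \<and>
       cell s2 ''B'' = (\<lambda>i r. if r < p \<and> i < d \<or> r = p \<and> i < d then ?v i r else B i r) \<and>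
       eqx (insert ''i'' (nmods ?a)) (rmods ?a) s1 s2)"
    proof (rule wp_For[where I = "\<lambda>l s'. cell s' ''B'' = (\<lambda>i r. if r < p \<and> i < d \<or> r = p \<and> i < l then ?v i r else B i r)"],
        goal_cases)
      case (7 i s2)
      then show ?case using \<open>nvar s1 ''p'' = p\<close> \<open>eqx _ _ s s1\<close> s
        by (auto simp: eqx_def less_Suc_eq fun_eq_iff)
    qed (use 7 s in \<open>auto simp: eqx_def fun_eq_iff\<close>)
    then show ?case by (rule wp_mono) (auto simp: fun_eq_iff less_Suc_eq)
  qed (use s in auto)
  then show ?thesis
    unfolding shrink_com_def by (rule wp_mono) (auto simp: eqx_def algebra_simps)
qed

definition insert_com :: com where
  "insert_com = Seq (For ''i'' ''d'' (RAssign ''B'' (NVar ''i'') (NVar ''mp'') (ent ''A'' ''i'' ''c'')))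
     (NAssign ''c'' (NAdd (NVar ''c'') (NConst 1)))"

lemma wp_insert_com:
  assumes s: "nvar s ''d'' = d" "cell s ''B'' = B" "nvar s ''mp'' = mp" "nvar s ''c'' = c"
  shows "wp insert_com s (\<lambda>t s'. t \<le> d * 14 + 10 \<and> nvar s' ''c'' = Suc c \<and>
     cell s' ''B'' = (\<lambda>i r. if r = mp \<and> i < d then cell s ''A'' i c else B i r) \<and>
     eqx {''i'', ''c''} {''B''} s s')"
proof -
  let ?a = "RAssign ''B'' (NVar ''i'') (NVar ''mp'') (ent ''A'' ''i'' ''c'')"
  have "wp (For ''i'' ''d'' ?a) s (\<lambda>t s2. t \<le> d * (6 + 8) + 6 \<and>
       cell s2 ''B'' = (\<lambda>i r. if r = mp \<and> i < d then cell s ''A'' i c else B i r) \<and>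
       eqx (insert ''i'' (nmods ?a)) (rmods ?a) s s2)"
  proof (rule wp_For[where I = "\<lambda>l s'. cell s' ''B'' = (\<lambda>i r. if r = mp \<and> i < l then cell s ''A'' i c else B i r)"],
        goal_cases)
    case (7 i s2)
    then show ?case using s by (auto simp: eqx_def less_Suc_eq fun_eq_iff)
  qed (use s in auto)
  then show ?thesis
    unfolding insert_com_def wp_Seq by (rule wp_mono) (use s in \<open>auto simp: eqx_def algebra_simps\<close>)
qed

definition sketch_body :: com where
  "sketch_body = Seq (colnorms ''B'' ''X'' ''p'' ''m'') (Seq argmin_com (Seq pairs_com
     (Cond (NLess (NConst 0) (NVar ''bad'')) rotate_com
        (Cond (RLess (scalar ''f'') (row0 ''X'' ''mp'')) shrink_com insert_com))))"

lemma mods_sketch [simp]: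
  "nmods argmin_com = {''p'', ''mp''}" "rmods argmin_com = {}"
  "nmods pairs_com = {''i'', ''p'', ''q'', ''bad'', ''bp'', ''bq''}" "rmods pairs_com = {''g'', ''gb''}"
  "nmods rotate_com = {''i''}" "rmods rotate_com = {''W'', ''rr'', ''co'', ''si'', ''t'', ''B''}"
  "nmods shrink_com = {''i'', ''p''}" "rmods shrink_com = {''B''}"
  "nmods insert_com = {''i'', ''c''}" "rmods insert_com = {''B''}"
  by (auto simp: argmin_com_def pairs_com_def rotate_com_def shrink_com_def insert_com_def)

text \<open>Each iteration makes one move, and each move lowers \<open>fd_measure\<close> by 1. A
  correlated pair is rotated. If there is none, the smallest column decides: above \<open>f\<close>
  the buffer is shrunk, otherwise that column gives way to the next column of \<open>A\<close>. The
  time is dominated by O(m^2) inner products of length d.\<close>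

lemma wp_sketch_body:
  assumes s: "nvar s ''d'' = d" "nvar s ''m'' = m" "cell s ''f'' 0 0 = f" "nvar s ''c'' = c"
    and pos: "0 < m" "0 < d" "0 < f" "c < n"
    and inv: "fd_inv d m (cell s ''A'') f c (cell s ''B'') D"
  shows "wp sketch_body s (\<lambda>t s'. t \<le> 500 * (m * m * d) \<and> nvar s' ''c'' \<le> n \<and>
     (\<exists>D. fd_inv d m (cell s ''A'') f (nvar s' ''c'') (cell s' ''B'') D) \<and>
     fd_measure d n m (cell s ''A'') f (nvar s' ''c'') (cell s' ''B'') + 1 \<le>
     fd_measure d n m (cell s ''A'') f c (cell s ''B''))"
proof -
  define a where "a = cell s ''A''"
  define B where "B = cell s ''B''"
  have mono: "m \<le> m * m * d" "d \<le> m * m * d" "m * d \<le> m * m * d" "m * m \<le> m * m * d" "1 \<le> m * m * d"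
    using pos by (auto simp: mult.assoc)
  have 1: "wp (colnorms ''B'' ''X'' ''p'' ''m'') s (\<lambda>t s'. t \<le> m * (d * 22 + 25) + 6 \<and>
     (\<forall>r<m. cell s' ''X'' 0 r = sq d (column B r)) \<and> eqx {''p'', ''i''} {''t'', ''X''} s s')"
    unfolding B_def by (rule wp_colnorms) (use s in auto)
  let ?C = "Cond (NLess (NConst 0) (NVar ''bad'')) rotate_com
    (Cond (RLess (scalar ''f'') (row0 ''X'' ''mp'')) shrink_com insert_com)"
  let ?R = "\<lambda>s'. nvar s' ''c'' \<le> n \<and> (\<exists>D. fd_inv d m a f (nvar s' ''c'') (cell s' ''B'') D) \<and>
    fd_measure d n m a f (nvar s' ''c'') (cell s' ''B'') + 1 \<le> fd_measure d n m a f c B"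
  show ?thesis
    unfolding sketch_body_def wp_Seq a_def[symmetric] B_def[symmetric]
  proof (rule wp_mono[OF 1], elim conjE)
    fix t1 s1
    assume t1: "t1 \<le> m * (d * 22 + 25) + 6" and X1: "\<forall>r<m. cell s1 ''X'' 0 r = sq d (column B r)"
      and e1: "eqx {''p'', ''i''} {''t'', ''X''} s s1"
    have 2: "wp argmin_com s1 (\<lambda>t s'. t \<le> m * 20 + 10 \<and> nvar s' ''mp'' < m \<and>
      (\<forall>p<m. cell s1 ''X'' 0 (nvar s' ''mp'') \<le> cell s1 ''X'' 0 p) \<and> eqx {''p'', ''mp''} {} s1 s')"
      by (rule wp_argmin_com) (use s e1 pos in \<open>auto simp: eqx_def\<close>)
    show "wp argmin_com s1 (\<lambda>t2 s2. wp pairs_com s2 (\<lambda>t3 s3.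
      wp ?C s3 (\<lambda>t4 s4. t1 + (t2 + (t3 + t4)) \<le> 500 * (m * m * d) \<and> ?R s4)))"
    proof (rule wp_mono[OF 2], elim conjE)
      fix t2 s2
      assume t2: "t2 \<le> m * 20 + 10" and mp: "nvar s2 ''mp'' < m"
        and le2: "\<forall>p<m. cell s1 ''X'' 0 (nvar s2 ''mp'') \<le> cell s1 ''X'' 0 p"
        and e2: "eqx {''p'', ''mp''} {} s1 s2"
      have s2: "nvar s2 ''d'' = d" "nvar s2 ''m'' = m" "cell s2 ''B'' = B" "cell s2 ''f'' 0 0 = f"
        "nvar s2 ''c'' = c" "cell s2 ''A'' = a"
        "\<And>r. r < m \<Longrightarrow> cell s2 ''X'' 0 r = sq d (column B r)"
        using s e1 e2 X1 by (auto simp: eqx_def B_def a_def)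
      define la where "la = sq d (column B (nvar s2 ''mp''))"
      have la: "la \<le> sq d (column B r)" if "r < m" for r
        using le2 mp X1 that by (auto simp: la_def)
      have 3: "wp pairs_com s2 (\<lambda>t s'. t \<le> m * (m * (d * 22 + 80) + 14) + 8 \<and>
        (nvar s' ''bad'' = 0 \<and> (\<forall>p<m. \<forall>q<p. \<not> correlated d m f B p q) \<or> pair_found d m f B s') \<and>
        eqx {''i'', ''p'', ''q'', ''bad'', ''bp'', ''bq''} {''g'', ''gb''} s2 s')"
        by (rule wp_pairs_com) (use s2 in auto)
      show "wp pairs_com s2 (\<lambda>t3 s3.
        wp ?C s3 (\<lambda>t4 s4. t1 + (t2 + (t3 + t4)) \<le> 500 * (m * m * d) \<and> ?R s4))"
      proof (rule wp_mono[OF 3], elim conjE)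
        fix t3 s3
        assume t3: "t3 \<le> m * (m * (d * 22 + 80) + 14) + 8"
          and found: "nvar s3 ''bad'' = 0 \<and> (\<forall>p<m. \<forall>q<p. \<not> correlated d m f B p q) \<or> pair_found d m f B s3"
          and e3: "eqx {''i'', ''p'', ''q'', ''bad'', ''bp'', ''bq''} {''g'', ''gb''} s2 s3"
        have s3: "nvar s3 ''d'' = d" "nvar s3 ''m'' = m" "cell s3 ''B'' = B" "cell s3 ''f'' 0 0 = f"
          "nvar s3 ''c'' = c" "cell s3 ''A'' = a" "nvar s3 ''mp'' = nvar s2 ''mp''"
          "\<And>r. r < m \<Longrightarrow> cell s3 ''X'' 0 r = sq d (column B r)"
          using s2 e3 by (auto simp: eqx_def)
        have time: "t1 + (t2 + (t3 + t)) \<le> 500 * (m * m * d)"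
          if "t \<le> d * 60 + 120 + (m * (d * 30 + 14) + 6) + d * 14 + 30" for t
        proof -
          have "t1 + (t2 + (t3 + t)) \<le> 22 * (m * m * d) + 80 * (m * m) + 52 * (m * d) + 73 * m + 74 * d + 190"
            using that t1 t2 t3 by (simp add: algebra_simps)
          then show ?thesis using mono by linarith
        qed
        let ?Q = "\<lambda>t4 s4. t1 + (t2 + (t3 + t4)) \<le> 500 * (m * m * d) \<and> ?R s4"
        have inv': "fd_inv d m a f c B D" using inv by (simp add: a_def B_def)
        show "wp ?C s3 (\<lambda>t4 s4. t1 + (t2 + (t3 + t4)) \<le> 500 * (m * m * d) \<and> ?R s4)"
        proof (cases "nvar s3 ''bad'' = 0")
          case False
          then have F: "pair_found d m f B s3" using found by simp
          define p q where "p = nvar s3 ''bp''" and "q = nvar s3 ''bq''"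
          have pq: "p < m" "q < m" "p \<noteq> q" and g: "cell s3 ''gb'' 0 0 = dot d (column B p) (column B q)"
            and corr: "f < sq d (column B p)" "f < sq d (column B q)"
              "sq d (column B p) * sq d (column B q) < (real m)\<^sup>2 * (dot d (column B p) (column B q))\<^sup>2"
            using F by (auto simp: pair_found_def correlated_def p_def q_def)
          let ?g = "dot d (column B p) (column B q)"
          let ?w = "(sq d (column B q) - sq d (column B p) +
            sqrt ((sq d (column B p) - sq d (column B q))\<^sup>2 + 4 * ?g\<^sup>2)) / 2"
          let ?r = "sqrt (?g\<^sup>2 + ?w\<^sup>2)"
          have "0 < sq d (column B p) * sq d (column B q)" using corr(1,2) pos by simp
          then have g0: "?g \<noteq> 0" using corr(3) by auto
          note J = jacobi_rotation[OF g0, where x = "sq d (column B p)" and y = "sq d (column B q)"]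
          have "wp rotate_com s3 (\<lambda>t. ?Q (1 + bcost (NLess (NConst 0) (NVar ''bad'')) + t))"
          proof (rule wp_mono[OF wp_rotate_com[OF s3(1,3) g p_def[symmetric] q_def[symmetric] pq(3)
                s3(8)[OF pq(1)] s3(8)[OF pq(2)]]], elim conjE)
            fix t s4
            assume t: "t \<le> d * 60 + 120" and e4: "eqx {''i''} {''W'', ''rr'', ''co'', ''si'', ''t'', ''B''} s3 s4"
              and B4: "cell s4 ''B'' = (\<lambda>i j. if i < d \<and> j = p then ?g / ?r * B i p + ?w / ?r * B i q
                else if i < d \<and> j = q then ?g / ?r * B i q - ?w / ?r * B i p else B i j)"
            have c4: "nvar s4 ''c'' = c" using e4 s3 by (simp add: eqx_def)
            note R = rotate_columns[OF pq J(1), of d "cell s4 ''B''" B]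
            have R1: "energy d m (cell s4 ''B'') u = energy d m B u" for u
              by (rule R(1)) (use B4 pq in auto)
            have R2: "total_sq d m (cell s4 ''B'') = total_sq d m B"
              by (rule R(2)) (use B4 pq in auto)
            have R3: "sq d (column (cell s4 ''B'') p) = (?g / ?r)\<^sup>2 * sq d (column B p)
              + 2 * (?g / ?r) * (?w / ?r) * ?g + (?w / ?r)\<^sup>2 * sq d (column B q)"
              by (rule R(3)) (use B4 pq in auto)
            have R4: "sq d (column (cell s4 ''B'') q) = (?g / ?r)\<^sup>2 * sq d (column B q)
              - 2 * (?g / ?r) * (?w / ?r) * ?g + (?w / ?r)\<^sup>2 * sq d (column B p)"
              by (rule R(4)) (use B4 pq in auto)
            have R5: "sq d (column (cell s4 ''B'') r) = sq d (column B r)"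
              if "r < m" "r \<noteq> p" "r \<noteq> q" for r
              using that B4 by (intro sq_cong) auto
            have id: "(c\<^sup>2 * x + 2 * c * t * g + t\<^sup>2 * y) + (c\<^sup>2 * y - 2 * c * t * g + t\<^sup>2 * x) =
              (c\<^sup>2 + t\<^sup>2) * (x + y)" for c t x y g :: real
              by (simp add: algebra_simps)
            have sum: "sq d (column (cell s4 ''B'') p) + sq d (column (cell s4 ''B'') q) =
              sq d (column B p) + sq d (column B q)"
            proof -
              have "sq d (column (cell s4 ''B'') p) + sq d (column (cell s4 ''B'') q) =
                ((?g / ?r)\<^sup>2 + (?w / ?r)\<^sup>2) * (sq d (column B p) + sq d (column B q))"
                unfolding R3 R4 by (rule id)
              then show ?thesis using J(1) by simp
            qed
            have prod: "sq d (column (cell s4 ''B'') p) * sq d (column (cell s4 ''B'') q) =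
              sq d (column B p) * sq d (column B q) - ?g\<^sup>2"
              unfolding R3 R4 by (rule J(2))
            have "fd_inv d m a f c (cell s4 ''B'') D"
              using inv' by (simp add: fd_inv_def R1 R2)
            moreover have "fd_measure d n m a f c (cell s4 ''B'') + 1 \<le> fd_measure d n m a f c B"
              by (rule fd_measure_rotate[OF pos(3) pq corr sum prod R5])
            ultimately show "?Q (1 + bcost (NLess (NConst 0) (NVar ''bad'')) + t) s4"
              using t pos c4 time[of "1 + bcost (NLess (NConst 0) (NVar ''bad'')) + t"] by auto
          qed
          then show "wp ?C s3 ?Q"
            using False unfolding wp_Cond by simp
        next
          case True
          then have near: "\<not> correlated d m f B p q" if "p < m" "q < p" for p q
            using found that by (auto simp: pair_found_def)
          have inner: "wp (Cond (RLess (scalar ''f'') (row0 ''X'' ''mp'')) shrink_com insert_com) s3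
            (\<lambda>t. ?Q (4 + t))"
          proof (cases "f < la")
            case True
            \<comment> \<open>The smallest column exceeds \<open>f\<close>, so all do; the exemption
              in \<open>correlated\<close> then hides no pair, and the buffer is nearly orthogonal
              as a whole.\<close>
            have gt: "f < sq d (column B p)" if "p < m" for p using la[OF that] True by linarith
            have orth: "(real m)\<^sup>2 * (dot d (column B p) (column B q))\<^sup>2 \<le> sq d (column B p) * sq d (column B q)"
              if "p < m" "q < m" "p \<noteq> q" for p q
            proof (cases "q < p")
              case True
              then show ?thesis using near[of p q] gt that by (simp add: correlated_def)
            next
              case False
              then show ?thesis using near[of q p] gt that
                by (simp add: correlated_def dot_commute[of d "column B q"] mult.commute)
            qed
            have "wp shrink_com s3 (\<lambda>t. ?Q (4 + (8 + t)))"
            proof (rule wp_mono[OF wp_shrink_com[OF s3(1-3,7)]], elim conjE)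
              fix t s4
              assume t: "t \<le> m * (d * 30 + 14) + 6" and e4: "eqx {''i'', ''p''} {''B''} s3 s4"
                and B4: "cell s4 ''B'' = (\<lambda>i r. if r < m \<and> i < d
                  then B i r * sqrt (1 - cell s3 ''X'' 0 (nvar s2 ''mp'') / cell s3 ''X'' 0 r) else B i r)"
              have c4: "nvar s4 ''c'' = c" using e4 s3 by (simp add: eqx_def)
              have "cell s4 ''B'' i r = B i r * sqrt (1 - la / sq d (column B r))" if "i < d" "r < m" for i r
                using that mp by (simp add: B4 s3 la_def)
              note S = fd_shrink[OF inv' pos(3) True mp la_def[symmetric] la orth this]
              show "?Q (4 + (8 + t)) s4"
                using S(1) S(2)[of n] c4 t pos time[of "4 + (8 + t)"] by auto
            qed
            then show ?thesis using True mp s3 by (simp add: la_def)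
          next
            case False
            have "wp insert_com s3 (\<lambda>t. ?Q (4 + (8 + t)))"
            proof (rule wp_mono[OF wp_insert_com[OF s3(1,3,7,5)]], elim conjE)
              fix t s4
              assume t: "t \<le> d * 14 + 10" and c4: "nvar s4 ''c'' = Suc c"
                and B4: "cell s4 ''B'' = (\<lambda>i r. if r = nvar s2 ''mp'' \<and> i < d
                  then cell s3 ''A'' i c else B i r)"
              have "fd_inv d m a f (Suc c) (cell s4 ''B'') D"
                by (rule fd_inv_insert[OF inv' mp]) (use False B4 s3 in \<open>auto simp: la_def\<close>)
              moreover have "fd_measure d n m a f (Suc c) (cell s4 ''B'') + 1 \<le> fd_measure d n m a f c B"
                by (rule fd_measure_insert[OF pos(3) mp pos(4)]) (use B4 s3 in auto)
              ultimately show "?Q (4 + (8 + t)) s4"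
                using c4 t pos time[of "4 + (8 + t)"] by auto
            qed
            then show ?thesis using False mp s3 by (simp add: la_def)
          qed
          show "wp ?C s3 ?Q"
            unfolding wp_Cond[of "NLess (NConst 0) (NVar ''bad'')"] using True
            by (simp del: wp_Cond) (rule wp_mono[OF inner], simp)
        qed
      qed
    qed
  qed
qed

definition sketch_com :: com where
  "sketch_com = While (NLess (NVar ''c'') (NVar ''n'')) sketch_body"

lemma mods_sketch_com [simp]:
  "nmods sketch_com = {''i'', ''p'', ''q'', ''bad'', ''bp'', ''bq'', ''mp'', ''c''}"
  "rmods sketch_com = {''t'', ''X'', ''g'', ''gb'', ''W'', ''rr'', ''co'', ''si'', ''B''}"
  by (auto simp: sketch_com_def sketch_body_def)

lemma wp_sketch_com:
  assumes s: "nvar s ''d'' = d" "nvar s ''m'' = m" "nvar s ''n'' = n" "cell s ''f'' 0 0 = f" "nvar s ''c'' = 0"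
    "cell s ''A'' = a" "cell s ''B'' = (\<lambda>_ _. 0)"
    and pos: "0 < m" "0 < d" "0 < f"
  shows "wp sketch_com s (\<lambda>t s'. real t \<le> (4 * (real m)\<^sup>2 * (total_sq d n a / f) + real n + 1) * (510 * (real m * real m * real d)) \<and>
     (\<exists>D. fd_inv d m a f n (cell s' ''B'') D) \<and> eqx (nmods sketch_com) (rmods sketch_com) s s')"
proof -
  let ?M = "\<lambda>s'. fd_measure d n m a f (nvar s' ''c'') (cell s' ''B'')"
  let ?I = "\<lambda>s'. eqx (nmods sketch_body) (rmods sketch_body) s s' \<and> nvar s' ''c'' \<le> n \<and>
     (\<exists>D. fd_inv d m a f (nvar s' ''c'') (cell s' ''B'') D)"
  have mods: "''d'' \<notin> nmods sketch_body" "''m'' \<notin> nmods sketch_body" "''n'' \<notin> nmods sketch_body"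
    "''f'' \<notin> rmods sketch_body" "''A'' \<notin> rmods sketch_body"
    by (auto simp: sketch_body_def)
  have M0: "?M s = 4 * (real m)\<^sup>2 * (total_sq d n a / f) + real n"
    unfolding s by (rule fd_measure_zero) simp
  have "wp sketch_com s (\<lambda>t s'. t \<le> nat \<lfloor>?M s\<rfloor> * (500 * (m * m * d) + 1 + bcost (NLess (NVar ''c'') (NVar ''n''))) + 1 +
     bcost (NLess (NVar ''c'') (NVar ''n'')) \<and> ?I s' \<and> \<not> bval (NLess (NVar ''c'') (NVar ''n'')) s')"
    unfolding sketch_com_def
  \<comment> \<open>\<open>fd_measure\<close> is a nonnegative real that falls by at least 1, so its
    floor is a natural-valued variant.\<close>
  proof (rule wp_While_bound[where M = "\<lambda>s. nat \<lfloor>?M s\<rfloor>"])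
    show "?I s" using fd_inv_zero[of d m "cell s ''B''" a f] s by auto
    fix s1 assume I: "?I s1" and b: "bval (NLess (NVar ''c'') (NVar ''n'')) s1"
    then obtain D where D: "fd_inv d m a f (nvar s1 ''c'') (cell s1 ''B'') D" by auto
    have s1: "nvar s1 ''d'' = d" "nvar s1 ''m'' = m" "nvar s1 ''n'' = n" "cell s1 ''f'' 0 0 = f" "cell s1 ''A'' = a"
      using I mods s unfolding eqx_def by simp_all
    have "wp sketch_body s1 (\<lambda>t s'. (t \<le> 500 * (m * m * d) \<and> nvar s' ''c'' \<le> n \<and>
       (\<exists>D. fd_inv d m (cell s1 ''A'') f (nvar s' ''c'') (cell s' ''B'') D) \<and>
       fd_measure d n m (cell s1 ''A'') f (nvar s' ''c'') (cell s' ''B'') + 1 \<le>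
       fd_measure d n m (cell s1 ''A'') f (nvar s1 ''c'') (cell s1 ''B'')) \<and>
       eqx (nmods sketch_body) (rmods sketch_body) s1 s')"
      by (rule wp_frame, rule wp_sketch_body[where D = D]) (use s1 pos b D in auto)
    then show "wp sketch_body s1 (\<lambda>t s'. t \<le> 500 * (m * m * d) \<and> ?I s' \<and> nat \<lfloor>?M s'\<rfloor> < nat \<lfloor>?M s1\<rfloor>)"
    proof (rule wp_mono, unfold s1, elim conjE, intro conjI)
      fix t s' assume e: "eqx (nmods sketch_body) (rmods sketch_body) s1 s'"
        and M: "?M s' + 1 \<le> ?M s1"
      show "eqx (nmods sketch_body) (rmods sketch_body) s s'" using I e eqx_trans by blast
      have "0 \<le> ?M s'" by (rule fd_measure_nonneg[OF pos(3)])
      then have "0 \<le> \<lfloor>?M s'\<rfloor>" by simp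
      moreover have "\<lfloor>?M s'\<rfloor> + 1 \<le> \<lfloor>?M s1\<rfloor>" using M by linarith
      ultimately show "nat \<lfloor>?M s'\<rfloor> < nat \<lfloor>?M s1\<rfloor>" by linarith
    qed
  qed simp
  then show ?thesis
  proof (rule wp_mono, elim conjE)
    fix t s'
    assume t: "t \<le> nat \<lfloor>?M s\<rfloor> * (500 * (m * m * d) + 1 + bcost (NLess (NVar ''c'') (NVar ''n''))) + 1 +
        bcost (NLess (NVar ''c'') (NVar ''n''))"
      and e: "eqx (nmods sketch_body) (rmods sketch_body) s s'" and c: "nvar s' ''c'' \<le> n"
      and D: "\<exists>D. fd_inv d m a f (nvar s' ''c'') (cell s' ''B'') D"
      and b: "\<not> bval (NLess (NVar ''c'') (NVar ''n'')) s'"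
    have "nvar s' ''n'' = n" using e mods(3) s(3) unfolding eqx_def by simp
    then have cn: "nvar s' ''c'' = n" using b c by simp
    have K1: "1 \<le> m * m * d" using pos by simp
    have M0': "0 \<le> ?M s" by (rule fd_measure_nonneg[OF pos(3)])
    have "t \<le> (nat \<lfloor>?M s\<rfloor> + 1) * (510 * (m * m * d))"
    proof -
      have *: "t \<le> (A + 1) * (510 * K)" if "t \<le> A * (500 * K + 4) + 4" "1 \<le> K" for A K :: nat
      proof -
        have "A * (500 * K + 4) \<le> A * (510 * K)" using that(2) by (intro mult_le_mono2) simp
        then have "t \<le> A * (510 * K) + 510 * K" using that by linarith
        then show ?thesis by (simp add: algebra_simps)
      qed
      show ?thesis by (rule *) (use t K1 in \<open>simp_all add: algebra_simps\<close>)
    qed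
    then have "real t \<le> real ((nat \<lfloor>?M s\<rfloor> + 1) * (510 * (m * m * d)))" by (rule of_nat_mono)
    also have "\<dots> = (real (nat \<lfloor>?M s\<rfloor>) + 1) * (510 * (real m * real m * real d))" by (simp add: distrib_right)
    also have "\<dots> \<le> (?M s + 1) * (510 * (real m * real m * real d))"
      using M0' by (intro mult_right_mono add_right_mono) auto
    finally show "real t \<le> (4 * (real m)\<^sup>2 * (total_sq d n a / f) + real n + 1) * (510 * (real m * real m * real d)) \<and>
       (\<exists>D. fd_inv d m a f n (cell s' ''B'') D) \<and> eqx (nmods sketch_com) (rmods sketch_com) s s'"
      using D e unfolding M0 cn sketch_com_def by simp
  qed
qed

section \<open>The search program\<close>

definition gvals :: "nat \<Rightarrow> nat \<Rightarrow> (nat \<Rightarrow> nat \<Rightarrow> real) \<Rightarrow> (nat \<Rightarrow> nat) \<Rightarrow> nat \<Rightarrow> nat \<Rightarrow> real" where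
  "gvals m k B z i j = (\<Sum>p<m. coef m (k * m) z p j * B i p)"

definition gval_com :: com where
  "gval_com = SumLoop ''a'' ''p'' ''m'' (RMul
     (RSub (RCell ''Z'' (NConst 0) (NAdd (NVar ''q'') (NVar ''p'')))
           (RCell ''Z'' (NConst 0) (NAdd (NAdd (NVar ''q'') (NVar ''p'')) (NVar ''H''))))
     (ent ''B'' ''i'' ''p''))"

text \<open>Register \<open>q\<close> follows j m, the start of block j in the grid point, by
  repeated addition, as integers cannot be multiplied.\<close>

definition row_body :: com where
  "row_body = Seq (RAssign ''Y'' (NVar ''i'') (NVar ''j'') (nat_lit 0)) (Seq gval_com
     (Seq (Cond (RLess (scalar ''v'') (scalar ''a''))
        (Seq (put ''v'' (scalar ''a'')) (NAssign ''jj'' (NVar ''j''))) Skip)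
     (NAssign ''q'' (NAdd (NVar ''q'') (NVar ''m'')))))"

text \<open>Starting \<open>v\<close> at 0 yields the positive part of the row maximum; column 0 is
  the default for a row without positive values.\<close>

definition row_com :: com where
  "row_com = Seq (put ''v'' (nat_lit 0)) (Seq (NAssign ''jj'' (NConst 0)) (Seq (NAssign ''q'' (NConst 0))
     (Seq (For ''j'' ''k'' row_body) (RAssign ''Y'' (NVar ''i'') (NVar ''jj'') (scalar ''v'')))))"

definition assign_com :: com where
  "assign_com = For ''i'' ''d'' row_com"

lemma mods_row [simp]:
  "nmods gval_com = {''p''}" "rmods gval_com = {''a''}"
  "nmods row_body = {''p'', ''jj'', ''q''}" "rmods row_body = {''Y'', ''a'', ''v''}"
  "nmods row_com = {''j'', ''p'', ''jj'', ''q''}" "rmods row_com = {''Y'', ''a'', ''v''}"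
  "nmods assign_com = {''i'', ''j'', ''p'', ''jj'', ''q''}" "rmods assign_com = {''Y'', ''a'', ''v''}"
  by (auto simp: gval_com_def row_body_def row_com_def assign_com_def)

lemma wp_gval_com:
  assumes s: "nvar s ''m'' = m" "nvar s ''H'' = k * m" "cell s ''B'' = B" "cell s ''Z'' 0 = real \<circ> z"
    "nvar s ''i'' = i" "nvar s ''q'' = j * m"
  shows "wp gval_com s (\<lambda>t s'. t \<le> m * 34 + 11 \<and> cell s' ''a'' 0 0 = gvals m k B z i j \<and> eqx {''p''} {''a''} s s')"
proof -
  let ?e = "RMul (RSub (RCell ''Z'' (NConst 0) (NAdd (NVar ''q'') (NVar ''p'')))
           (RCell ''Z'' (NConst 0) (NAdd (NAdd (NVar ''q'') (NVar ''p'')) (NVar ''H''))))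
     (ent ''B'' ''i'' ''p'')"
  have "wp gval_com s (\<lambda>t s'. t \<le> m * (rcost ?e + 15) + 11 \<and>
     cell s' ''a'' 0 0 = (\<Sum>p<m. coef m (k * m) z p j * B i p) \<and> eqx {''p''} {''a''} s s')"
    unfolding gval_com_def
    by (rule wp_SumLoop) (use s in \<open>auto simp: eqx_def coef_def\<close>)
  then show ?thesis by (rule wp_mono) (simp add: gvals_def)
qed

definition row_ok :: "nat \<Rightarrow> (nat \<Rightarrow> nat \<Rightarrow> real) \<Rightarrow> (nat \<Rightarrow> nat \<Rightarrow> real) \<Rightarrow> nat \<Rightarrow> bool" where
  "row_ok k G Y i \<longleftrightarrow> (\<exists>l<k. \<exists>v\<ge>0. (\<forall>j<k. Y i j = (if j = l then v else 0)) \<and>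
     (\<forall>j<k. G i j \<le> v) \<and> (0 < v \<longrightarrow> v = G i l))"

lemma wp_row_com:
  assumes s: "nvar s ''m'' = m" "nvar s ''k'' = k" "nvar s ''H'' = k * m" "cell s ''B'' = B"
    "cell s ''Z'' 0 = real \<circ> z" "nvar s ''i'' = i" and k: "0 < k"
  shows "wp row_com s (\<lambda>t s'. t \<le> k * (m * 34 + 60) + 20 \<and> row_ok k (gvals m k B z) (cell s' ''Y'') i \<and>
     (\<forall>r. r \<noteq> i \<longrightarrow> cell s' ''Y'' r = cell s ''Y'' r))"
proof -
  let ?G = "gvals m k B z"
  define s0 where "s0 = set_nvar ''q'' 0 (set_nvar ''jj'' 0 (set_cell ''v'' 0 0 0 s))"
  let ?I = "\<lambda>j s'. nvar s' ''q'' = j * m \<and> nvar s' ''jj'' < k \<and> 0 \<le> cell s' ''v'' 0 0 \<and>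
     (\<forall>l<j. ?G i l \<le> cell s' ''v'' 0 0) \<and>
     (0 < cell s' ''v'' 0 0 \<longrightarrow> cell s' ''v'' 0 0 = ?G i (nvar s' ''jj'')) \<and>
     (\<forall>l<j. cell s' ''Y'' i l = 0) \<and> (\<forall>r. r \<noteq> i \<longrightarrow> cell s' ''Y'' r = cell s ''Y'' r)"
  have "wp (For ''j'' ''k'' row_body) s0 (\<lambda>t s'. t \<le> k * ((m * 34 + 45) + 8) + 6 \<and> ?I k s' \<and>
     eqx (insert ''j'' (nmods row_body)) (rmods row_body) s0 s')"
  proof (rule wp_For[where I = ?I], goal_cases)
    case (7 j s1)
    let ?s1 = "set_cell ''Y'' i j 0 s1"
    have e: "nvar s1 ''i'' = i" "nvar s1 ''m'' = m" "nvar s1 ''H'' = k * m" "cell s1 ''B'' = B"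
      "cell s1 ''Z'' 0 = real \<circ> z"
      using 7(2) s by (auto simp: eqx_def s0_def)
    have G: "wp gval_com ?s1 (\<lambda>t s'. t \<le> m * 34 + 11 \<and> cell s' ''a'' 0 0 = ?G i j \<and> eqx {''p''} {''a''} ?s1 s')"
      by (rule wp_gval_com) (use e 7 in auto)
    have "wp gval_com ?s1 (\<lambda>t1 s2. wp (Seq (Cond (RLess (scalar ''v'') (scalar ''a''))
        (Seq (put ''v'' (scalar ''a'')) (NAssign ''jj'' (NVar ''j''))) Skip)
        (NAssign ''q'' (NAdd (NVar ''q'') (NVar ''m'')))) s2 (\<lambda>t2 s3. 5 + (t1 + t2) \<le> m * 34 + 45 \<and> ?I (Suc j) s3))"
    proof (rule wp_mono[OF G], elim conjE)
      fix t s2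
      assume t: "t \<le> m * 34 + 11" and a: "cell s2 ''a'' 0 0 = ?G i j" and e2: "eqx {''p''} {''a''} ?s1 s2"
      have s2: "nvar s2 ''q'' = j * m" "nvar s2 ''m'' = m" "nvar s2 ''j'' = j" "nvar s2 ''jj'' = nvar s1 ''jj''"
        "cell s2 ''v'' = cell s1 ''v''" "cell s2 ''Y'' = (cell s1 ''Y'')(i := (cell s1 ''Y'' i)(j := 0))"
        using e2 7 e by (auto simp: eqx_def)
      show "wp (Seq (Cond (RLess (scalar ''v'') (scalar ''a''))
        (Seq (put ''v'' (scalar ''a'')) (NAssign ''jj'' (NVar ''j''))) Skip)
        (NAssign ''q'' (NAdd (NVar ''q'') (NVar ''m'')))) s2 (\<lambda>t2 s3. 5 + (t + t2) \<le> m * 34 + 45 \<and> ?I (Suc j) s3)"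
        using t a s2 7(1,4) by (auto simp: less_Suc_eq intro: order_trans[OF _ less_imp_le])
    qed
    then show ?case
      unfolding row_body_def wp_Seq[of "RAssign _ _ _ _"] wp_Seq[of gval_com] wp_RAssign
      using e(1) 7(3) by simp
  qed (use s k in \<open>auto simp: s0_def\<close>)
  then have F: "wp (For ''j'' ''k'' row_body) s0 (\<lambda>t s'. t \<le> k * (m * 34 + 53) + 6 \<and> ?I k s' \<and>
     eqx (insert ''j'' (nmods row_body)) (rmods row_body) s0 s')" by (simp add: algebra_simps)
  have "wp (For ''j'' ''k'' row_body) s0 (\<lambda>t s1. wp (RAssign ''Y'' (NVar ''i'') (NVar ''jj'') (scalar ''v'')) s1
     (\<lambda>t2 s'. 9 + (t + t2) \<le> k * (m * 34 + 60) + 20 \<and> row_ok k ?G (cell s' ''Y'') i \<and>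
     (\<forall>r. r \<noteq> i \<longrightarrow> cell s' ''Y'' r = cell s ''Y'' r)))"
  proof (rule wp_mono[OF F], elim conjE)
    fix t s1
    assume t: "t \<le> k * (m * 34 + 53) + 6" and e: "eqx (insert ''j'' (nmods row_body)) (rmods row_body) s0 s1"
      and I: "nvar s1 ''jj'' < k" "0 \<le> cell s1 ''v'' 0 0" "\<forall>l<k. ?G i l \<le> cell s1 ''v'' 0 0"
        "0 < cell s1 ''v'' 0 0 \<longrightarrow> cell s1 ''v'' 0 0 = ?G i (nvar s1 ''jj'')"
        "\<forall>l<k. cell s1 ''Y'' i l = 0" "\<forall>r. r \<noteq> i \<longrightarrow> cell s1 ''Y'' r = cell s ''Y'' r"
    have i: "nvar s1 ''i'' = i" using e s by (simp add: eqx_def s0_def)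
    have "row_ok k ?G ((cell s1 ''Y'')(i := (cell s1 ''Y'' i)(nvar s1 ''jj'' := cell s1 ''v'' 0 0))) i"
      unfolding row_ok_def using I
      by (intro exI[of _ "nvar s1 ''jj''"] conjI exI[of _ "cell s1 ''v'' 0 0"]) auto
    moreover have "k * (m * 34 + 53) + 20 \<le> k * (m * 34 + 60) + 20" by simp
    ultimately show "wp (RAssign ''Y'' (NVar ''i'') (NVar ''jj'') (scalar ''v'')) s1
     (\<lambda>t2 s'. 9 + (t + t2) \<le> k * (m * 34 + 60) + 20 \<and> row_ok k ?G (cell s' ''Y'') i \<and>
     (\<forall>r. r \<noteq> i \<longrightarrow> cell s' ''Y'' r = cell s ''Y'' r))"
      using I(6) i t k by (simp add: algebra_simps)
  qed
  then show ?thesis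
    unfolding row_com_def wp_Seq wp_RAssign wp_NAssign by (simp add: s0_def)
qed

lemma wp_assign_com:
  assumes s: "nvar s ''d'' = d" "nvar s ''m'' = m" "nvar s ''k'' = k" "nvar s ''H'' = k * m" "cell s ''B'' = B"
    "cell s ''Z'' 0 = real \<circ> z" and k: "0 < k"
  shows "wp assign_com s (\<lambda>t s'. t \<le> d * (k * (m * 34 + 60) + 28) + 6 \<and>
     assigns d k (gvals m k B z) (cell s' ''Y'') \<and> eqx (nmods assign_com) (rmods assign_com) s s')"
proof -
  have "wp assign_com s (\<lambda>t s'. t \<le> d * ((k * (m * 34 + 60) + 20) + 8) + 6 \<and>
     (\<forall>r<d. row_ok k (gvals m k B z) (cell s' ''Y'') r) \<and>
     eqx (insert ''i'' (nmods row_com)) (rmods row_com) s s')"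
    unfolding assign_com_def
  proof (rule wp_For[where I = "\<lambda>i s'. \<forall>r<i. row_ok k (gvals m k B z) (cell s' ''Y'') r"], goal_cases)
    case (7 i s1)
    have R: "wp row_com s1 (\<lambda>t s'. t \<le> k * (m * 34 + 60) + 20 \<and> row_ok k (gvals m k B z) (cell s' ''Y'') i \<and>
     (\<forall>r. r \<noteq> i \<longrightarrow> cell s' ''Y'' r = cell s1 ''Y'' r))"
      by (rule wp_row_com) (use 7 s k in \<open>auto simp: eqx_def\<close>)
    show ?case
      by (rule wp_mono[OF R]) (use 7 in \<open>auto simp: less_Suc_eq row_ok_def\<close>)
  qed (use s in auto)
  then show ?thesis
    by (rule wp_mono) (auto simp: assigns_def row_ok_def add.commute[of _ 28])
qed

definition obj_inner :: com where
  "obj_inner = Seq (DotLoop ''t'' ''Y'' ''j'' ''B'' ''p'')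
     (put ''w'' (RAdd (scalar ''w'') (RMul (scalar ''t'') (scalar ''t''))))"

definition obj_body :: com where
  "obj_body = Seq (DotLoop ''nj'' ''Y'' ''j'' ''Y'' ''j'') (Seq (put ''w'' (nat_lit 0))
     (Seq (For ''p'' ''m'' obj_inner)
     (put ''obj'' (RAdd (scalar ''obj'') (RDiv (scalar ''w'') (scalar ''nj''))))))"

definition obj_com :: com where
  "obj_com = Seq (put ''obj'' (nat_lit 0)) (For ''j'' ''k'' obj_body)"

lemma mods_obj [simp]:
  "nmods obj_inner = {''i''}" "rmods obj_inner = {''t'', ''w''}"
  "nmods obj_body = {''i'', ''p''}" "rmods obj_body = {''nj'', ''t'', ''w'', ''obj''}"
  "nmods obj_com = {''j'', ''i'', ''p''}" "rmods obj_com = {''nj'', ''t'', ''w'', ''obj''}"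
  by (auto simp: obj_inner_def obj_body_def obj_com_def)

lemma wp_obj_inner:
  assumes s: "nvar s ''d'' = d" "cell s ''B'' = B" "cell s ''Y'' = Y" "nvar s ''j'' = j" "nvar s ''p'' = p"
  shows "wp obj_inner s (\<lambda>t s'. t \<le> d * 22 + 30 \<and>
     cell s' ''w'' 0 0 = cell s ''w'' 0 0 + (dot d (column Y j) (column B p))\<^sup>2)"
  unfolding obj_inner_def wp_Seq
  by (rule wp_mono[OF wp_DotLoop[OF s(1)]]) (use s in \<open>auto simp: eqx_def power2_eq_square\<close>)

lemma wp_obj_body:
  assumes s: "nvar s ''d'' = d" "nvar s ''m'' = m" "cell s ''B'' = B" "cell s ''Y'' = Y" "nvar s ''j'' = j"
  shows "wp obj_body s (\<lambda>t s'. t \<le> d * 22 + m * (d * 22 + 38) + 50 \<and>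
     cell s' ''obj'' 0 0 = cell s ''obj'' 0 0 + energy d m B (column Y j) / sq d (column Y j))"
  unfolding obj_body_def wp_Seq
proof (rule wp_mono[OF wp_DotLoop[OF s(1)]], goal_cases)
  case (5 t s1)
  then have e: "eqx {''i''} {''nj''} s s1" and t: "t \<le> d * 22 + 11"
    and nj: "cell s1 ''nj'' 0 0 = sq d (column Y j)"
    using s by (auto simp: dot_self)
  let ?s1 = "set_cell ''w'' 0 0 0 s1"
  have F: "wp (For ''p'' ''m'' obj_inner) ?s1 (\<lambda>t s'. t \<le> m * ((d * 22 + 30) + 8) + 6 \<and>
     cell s' ''w'' 0 0 = energy d m B (column Y j) \<and> eqx (insert ''p'' (nmods obj_inner)) (rmods obj_inner) ?s1 s')"
  proof (rule wp_For[where I = "\<lambda>p s'. cell s' ''w'' 0 0 = energy d p B (column Y j)"], goal_cases)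
    case (7 p s2)
    show ?case
      by (rule wp_mono[OF wp_obj_inner[where d = d and B = B and Y = Y and j = j and p = p]])
        (use 7 s e in \<open>auto simp: eqx_def energy_def\<close>)
  qed (use s e in \<open>auto simp: eqx_def energy_def\<close>)
  have "wp (For ''p'' ''m'' obj_inner) ?s1 (\<lambda>t1 s2. wp (put ''obj'' (RAdd (scalar ''obj'') (RDiv (scalar ''w'') (scalar ''nj''))))
     s2 (\<lambda>t2 s'. t + (5 + (t1 + t2)) \<le> d * 22 + m * (d * 22 + 38) + 50 \<and>
     cell s' ''obj'' 0 0 = cell s ''obj'' 0 0 + energy d m B (column Y j) / sq d (column Y j)))"
    by (rule wp_mono[OF F]) (use t nj e in \<open>auto simp: eqx_def algebra_simps\<close>)
  then show ?case by simp
qed auto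

lemma wp_obj_com:
  assumes s: "nvar s ''d'' = d" "nvar s ''m'' = m" "nvar s ''k'' = k" "cell s ''B'' = B" "cell s ''Y'' = Y"
  shows "wp obj_com s (\<lambda>t s'. t \<le> k * (d * 22 + m * (d * 22 + 38) + 58) + 15 \<and>
     cell s' ''obj'' 0 0 = captured d m k B Y \<and> eqx (nmods obj_com) (rmods obj_com) s s')"
proof -
  let ?s = "set_cell ''obj'' 0 0 0 s"
  have "wp (For ''j'' ''k'' obj_body) ?s (\<lambda>t s'. t \<le> k * ((d * 22 + m * (d * 22 + 38) + 50) + 8) + 6 \<and>
     cell s' ''obj'' 0 0 = captured d m k B Y \<and> eqx (insert ''j'' (nmods obj_body)) (rmods obj_body) ?s s')"
  proof (rule wp_For[where I = "\<lambda>j s'. cell s' ''obj'' 0 0 = captured d m j B Y"], goal_cases)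
    case (7 j s1)
    show ?case
      by (rule wp_mono[OF wp_obj_body[where d = d and m = m and B = B and Y = Y and j = j]])
        (use 7 s in \<open>auto simp: eqx_def captured_def\<close>)
  qed (use s in \<open>auto simp: captured_def\<close>)
  then show ?thesis
    unfolding obj_com_def wp_Seq wp_RAssign
    by simp (erule wp_mono, auto simp: eqx_def algebra_simps)
qed

definition keep_com :: com where
  "keep_com = Cond (RLess (scalar ''best'') (scalar ''obj''))
     (Seq (put ''best'' (scalar ''obj'')) (For ''i'' ''d'' (For ''j'' ''k''
        (RAssign ''U'' (NVar ''i'') (NVar ''j'') (ent ''Y'' ''i'' ''j''))))) Skip"

lemma mods_keep [simp]: "nmods keep_com = {''i'', ''j''}" "rmods keep_com = {''best'', ''U''}"
  by (auto simp: keep_com_def)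

lemma wp_keep_com:
  assumes s: "nvar s ''d'' = d" "nvar s ''k'' = k" "cell s ''Y'' = Y"
  shows "wp keep_com s (\<lambda>t s'. t \<le> d * (k * 14 + 14) + 30 \<and>
     (if cell s ''best'' 0 0 < cell s ''obj'' 0 0
      then cell s' ''best'' 0 0 = cell s ''obj'' 0 0 \<and> (\<forall>i<d. \<forall>j<k. cell s' ''U'' i j = Y i j)
      else s' = s))"
proof -
  let ?a = "RAssign ''U'' (NVar ''i'') (NVar ''j'') (ent ''Y'' ''i'' ''j'')"
  let ?s = "set_cell ''best'' 0 0 (cell s ''obj'' 0 0) s"
  have "wp (For ''i'' ''d'' (For ''j'' ''k'' ?a)) ?s (\<lambda>t s'. t \<le> d * ((k * (6 + 8) + 6) + 8) + 6 \<and>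
     (\<forall>i<d. \<forall>j<k. cell s' ''U'' i j = Y i j) \<and>
     eqx (insert ''i'' (nmods (For ''j'' ''k'' ?a))) (rmods (For ''j'' ''k'' ?a)) ?s s')"
  proof (rule wp_For[where I = "\<lambda>i s'. \<forall>r<i. \<forall>j<k. cell s' ''U'' r j = Y r j"], goal_cases)
    case (7 i s1)
    have "wp (For ''j'' ''k'' ?a) s1 (\<lambda>t s'. t \<le> k * (6 + 8) + 6 \<and>
       ((\<forall>r<i. \<forall>j<k. cell s' ''U'' r j = Y r j) \<and> (\<forall>l<k. cell s' ''U'' i l = Y i l)) \<and>
       eqx (insert ''j'' (nmods ?a)) (rmods ?a) s1 s')"
    proof (rule wp_For[where I = "\<lambda>j s'. (\<forall>r<i. \<forall>j<k. cell s' ''U'' r j = Y r j) \<and> (\<forall>l<j. cell s' ''U'' i l = Y i l)"],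
        goal_cases)
      case (7 j s2)
      then show ?case using \<open>nvar s1 ''i'' = i\<close> \<open>eqx _ _ ?s s1\<close> s by (auto simp: eqx_def less_Suc_eq)
    qed (use 7 s in \<open>auto simp: eqx_def\<close>)
    then show ?case by (rule wp_mono) (auto simp: less_Suc_eq)
  qed (use s in auto)
  then have F: "wp (For ''i'' ''d'' (For ''j'' ''k'' ?a)) ?s (\<lambda>t s'. t \<le> d * (k * 14 + 14) + 6 \<and>
     (\<forall>i<d. \<forall>j<k. cell s' ''U'' i j = Y i j) \<and> cell s' ''best'' 0 0 = cell s ''obj'' 0 0)"
  proof (rule wp_mono, elim conjE, intro conjI)
    fix t s'
    assume t: "t \<le> d * ((k * (6 + 8) + 6) + 8) + 6" and U: "\<forall>i<d. \<forall>j<k. cell s' ''U'' i j = Y i j"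
      and e: "eqx (insert ''i'' (nmods (For ''j'' ''k'' ?a))) (rmods (For ''j'' ''k'' ?a)) ?s s'"
    show "t \<le> d * (k * 14 + 14) + 6" using t by (simp add: algebra_simps)
    show "\<forall>i<d. \<forall>j<k. cell s' ''U'' i j = Y i j" by (rule U)
    show "cell s' ''best'' 0 0 = cell s ''obj'' 0 0" using e by (simp add: eqx_def)
  qed
  show ?thesis
    unfolding keep_com_def
    by simp (intro impI wp_mono[OF F], simp)
qed

text \<open>Coordinates are stored as reals. With the coordinates before \<open>q\<close> cleared,
  \<open>S\<close> is the sum of the others. If it has reached R, incrementing coordinate
  \<open>q\<close> would leave the ball; so this coordinate is cleared too and the carry moves
  on.\<close>

definition next_loop :: com where
  "next_loop = While (BAnd (NLess (NVar ''q'') (NVar ''Q'')) (BNot (RLess (scalar ''S'') (scalar ''R''))))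
     (Seq (put ''S'' (RSub (scalar ''S'') (row0 ''Z'' ''q'')))
     (Seq (RAssign ''Z'' (NConst 0) (NVar ''q'') (nat_lit 0)) (NAssign ''q'' (NAdd (NVar ''q'') (NConst 1)))))"

definition next_com :: com where
  "next_com = Seq (NAssign ''q'' (NConst 0)) (Seq next_loop
     (Cond (NLess (NVar ''q'') (NVar ''Q''))
        (Seq (RAssign ''Z'' (NConst 0) (NVar ''q'') (RAdd (row0 ''Z'' ''q'') (nat_lit 1)))
             (put ''S'' (RAdd (scalar ''S'') (nat_lit 1))))
        (NAssign ''run'' (NConst 0))))"

lemma mods_next [simp]:
  "nmods next_loop = {''q''}" "rmods next_loop = {''S'', ''Z''}"
  "nmods next_com = {''q'', ''run''}" "rmods next_com = {''S'', ''Z''}"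
  by (auto simp: next_loop_def next_com_def)

definition stepped :: "nat \<Rightarrow> nat \<Rightarrow> (nat \<Rightarrow> nat) \<Rightarrow> state \<Rightarrow> bool" where
  "stepped Q R z s' \<longleftrightarrow>
     (\<exists>q<Q. (\<forall>r<q. (\<Sum>i=r..<Q. z i) = R) \<and> (\<Sum>i=q..<Q. z i) < R \<and>
        cell s' ''Z'' 0 = real \<circ> bump q z \<and> cell s' ''S'' 0 0 = real (\<Sum>i<Q. bump q z i) \<and>
        nvar s' ''run'' = 1) \<or>
     (\<forall>r<Q. (\<Sum>i=r..<Q. z i) = R) \<and> nvar s' ''run'' = 0"

lemma wp_next_com:
  assumes s: "nvar s ''Q'' = Q" "cell s ''R'' 0 0 = real R" "cell s ''Z'' 0 = real \<circ> z"
    "cell s ''S'' 0 0 = real (\<Sum>q<Q. z q)" "nvar s ''run'' = 1" and z: "z \<in> grid Q R"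
  shows "wp next_com s (\<lambda>t s'. t \<le> Q * 40 + 60 \<and> stepped Q R z s')"
proof -
  let ?b = "BAnd (NLess (NVar ''q'') (NVar ''Q'')) (BNot (RLess (scalar ''S'') (scalar ''R'')))"
  let ?s = "set_nvar ''q'' 0 s"
  let ?I = "\<lambda>s'. nvar s' ''q'' \<le> Q \<and> (\<forall>r<nvar s' ''q''. (\<Sum>i=r..<Q. z i) = R) \<and>
     cell s' ''Z'' 0 = (\<lambda>i. if i < nvar s' ''q'' then 0 else real (z i)) \<and>
     cell s' ''S'' 0 0 = real (\<Sum>i=nvar s' ''q''..<Q. z i) \<and> eqx {''q''} {''S'', ''Z''} s s'"
  have L: "wp next_loop ?s (\<lambda>t s'. t \<le> Q * (20 + 1 + bcost ?b) + 1 + bcost ?b \<and> ?I s' \<and> \<not> bval ?b s')"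
    unfolding next_loop_def
  proof (rule wp_While_bound[where M = "\<lambda>s. Q - nvar s ''q''"])
    show "?I ?s" using s by (auto simp: eqx_def atLeast0LessThan)
    fix s1 assume I: "?I s1" and b: "bval ?b s1"
    have q: "nvar s1 ''q'' < Q" and R: "cell s1 ''R'' 0 0 = real R" and "nvar s1 ''Q'' = Q"
      using I b s by (auto simp: eqx_def)
    have "R \<le> (\<Sum>i=nvar s1 ''q''..<Q. z i)"
      using I b R by (simp del: of_nat_sum)
    then have sat: "(\<Sum>i=nvar s1 ''q''..<Q. z i) = R"
      using tail_sum_le[OF z, of "nvar s1 ''q''"] by simp
    have split: "(\<Sum>i=nvar s1 ''q''..<Q. z i) = z (nvar s1 ''q'') + (\<Sum>i=Suc (nvar s1 ''q'')..<Q. z i)"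
      using q by (simp add: sum.atLeast_Suc_lessThan)
    show "wp (Seq (put ''S'' (RSub (scalar ''S'') (row0 ''Z'' ''q'')))
     (Seq (RAssign ''Z'' (NConst 0) (NVar ''q'') (nat_lit 0)) (NAssign ''q'' (NAdd (NVar ''q'') (NConst 1))))) s1
     (\<lambda>t s'. t \<le> 20 \<and> ?I s' \<and> Q - nvar s' ''q'' < Q - nvar s1 ''q'')"
    proof -
      have S: "cell s1 ''S'' 0 0 - cell s1 ''Z'' 0 (nvar s1 ''q'') = real (\<Sum>i=Suc (nvar s1 ''q'')..<Q. z i)"
        using I split by (simp del: of_nat_sum)
      have Z: "(cell s1 ''Z'' 0)(nvar s1 ''q'' := 0) = (\<lambda>i. if i < Suc (nvar s1 ''q'') then 0 else real (z i))"
        using I by (auto simp: fun_eq_iff)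
      have "\<forall>r<Suc (nvar s1 ''q''). (\<Sum>i=r..<Q. z i) = R"
        using I sat by (simp add: less_Suc_eq)
      then show ?thesis
        using S Z I q by (simp add: eqx_def del: of_nat_sum)
    qed
  qed simp
  have "wp next_loop ?s (\<lambda>t1 s1. wp (Cond (NLess (NVar ''q'') (NVar ''Q''))
        (Seq (RAssign ''Z'' (NConst 0) (NVar ''q'') (RAdd (row0 ''Z'' ''q'') (nat_lit 1)))
             (put ''S'' (RAdd (scalar ''S'') (nat_lit 1))))
        (NAssign ''run'' (NConst 0))) s1 (\<lambda>t2 s'. 2 + (t1 + t2) \<le> Q * 40 + 60 \<and> stepped Q R z s'))"
  proof (rule wp_mono[OF L], elim conjE)
    fix t s1
    assume t: "t \<le> Q * (20 + 1 + bcost ?b) + 1 + bcost ?b" and b: "\<not> bval ?b s1"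
      and q: "nvar s1 ''q'' \<le> Q" and sat: "\<forall>r<nvar s1 ''q''. (\<Sum>i=r..<Q. z i) = R"
      and Z: "cell s1 ''Z'' 0 = (\<lambda>i. if i < nvar s1 ''q'' then 0 else real (z i))"
      and S: "cell s1 ''S'' 0 0 = real (\<Sum>i=nvar s1 ''q''..<Q. z i)" and e: "eqx {''q''} {''S'', ''Z''} s s1"
    have s1: "nvar s1 ''Q'' = Q" "cell s1 ''R'' 0 0 = real R" "nvar s1 ''run'' = 1"
      using e s by (auto simp: eqx_def)
    have t': "t \<le> Q * 40 + 20" using t by simp
    show "wp (Cond (NLess (NVar ''q'') (NVar ''Q''))
        (Seq (RAssign ''Z'' (NConst 0) (NVar ''q'') (RAdd (row0 ''Z'' ''q'') (nat_lit 1)))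
             (put ''S'' (RAdd (scalar ''S'') (nat_lit 1))))
        (NAssign ''run'' (NConst 0))) s1 (\<lambda>t2 s'. 2 + (t + t2) \<le> Q * 40 + 60 \<and> stepped Q R z s')"
    proof (cases "nvar s1 ''q'' < Q")
      case True
      define q' where "q' = nvar s1 ''q''"
      have less: "(\<Sum>i=q'..<Q. z i) < R" using b True s1 S by (simp add: q'_def del: of_nat_sum)
      have bs: "(\<Sum>i<Q. bump q' z i) = Suc (\<Sum>i=q'..<Q. z i)"
        using True sum_bump[of q' Q z] by (simp add: q'_def)
      have "\<exists>q<Q. (\<forall>r<q. (\<Sum>i=r..<Q. z i) = R) \<and> (\<Sum>i=q..<Q. z i) < R \<and>
         (cell s1 ''Z'' 0)(q' := cell s1 ''Z'' 0 q' + 1) = real \<circ> bump q z \<and>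
         cell s1 ''S'' 0 0 + 1 = real (\<Sum>i<Q. bump q z i)"
        using True sat less bs S Z by (intro exI[of _ q']) (auto simp: q'_def bump_def fun_eq_iff simp del: of_nat_sum)
      then show ?thesis using True s1 t' by (simp add: stepped_def q'_def del: of_nat_sum)
    next
      case False
      then show ?thesis using q sat s1 t' by (simp add: stepped_def)
    qed
  qed
  then show ?thesis unfolding next_com_def wp_Seq wp_NAssign by simp
qed

text \<open>Ties in a row maximum leave \<open>Y\<close> undetermined, hence the existential
  quantifier; \<open>captured_assigns_ge\<close> applies to whichever assignment was made.\<close>

definition visited :: "nat \<Rightarrow> nat \<Rightarrow> nat \<Rightarrow> (nat \<Rightarrow> nat \<Rightarrow> real) \<Rightarrow> (nat \<Rightarrow> nat) \<Rightarrow> real \<Rightarrow> bool" where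
  "visited d m k B z b \<longleftrightarrow> (\<exists>Y. assigns d k (gvals m k B z) Y \<and> captured d m k B Y \<le> b)"

lemma visited_mono: "visited d m k B z b \<Longrightarrow> b \<le> b' \<Longrightarrow> visited d m k B z b'"
  unfolding visited_def by (meson order_trans)

lemma scattered_cong:
  assumes "\<And>i j. i < d \<Longrightarrow> j < k \<Longrightarrow> U i j = Y i j"
  shows "scattered d k U = scattered d k Y"
  using assms by (simp add: scattered_def)

lemma captured_cong:
  assumes "\<And>i j. i < d \<Longrightarrow> j < k \<Longrightarrow> U i j = Y i j"
  shows "captured d m k B U = captured d m k B Y"
proof -
  have "dot d (column U j) v = dot d (column Y j) v" "sq d (column U j) = sq d (column Y j)" if "j < k" for j v
    using assms that by (auto intro!: dot_cong sq_cong)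
  then show ?thesis by (simp add: captured_def energy_def)
qed

definition search_body :: com where
  "search_body = Seq assign_com (Seq obj_com (Seq keep_com next_com))"

definition search_com :: com where
  "search_com = While (NLess (NConst 0) (NVar ''run'')) search_body"

lemma mods_search [simp]:
  "nmods search_body = {''i'', ''j'', ''p'', ''jj'', ''q'', ''run''}"
  "rmods search_body = {''Y'', ''a'', ''v'', ''nj'', ''t'', ''w'', ''obj'', ''best'', ''U'', ''S'', ''Z''}"
  "nmods search_com = {''i'', ''j'', ''p'', ''jj'', ''q'', ''run''}"
  "rmods search_com = {''Y'', ''a'', ''v'', ''nj'', ''t'', ''w'', ''obj'', ''best'', ''U'', ''S'', ''Z''}"
  by (auto simp: search_body_def search_com_def)

lemma wp_search_body:
  assumes s: "nvar s ''d'' = d" "nvar s ''m'' = m" "nvar s ''k'' = k" "nvar s ''H'' = k * m" "cell s ''B'' = B"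
    "nvar s ''Q'' = k * m + k * m" "cell s ''R'' 0 0 = real R" "nvar s ''run'' = 1"
    and pos: "0 < d" "0 < m" "0 < k"
    and z: "cell s ''Z'' 0 = real \<circ> z" "z \<in> grid (k * m + k * m) R"
      "cell s ''S'' 0 0 = real (\<Sum>q<k * m + k * m. z q)"
    and U: "scattered d k (cell s ''U'')" "captured d m k B (cell s ''U'') = cell s ''best'' 0 0"
  shows "wp search_body s (\<lambda>t s'. t \<le> 500 * (d * k * m) \<and>
     (scattered d k (cell s' ''U'') \<and> captured d m k B (cell s' ''U'') = cell s' ''best'' 0 0 \<and>
     cell s ''best'' 0 0 \<le> cell s' ''best'' 0 0 \<and> visited d m k B z (cell s' ''best'' 0 0) \<and>
     stepped (k * m + k * m) R z s'))"
proof -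
  let ?Q = "k * m + k * m"
  let ?G = "\<lambda>s'. scattered d k (cell s' ''U'') \<and> captured d m k B (cell s' ''U'') = cell s' ''best'' 0 0 \<and>
     cell s ''best'' 0 0 \<le> cell s' ''best'' 0 0 \<and> visited d m k B z (cell s' ''best'' 0 0)"
  define S1 where "S1 s1 \<longleftrightarrow> assigns d k (gvals m k B z) (cell s1 ''Y'') \<and>
     eqx (nmods assign_com) (rmods assign_com) s s1" for s1 :: state
  define S2 where "S2 s2 \<longleftrightarrow> assigns d k (gvals m k B z) (cell s2 ''Y'') \<and>
     cell s2 ''obj'' 0 0 = captured d m k B (cell s2 ''Y'') \<and>
     eqx (nmods assign_com \<union> nmods obj_com) (rmods assign_com \<union> rmods obj_com) s s2" for s2 :: state
  define S3 where "S3 s3 \<longleftrightarrow> ?G s3 \<and> nvar s3 ''Q'' = ?Q \<and> cell s3 ''R'' 0 0 = real R \<and>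
     nvar s3 ''run'' = 1 \<and> cell s3 ''Z'' 0 = real \<circ> z \<and> cell s3 ''S'' 0 0 = real (\<Sum>q<?Q. z q)" for s3 :: state
  have mono: "d * k \<le> d * k * m" "d \<le> d * k * m" "k * m \<le> d * k * m" "k \<le> d * k * m" "1 \<le> d * k * m"
    using pos by (auto simp: mult.assoc)
  have 1: "wp assign_com s (\<lambda>t s1. t \<le> d * (k * (m * 34 + 60) + 28) + 6 \<and> S1 s1)"
    unfolding S1_def by (rule wp_assign_com) (use s z pos in auto)
  have 2: "wp obj_com s1 (\<lambda>t s2. t \<le> k * (d * 22 + m * (d * 22 + 38) + 58) + 15 \<and> S2 s2)" if "S1 s1" for s1
  proof (rule wp_mono[OF wp_obj_com[where d = d and m = m and k = k and B = B and Y = "cell s1 ''Y''"]])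
    fix t s2
    assume "t \<le> k * (d * 22 + m * (d * 22 + 38) + 58) + 15 \<and>
      cell s2 ''obj'' 0 0 = captured d m k B (cell s1 ''Y'') \<and> eqx (nmods obj_com) (rmods obj_com) s1 s2"
    then show "t \<le> k * (d * 22 + m * (d * 22 + 38) + 58) + 15 \<and> S2 s2"
      using that unfolding S1_def S2_def by (auto simp: eqx_def)
  qed (use that s in \<open>auto simp: S1_def eqx_def\<close>)
  have 3: "wp keep_com s2 (\<lambda>t s3. t \<le> d * (k * 14 + 14) + 30 \<and> S3 s3)" if S2: "S2 s2" for s2
  proof -
    have K: "wp keep_com s2 (\<lambda>t s'. t \<le> d * (k * 14 + 14) + 30 \<and>
     (if cell s2 ''best'' 0 0 < cell s2 ''obj'' 0 0
      then cell s' ''best'' 0 0 = cell s2 ''obj'' 0 0 \<and> (\<forall>i<d. \<forall>j<k. cell s' ''U'' i j = cell s2 ''Y'' i j)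
      else s' = s2))"
      by (rule wp_keep_com) (use S2 s in \<open>auto simp: S2_def eqx_def\<close>)
    show ?thesis
    proof (rule wp_mono[OF wp_frame[OF K]], elim conjE)
      fix t s3
      assume t: "t \<le> d * (k * 14 + 14) + 30" and e: "eqx (nmods keep_com) (rmods keep_com) s2 s3"
        and K: "if cell s2 ''best'' 0 0 < cell s2 ''obj'' 0 0
          then cell s3 ''best'' 0 0 = cell s2 ''obj'' 0 0 \<and> (\<forall>i<d. \<forall>j<k. cell s3 ''U'' i j = cell s2 ''Y'' i j)
          else s3 = s2"
      have Y: "assigns d k (gvals m k B z) (cell s2 ''Y'')" "cell s2 ''obj'' 0 0 = captured d m k B (cell s2 ''Y'')"
        and e2: "cell s2 ''best'' = cell s ''best''" "cell s2 ''U'' = cell s ''U''"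
        using S2 by (auto simp: S2_def eqx_def)
      have "?G s3"
      proof (cases "cell s2 ''best'' 0 0 < cell s2 ''obj'' 0 0")
        case True
        then have b: "cell s3 ''best'' 0 0 = captured d m k B (cell s2 ''Y'')"
          and eq: "\<And>i j. i < d \<Longrightarrow> j < k \<Longrightarrow> cell s3 ''U'' i j = cell s2 ''Y'' i j" using K Y(2) by auto
        show ?thesis
          using scattered_cong[OF eq] captured_cong[OF eq] assigns_scattered[OF Y(1)] True e2 Y b
          by (auto simp: visited_def)
      next
        case False
        then show ?thesis using K U e2 Y by (auto simp: visited_def)
      qed
      then show "t \<le> d * (k * 14 + 14) + 30 \<and> S3 s3"
        using t e S2 s z unfolding S2_def S3_def by (simp add: eqx_def del: of_nat_sum)
    qed
  qed
  have 4: "wp next_com s3 (\<lambda>t s'. t \<le> ?Q * 40 + 60 \<and> (?G s' \<and> stepped ?Q R z s'))" if S3: "S3 s3" for s3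
  proof -
    have K: "wp next_com s3 (\<lambda>t s'. t \<le> ?Q * 40 + 60 \<and> stepped ?Q R z s')"
      by (rule wp_next_com) (use S3 z in \<open>auto simp: S3_def simp del: of_nat_sum\<close>)
    show ?thesis
    proof (rule wp_mono[OF wp_frame[OF K]], elim conjE)
      fix t s'
      assume t: "t \<le> ?Q * 40 + 60" and e: "eqx (nmods next_com) (rmods next_com) s3 s'" and N: "stepped ?Q R z s'"
      have "?G s'" using S3 e by (simp add: S3_def eqx_def)
      then show "t \<le> ?Q * 40 + 60 \<and> (?G s' \<and> stepped ?Q R z s')" using N t by simp
    qed
  qed
  have "wp search_body s (\<lambda>t s'. t \<le> 500 * (d * k * m) \<and> (?G s' \<and> stepped ?Q R z s'))"
    unfolding search_body_def
    apply (rule wp_Seq_bound[OF 1 wp_Seq_bound[OF 2 wp_Seq_bound[OF 3 4 order_refl] order_refl]])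
       apply assumption+
  proof -
    have "d * (k * (m * 34 + 60) + 28) + 6 + (k * (d * 22 + m * (d * 22 + 38) + 58) + 15 +
       (d * (k * 14 + 14) + 30 + (?Q * 40 + 60))) =
       56 * (d * k * m) + 96 * (d * k) + 42 * d + 118 * (k * m) + 58 * k + 111"
      by (simp add: algebra_simps)
    also have "\<dots> \<le> 500 * (d * k * m)" using mono by linarith
    finally show "d * (k * (m * 34 + 60) + 28) + 6 + (k * (d * 22 + m * (d * 22 + 38) + 58) + 15 +
       (d * (k * 14 + 14) + 30 + (?Q * 40 + 60))) \<le> 500 * (d * k * m)" .
  qed
  then show ?thesis using s(8) by simp
qed

text \<open>Invariant: every grid point below the current one is visited with respect to the current
  record. The variant is one more than the number of points above, and 0 once \<open>run\<close> is
  cleared, so there are at most as many iterations as grid points.\<close>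

lemma wp_search_com:
  assumes s: "nvar s ''d'' = d" "nvar s ''m'' = m" "nvar s ''k'' = k" "nvar s ''H'' = k * m" "cell s ''B'' = B"
    "nvar s ''Q'' = k * m + k * m" "cell s ''R'' 0 0 = real R" "nvar s ''run'' = 1"
    and pos: "0 < d" "0 < m" "0 < k"
    and init: "cell s ''Z'' = (\<lambda>_ _. 0)" "cell s ''S'' 0 0 = 0" "cell s ''U'' = (\<lambda>_ _. 0)" "cell s ''best'' 0 0 = 0"
  shows "wp search_com s (\<lambda>t s'. t \<le> (card (grid (k * m + k * m) R) + 1) * (510 * (d * k * m)) \<and>
     scattered d k (cell s' ''U'') \<and>
     (\<forall>z\<in>grid (k * m + k * m) R. visited d m k B z (captured d m k B (cell s' ''U''))) \<and>
     eqx (nmods search_com) (rmods search_com) s s')"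
proof -
  let ?Q = "k * m + k * m"
  let ?b = "NLess (NConst 0) (NVar ''run'')"
  \<comment> \<open>Reads the current grid point back from the real cells, exactly so as long as
    these hold natural numbers.\<close>
  define zof where "zof s i = nat \<lfloor>cell s ''Z'' 0 i\<rfloor>" for s :: state and i
  have zof: "zof s' = z" if "cell s' ''Z'' 0 = real \<circ> z" for s' z
    using that by (simp add: zof_def fun_eq_iff)
  let ?I = "\<lambda>s'. eqx (nmods search_body) (rmods search_body) s s' \<and> scattered d k (cell s' ''U'') \<and>
     captured d m k B (cell s' ''U'') = cell s' ''best'' 0 0 \<and>
     (if nvar s' ''run'' = 0 then (\<forall>y\<in>grid ?Q R. visited d m k B y (cell s' ''best'' 0 0))
      else nvar s' ''run'' = 1 \<and> cell s' ''Z'' 0 = real \<circ> zof s' \<and> zof s' \<in> grid ?Q R \<and>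
        cell s' ''S'' 0 0 = real (\<Sum>q<?Q. zof s' q) \<and>
        (\<forall>y\<in>grid ?Q R. colex ?Q y (zof s') \<longrightarrow> visited d m k B y (cell s' ''best'' 0 0)))"
  let ?M = "\<lambda>s'. if nvar s' ''run'' = 0 then 0 else Suc (card {y \<in> grid ?Q R. colex ?Q (zof s') y})"
  have W: "wp search_com s (\<lambda>t s'. t \<le> card (grid ?Q R) * (500 * (d * k * m) + 1 + bcost ?b) + 1 + bcost ?b \<and>
     ?I s' \<and> \<not> bval ?b s')"
    unfolding search_com_def
  proof (rule wp_While_bound[where M = ?M])
    have z0: "cell s ''Z'' 0 = real \<circ> (\<lambda>_. 0)" using init by (simp add: fun_eq_iff)
    have g0: "(\<lambda>_. 0) \<in> grid ?Q R" by (simp add: grid_def)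
    have "\<not> colex ?Q y (\<lambda>_. 0)" for y by (simp add: colex_def)
    \<comment> \<open>The zero matrix captures 0 / 0 = 0 in every column, in agreement with the
      initial record, and no point lies below the origin.\<close>
    then show "?I s"
      using zof[OF z0] z0 g0 init s by (auto simp: scattered_def captured_def sq_def)
    have "{y \<in> grid ?Q R. colex ?Q (zof s) y} \<subseteq> grid ?Q R - {\<lambda>_. 0}"
      by (auto simp: zof[OF z0] colex_irrefl)
    then have "card {y \<in> grid ?Q R. colex ?Q (zof s) y} \<le> card (grid ?Q R - {\<lambda>_. 0})"
      by (intro card_mono) (simp_all add: finite_grid)
    also have "\<dots> < card (grid ?Q R)" by (rule card_Diff1_less[OF finite_grid g0])
    finally show "?M s \<le> card (grid ?Q R)" by simp
    fix s1 assume I: "?I s1" and b: "bval ?b s1"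
    define z where "z = zof s1"
    have run: "nvar s1 ''run'' = 1" and z: "cell s1 ''Z'' 0 = real \<circ> z" "z \<in> grid ?Q R"
      "cell s1 ''S'' 0 0 = real (\<Sum>q<?Q. z q)"
      and V: "\<And>y. y \<in> grid ?Q R \<Longrightarrow> colex ?Q y z \<Longrightarrow> visited d m k B y (cell s1 ''best'' 0 0)"
      and U: "scattered d k (cell s1 ''U'')" "captured d m k B (cell s1 ''U'') = cell s1 ''best'' 0 0"
      and e: "eqx (nmods search_body) (rmods search_body) s s1"
      using I b by (auto simp: z_def split: if_splits)
    have B: "wp search_body s1 (\<lambda>t s'. t \<le> 500 * (d * k * m) \<and>
     (scattered d k (cell s' ''U'') \<and> captured d m k B (cell s' ''U'') = cell s' ''best'' 0 0 \<and>
     cell s1 ''best'' 0 0 \<le> cell s' ''best'' 0 0 \<and> visited d m k B z (cell s' ''best'' 0 0) \<and>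
     stepped ?Q R z s'))"
      by (rule wp_search_body) (use e s pos run z U in \<open>auto simp: eqx_def simp del: of_nat_sum\<close>)
    show "wp search_body s1 (\<lambda>t s'. t \<le> 500 * (d * k * m) \<and> ?I s' \<and> ?M s' < ?M s1)"
    proof (rule wp_mono[OF wp_frame[OF B]], elim conjE)
      fix t s'
      assume t: "t \<le> 500 * (d * k * m)" and e': "eqx (nmods search_body) (rmods search_body) s1 s'"
        and U': "scattered d k (cell s' ''U'')" "captured d m k B (cell s' ''U'') = cell s' ''best'' 0 0"
        and up: "cell s1 ''best'' 0 0 \<le> cell s' ''best'' 0 0" and vz: "visited d m k B z (cell s' ''best'' 0 0)"
        and N: "stepped ?Q R z s'"
      have ee: "eqx (nmods search_body) (rmods search_body) s s'" using e e' eqx_trans by blast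
      \<comment> \<open>By totality such a point is \<open>z\<close> itself, visited in this
        iteration, or lies below \<open>z\<close>; since the record only grows, older visits stay
        valid.\<close>
      have V': "visited d m k B y (cell s' ''best'' 0 0)" if "y \<in> grid ?Q R" "\<not> colex ?Q z y" for y
        using colex_total[OF z(2) that(1)] that V vz visited_mono[OF _ up] by blast
      from N[unfolded stepped_def] show "t \<le> 500 * (d * k * m) \<and> ?I s' \<and> ?M s' < ?M s1"
      proof
        assume last: "(\<forall>r<?Q. (\<Sum>i=r..<?Q. z i) = R) \<and> nvar s' ''run'' = 0"
        then have "visited d m k B y (cell s' ''best'' 0 0)" if "y \<in> grid ?Q R" for y
          using V'[OF that] saturated_is_last[OF that] by blast
        then show ?thesis using t ee U' last run by simp
      next
        assume "\<exists>q<?Q. (\<forall>r<q. (\<Sum>i=r..<?Q. z i) = R) \<and> (\<Sum>i=q..<?Q. z i) < R \<and>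
         cell s' ''Z'' 0 = real \<circ> bump q z \<and> cell s' ''S'' 0 0 = real (\<Sum>i<?Q. bump q z i) \<and>
         nvar s' ''run'' = 1"
        then obtain q where q: "q < ?Q" "\<And>r. r < q \<Longrightarrow> (\<Sum>i=r..<?Q. z i) = R" "(\<Sum>i=q..<?Q. z i) < R"
          "cell s' ''Z'' 0 = real \<circ> bump q z" "cell s' ''S'' 0 0 = real (\<Sum>i<?Q. bump q z i)"
          "nvar s' ''run'' = 1" by blast
        note bg = bump_in_grid[OF z(2) q(1,3)]
        have V'': "visited d m k B y (cell s' ''best'' 0 0)" if y: "y \<in> grid ?Q R" "colex ?Q y (bump q z)" for y
        proof (rule V'[OF y(1)])
          show "\<not> colex ?Q z y"
            using bump_is_successor[OF y(1) _ z(2) q(1,2)] y(2) colex_irrefl colex_trans by blast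
        qed
        have "{y \<in> grid ?Q R. colex ?Q (bump q z) y} \<subset> {y \<in> grid ?Q R. colex ?Q z y}"
          using bg colex_trans[OF bg(2)] colex_irrefl by blast
        then have "card {y \<in> grid ?Q R. colex ?Q (bump q z) y} < card {y \<in> grid ?Q R. colex ?Q z y}"
          by (intro psubset_card_mono) (auto simp: finite_grid)
        then show ?thesis
          using t ee U' q(4,5,6) bg V'' zof[OF q(4)] run by (simp add: z_def del: of_nat_sum)
      qed
    qed
  qed
  show ?thesis
  proof (rule wp_mono[OF W], elim conjE, intro conjI)
    fix t s'
    assume t: "t \<le> card (grid ?Q R) * (500 * (d * k * m) + 1 + bcost ?b) + 1 + bcost ?b"
    have *: "t \<le> (A + 1) * (510 * K)" if "t \<le> A * (500 * K + 4) + 4" "1 \<le> K" for A K :: nat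
    proof -
      have "A * (500 * K + 4) \<le> A * (510 * K)" using that(2) by (intro mult_le_mono2) simp
      then have "t \<le> A * (510 * K) + 510 * K" using that by linarith
      then show ?thesis by (simp add: algebra_simps)
    qed
    show "t \<le> (card (grid ?Q R) + 1) * (510 * (d * k * m))"
      by (rule *) (use t pos in \<open>simp_all add: algebra_simps\<close>)
  qed (auto simp del: of_nat_sum)
qed

section \<open>The repair and normalisation programs\<close>

definition free_test :: bexp where
  "free_test = BAnd (RLess (nat_lit 0) (ent ''U'' ''i'' ''l''))
     (BNot (RLess (RMul (ent ''U'' ''i'' ''l'') (ent ''U'' ''i'' ''l'')) (row0 ''L'' ''l'')))"

definition find_body :: com where
  "find_body = Seq (NAssign ''ok'' (NConst 1))
     (Seq (For ''l'' ''k'' (Cond free_test (NAssign ''ok'' (NConst 0)) Skip))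
     (Cond (NLess (NConst 0) (NVar ''ok'')) (NAssign ''r'' (NVar ''i'')) Skip))"

definition find_com :: com where
  "find_com = For ''i'' ''d'' find_body"

lemma mods_find [simp]:
  "nmods find_body = {''ok'', ''l'', ''r''}" "rmods find_body = {}"
  "nmods find_com = {''i'', ''ok'', ''l'', ''r''}" "rmods find_com = {}"
  by (auto simp: find_body_def find_com_def)

lemma wp_find_body:
  assumes s: "nvar s ''k'' = k" "cell s ''U'' = U" "nvar s ''i'' = i"
    and L: "\<And>l. l < k \<Longrightarrow> cell s ''L'' 0 l = sq d (column U l)"
  shows "wp find_body s (\<lambda>t s'. t \<le> k * 40 + 20 \<and>
     (if free_row d k U i then nvar s' ''r'' = i else nvar s' ''r'' = nvar s ''r''))"
proof -
  let ?b = "Cond free_test (NAssign ''ok'' (NConst 0)) Skip"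
  let ?s = "set_nvar ''ok'' 1 s"
  let ?c = "\<lambda>l. 0 < U i l \<longrightarrow> (U i l)\<^sup>2 < sq d (column U l)"
  have F: "wp (For ''l'' ''k'' ?b) ?s (\<lambda>t s'. t \<le> k * (24 + 8) + 6 \<and>
     nvar s' ''ok'' = (if \<forall>l<k. ?c l then 1 else 0) \<and> eqx (insert ''l'' (nmods ?b)) (rmods ?b) ?s s')"
  proof (rule wp_For[where I = "\<lambda>j s'. nvar s' ''ok'' = (if \<forall>l<j. ?c l then 1 else 0)"], goal_cases)
    case (7 l s1)
    have "bval free_test s1 \<longleftrightarrow> \<not> ?c l"
      using 7 s L by (auto simp: free_test_def eqx_def power2_eq_square)
    moreover have "bcost free_test = 19" by (simp add: free_test_def)
    ultimately show ?case using 7(4) by (auto simp: less_Suc_eq)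
  qed (use s in auto)
  have "wp (For ''l'' ''k'' ?b) ?s (\<lambda>t s1. wp (Cond (NLess (NConst 0) (NVar ''ok'')) (NAssign ''r'' (NVar ''i'')) Skip) s1
     (\<lambda>t2 s'. 2 + (t + t2) \<le> k * 40 + 20 \<and>
     (if free_row d k U i then nvar s' ''r'' = i else nvar s' ''r'' = nvar s ''r'')))"
    by (rule wp_mono[OF F]) (use s in \<open>auto simp: free_row_def eqx_def\<close>)
  then show ?thesis unfolding find_body_def wp_Seq wp_NAssign by simp
qed

lemma wp_find_com:
  assumes s: "nvar s ''k'' = k" "nvar s ''d'' = d" "cell s ''U'' = U"
    and L: "\<And>l. l < k \<Longrightarrow> cell s ''L'' 0 l = sq d (column U l)" and ex: "\<exists>r<d. free_row d k U r"
  shows "wp find_com s (\<lambda>t s'. t \<le> d * (k * 40 + 28) + 6 \<and> (nvar s' ''r'' < d \<and>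
     free_row d k U (nvar s' ''r'')) \<and> eqx (nmods find_com) (rmods find_com) s s')"
proof -
  have "wp find_com s (\<lambda>t s'. t \<le> d * ((k * 40 + 20) + 8) + 6 \<and>
     ((\<exists>r<d. free_row d k U r) \<longrightarrow> nvar s' ''r'' < d \<and> free_row d k U (nvar s' ''r'')) \<and>
     eqx (insert ''i'' (nmods find_body)) (rmods find_body) s s')"
    unfolding find_com_def
  proof (rule wp_For[where I = "\<lambda>i s'. (\<exists>r<i. free_row d k U r) \<longrightarrow> nvar s' ''r'' < d \<and> free_row d k U (nvar s' ''r'')"],
      goal_cases)
    case (7 i s1)
    show ?case
      by (rule wp_mono[OF wp_find_body[where k = k and U = U and i = i and d = d]])
        (use 7 s L in \<open>auto simp: eqx_def less_Suc_eq split: if_splits\<close>)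
  qed (use s in auto)
  then show ?thesis by (rule wp_mono) (use ex in \<open>auto simp: add.commute[of _ 28]\<close>)
qed

definition clear_com :: com where
  "clear_com = Seq (For ''l'' ''k'' (RAssign ''U'' (NVar ''r'') (NVar ''l'') (nat_lit 0)))
     (RAssign ''U'' (NVar ''r'') (NVar ''j'') (nat_lit 1))"

lemma mods_clear [simp]: "nmods clear_com = {''l''}" "rmods clear_com = {''U''}"
  by (auto simp: clear_com_def)

lemma wp_clear_com:
  assumes s: "nvar s ''k'' = k" "cell s ''U'' = U" "nvar s ''r'' = r" "nvar s ''j'' = j"
  shows "wp clear_com s (\<lambda>t s'. t \<le> k * 13 + 20 \<and>
     (\<forall>i. \<forall>l<k. cell s' ''U'' i l = (if i = r then (if l = j then 1 else 0) else U i l)))"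
proof -
  let ?b = "RAssign ''U'' (NVar ''r'') (NVar ''l'') (nat_lit 0)"
  have F: "wp (For ''l'' ''k'' ?b) s (\<lambda>t s'. t \<le> k * (5 + 8) + 6 \<and>
     cell s' ''U'' = (\<lambda>i l. if i = r \<and> l < k then 0 else U i l) \<and> eqx (insert ''l'' (nmods ?b)) (rmods ?b) s s')"
  proof (rule wp_For[where I = "\<lambda>j s'. cell s' ''U'' = (\<lambda>i l. if i = r \<and> l < j then 0 else U i l)"], goal_cases)
    case (7 l s1)
    then show ?case using s by (auto simp: eqx_def fun_eq_iff less_Suc_eq)
  qed (use s in auto)
  show ?thesis
    unfolding clear_com_def wp_Seq
    by (rule wp_mono[OF F]) (use s in \<open>auto simp: eqx_def\<close>)
qed

definition repair_body :: com where
  "repair_body = Seq (colnorms ''U'' ''L'' ''l'' ''k'')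
     (Cond (BNot (RLess (nat_lit 0) (row0 ''L'' ''j''))) (Seq find_com clear_com) Skip)"

definition repair_com :: com where
  "repair_com = For ''j'' ''k'' repair_body"

lemma mods_repair [simp]:
  "nmods repair_body = {''i'', ''l'', ''ok'', ''r''}" "rmods repair_body = {''t'', ''L'', ''U''}"
  "nmods repair_com = {''j'', ''i'', ''l'', ''ok'', ''r''}" "rmods repair_com = {''t'', ''L'', ''U''}"
  by (auto simp: repair_body_def repair_com_def)

lemma wp_repair_body:
  assumes s: "nvar s ''k'' = k" "nvar s ''d'' = d" "nvar s ''j'' = j" "cell s ''U'' = U"
    and j: "j < k" "k \<le> d" and U: "scattered d k U"
  shows "wp repair_body s (\<lambda>t s'. t \<le> 300 * (k * d) \<and>
     (scattered d k (cell s' ''U'') \<and> captured d m k B U \<le> captured d m k B (cell s' ''U'') \<and>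
     (\<forall>l<k. l = j \<or> 0 < sq d (column U l) \<longrightarrow> 0 < sq d (column (cell s' ''U'') l))))"
proof -
  let ?G = "\<lambda>s'. scattered d k (cell s' ''U'') \<and> captured d m k B U \<le> captured d m k B (cell s' ''U'') \<and>
     (\<forall>l<k. l = j \<or> 0 < sq d (column U l) \<longrightarrow> 0 < sq d (column (cell s' ''U'') l))"
  have mono: "k \<le> k * d" "d \<le> k * d" "1 \<le> k * d" using j by auto
  have 1: "wp (colnorms ''U'' ''L'' ''l'' ''k'') s (\<lambda>t s'. t \<le> k * (d * 22 + 25) + 6 \<and>
     (\<forall>r<k. cell s' ''L'' 0 r = sq d (column U r)) \<and> eqx {''l'', ''i''} {''t'', ''L''} s s')"
    using wp_colnorms[of s d "''k''" k "''U''" "''L''" "''l''"] s by simp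
  show ?thesis
    unfolding repair_body_def wp_Seq[of "colnorms _ _ _ _"]
  proof (rule wp_mono[OF 1], elim conjE)
    fix t1 s1
    assume t1: "t1 \<le> k * (d * 22 + 25) + 6" and L: "\<forall>r<k. cell s1 ''L'' 0 r = sq d (column U r)"
      and e1: "eqx {''l'', ''i''} {''t'', ''L''} s s1"
    have s1: "nvar s1 ''k'' = k" "nvar s1 ''d'' = d" "nvar s1 ''j'' = j" "cell s1 ''U'' = U"
      using s e1 by (auto simp: eqx_def)
    have time: "t1 + t \<le> 300 * (k * d)" if "t \<le> d * (k * 40 + 28) + 6 + (k * 13 + 20) + 20" for t
    proof -
      have "t1 + t \<le> 62 * (k * d) + 28 * d + 38 * k + 52"
        using that t1 by (simp add: algebra_simps)
      then show ?thesis using mono by linarith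
    qed
    show "wp (Cond (BNot (RLess (nat_lit 0) (row0 ''L'' ''j''))) (Seq find_com clear_com) Skip) s1
      (\<lambda>t2 s2. t1 + t2 \<le> 300 * (k * d) \<and> ?G s2)"
    proof (cases "sq d (column U j) = 0")
      case False
      then have p: "0 < sq d (column U j)" using sq_nonneg[of d "column U j"] by linarith
      have "t1 + 10 \<le> 300 * (k * d)" by (rule time) simp
      then show ?thesis using p U L j s1 by simp
    next
      case True
      have F: "wp find_com s1 (\<lambda>t s'. t \<le> d * (k * 40 + 28) + 6 \<and> (nvar s' ''r'' < d \<and>
         free_row d k U (nvar s' ''r'')) \<and> eqx (nmods find_com) (rmods find_com) s1 s')"
        by (rule wp_find_com) (use s1 L free_row_exists[OF U j(1) True j(2)] in auto)
      have "wp find_com s1 (\<lambda>t2 s2. wp clear_com s2 (\<lambda>t3 s3. t1 + (10 + (t2 + t3)) \<le> 300 * (k * d) \<and> ?G s3))"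
      proof (rule wp_mono[OF F], elim conjE)
        fix t2 s2
        assume t2: "t2 \<le> d * (k * 40 + 28) + 6" and r: "nvar s2 ''r'' < d" "free_row d k U (nvar s2 ''r'')"
          and e2: "eqx (nmods find_com) (rmods find_com) s1 s2"
        have C: "wp clear_com s2 (\<lambda>t s'. t \<le> k * 13 + 20 \<and>
          (\<forall>i. \<forall>l<k. cell s' ''U'' i l = (if i = nvar s2 ''r'' then (if l = j then 1 else 0) else U i l)))"
          by (rule wp_clear_com) (use s1 e2 in \<open>auto simp: eqx_def\<close>)
        show "wp clear_com s2 (\<lambda>t3 s3. t1 + (10 + (t2 + t3)) \<le> 300 * (k * d) \<and> ?G s3)"
        proof (rule wp_mono[OF C], elim conjE)
          fix t3 s3
          assume t3: "t3 \<le> k * 13 + 20" and U3: "\<forall>i. \<forall>l<k. cell s3 ''U'' i l =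
            (if i = nvar s2 ''r'' then (if l = j then 1 else 0) else U i l)"
          have U3': "\<And>i l. i < d \<Longrightarrow> l < k \<Longrightarrow> cell s3 ''U'' i l =
            (if i = nvar s2 ''r'' then (if l = j then 1 else 0) else U i l)" using U3 by blast
          note R = repair_column[OF U r j(1) True U3']
          have "?G s3" using R(1) R(2)[of m B] R(3) by blast
          moreover have "t1 + (10 + (t2 + t3)) \<le> 300 * (k * d)" by (rule time) (use t2 t3 in simp)
          ultimately show "t1 + (10 + (t2 + t3)) \<le> 300 * (k * d) \<and> ?G s3" by blast
        qed
      qed
      then show ?thesis
        using True L j s1 by (simp add: wp_Seq[of find_com]) (erule wp_mono, erule wp_mono, auto)
    qed
  qed
qed

text \<open>Round j repairs column j if it is zero. The row used is free in the current matrix, so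
  no positive column is emptied again, and after k rounds all columns are positive.\<close>

lemma wp_repair_com:
  assumes s: "nvar s ''k'' = k" "nvar s ''d'' = d" "cell s ''U'' = U"
    and j: "k \<le> d" and U: "scattered d k U"
  shows "wp repair_com s (\<lambda>t s'. t \<le> k * (300 * (k * d) + 8) + 6 \<and>
     (scattered d k (cell s' ''U'') \<and> captured d m k B U \<le> captured d m k B (cell s' ''U'') \<and>
     (\<forall>l<k. 0 < sq d (column (cell s' ''U'') l))) \<and> eqx (nmods repair_com) (rmods repair_com) s s')"
proof -
  have "wp repair_com s (\<lambda>t s'. t \<le> k * (300 * (k * d) + 8) + 6 \<and>
     (scattered d k (cell s' ''U'') \<and> captured d m k B U \<le> captured d m k B (cell s' ''U'') \<and>
     (\<forall>l<k. 0 < sq d (column (cell s' ''U'') l))) \<and> eqx (insert ''j'' (nmods repair_body)) (rmods repair_body) s s')"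
    unfolding repair_com_def
  proof (rule wp_For[where I = "\<lambda>j s'. scattered d k (cell s' ''U'') \<and>
      captured d m k B U \<le> captured d m k B (cell s' ''U'') \<and> (\<forall>l<j. 0 < sq d (column (cell s' ''U'') l))"], goal_cases)
    case (7 j s1)
    show ?case
      by (rule wp_mono[OF wp_repair_body[where k = k and d = d and j = j and U = "cell s1 ''U''" and m = m and B = B]])
        (use 7 s \<open>k \<le> d\<close> in \<open>auto simp: eqx_def less_Suc_eq\<close>)
  qed (use s U in auto)
  then show ?thesis by simp
qed

definition norm_inner :: com where
  "norm_inner = RAssign ''U'' (NVar ''i'') (NVar ''j'') (RDiv (ent ''U'' ''i'' ''j'') (RSqrt (scalar ''nj'')))"

definition norm_body :: com where
  "norm_body = Seq (DotLoop ''nj'' ''U'' ''j'' ''U'' ''j'') (For ''i'' ''d'' norm_inner)"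

definition norm_com :: com where
  "norm_com = For ''j'' ''k'' norm_body"

lemma mods_norm [simp]:
  "nmods norm_inner = {}" "rmods norm_inner = {''U''}"
  "nmods norm_body = {''i''}" "rmods norm_body = {''nj'', ''U''}"
  by (auto simp: norm_inner_def norm_body_def)

lemma wp_norm_com:
  assumes s: "nvar s ''k'' = k" "nvar s ''d'' = d" "cell s ''U'' = U"
  shows "wp norm_com s (\<lambda>t s'. t \<le> k * (d * 45 + 30) + 6 \<and>
     (\<forall>i<d. \<forall>j<k. cell s' ''U'' i j = U i j / sqrt (sq d (column U j))))"
proof -
  let ?R = "\<lambda>j i l. if i < d \<and> l < j then U i l / sqrt (sq d (column U l)) else U i l"
  have "wp norm_com s (\<lambda>t s'. t \<le> k * ((d * 45 + 20) + 8) + 6 \<and> cell s' ''U'' = ?R k \<and>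
     eqx (insert ''j'' (nmods norm_body)) (rmods norm_body) s s')"
    unfolding norm_com_def
  proof (rule wp_For[where I = "\<lambda>j s'. cell s' ''U'' = ?R j"], goal_cases)
    case (7 j s1)
    have s1: "nvar s1 ''d'' = d" using 7 s by (simp add: eqx_def)
    show ?case
      unfolding norm_body_def wp_Seq
    proof (rule wp_mono[OF wp_DotLoop[OF s1]], goal_cases)
      case (5 t s2)
      then have t: "t \<le> d * 22 + 11" and e2: "eqx {''i''} {''nj''} s1 s2"
        and "cell s2 ''nj'' 0 0 = sq d (column (?R j) j)"
        using 7 by (auto simp: dot_self)
      then have nj: "cell s2 ''nj'' 0 0 = sq d (column U j)" by simp
      have "wp (For ''i'' ''d'' norm_inner) s2 (\<lambda>t s'. t \<le> d * (11 + 8) + 6 \<and>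
         cell s' ''U'' = (\<lambda>i l. if i < d \<and> l < j \<or> i < d \<and> l = j then U i l / sqrt (sq d (column U l)) else U i l) \<and>
         eqx (insert ''i'' (nmods norm_inner)) (rmods norm_inner) s2 s')"
      proof (rule wp_For[where I = "\<lambda>r s'. cell s' ''U'' =
          (\<lambda>i l. if i < d \<and> l < j \<or> i < r \<and> l = j then U i l / sqrt (sq d (column U l)) else U i l)"], goal_cases)
        case (7 i s3)
        then show ?case
          using e2 nj \<open>nvar s1 ''j'' = j\<close> by (auto simp: norm_inner_def eqx_def fun_eq_iff less_Suc_eq)
      qed (use e2 s1 7 in \<open>auto simp: eqx_def\<close>)
      then show ?case
        by (rule wp_mono) (use t in \<open>auto simp: fun_eq_iff less_Suc_eq\<close>)
    qed auto
  qed (use s in auto)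
  then show ?thesis by (rule wp_mono) (auto simp: algebra_simps)
qed

section \<open>The complete program\<close>

text \<open>The machine cannot round reals, so the least natural number not below \<open>L\<close>
  is found by counting up.\<close>

lemma wp_upto:
  assumes b: "\<And>s'. eqx {x} {} s s' \<Longrightarrow> bval b s' \<longleftrightarrow> real (nvar s' x) < L" and L: "0 \<le> L"
  shows "wp (Seq (NAssign x (NConst 0)) (While b (NAssign x (NAdd (NVar x) (NConst 1))))) s
    (\<lambda>t s'. real t \<le> (L + 2) * (real (bcost b) + 5) \<and> L \<le> real (nvar s' x) \<and> real (nvar s' x) \<le> L + 1 \<and>
       eqx {x} {} s s')"
proof -
  let ?c = "NAssign x (NAdd (NVar x) (NConst 1))"
  let ?s = "set_nvar x 0 s"
  let ?I = "\<lambda>s'. real (nvar s' x) \<le> L + 1 \<and> eqx {x} {} s s'"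
  have W: "wp (While b ?c) ?s (\<lambda>t s'. t \<le> nat \<lceil>L\<rceil> * (4 + 1 + bcost b) + 1 + bcost b \<and> ?I s' \<and> \<not> bval b s')"
  proof (rule wp_While_bound[where M = "\<lambda>s'. nat \<lceil>L - real (nvar s' x)\<rceil>"])
    show "?I ?s" using L by (auto simp: eqx_def)
    fix s1 assume I: "?I s1" and g: "bval b s1"
    then have lt: "real (nvar s1 x) < L" using b by blast
    have "nat \<lceil>L - real (Suc (nvar s1 x))\<rceil> < nat \<lceil>L - real (nvar s1 x)\<rceil>"
    proof -
      have "\<lceil>L - real (Suc (nvar s1 x))\<rceil> = \<lceil>L - real (nvar s1 x)\<rceil> - 1"
        by (simp add: diff_diff_eq[symmetric] del: diff_diff_eq) linarith
      moreover have "0 < \<lceil>L - real (nvar s1 x)\<rceil>" using lt by simp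
      ultimately show ?thesis by linarith
    qed
    then show "wp ?c s1 (\<lambda>t s'. t \<le> 4 \<and> ?I s' \<and> nat \<lceil>L - real (nvar s' x)\<rceil> < nat \<lceil>L - real (nvar s1 x)\<rceil>)"
      using I lt by (auto simp: eqx_def)
  qed simp
  have "wp (While b ?c) ?s (\<lambda>t s'. real (2 + t) \<le> (L + 2) * (real (bcost b) + 5) \<and> L \<le> real (nvar s' x) \<and>
      real (nvar s' x) \<le> L + 1 \<and> eqx {x} {} s s')"
  proof (rule wp_mono[OF W], elim conjE)
    fix t s'
    assume t: "t \<le> nat \<lceil>L\<rceil> * (4 + 1 + bcost b) + 1 + bcost b" and "\<not> bval b s'"
      and I: "real (nvar s' x) \<le> L + 1" "eqx {x} {} s s'"
    have "real t \<le> real (nat \<lceil>L\<rceil> * (4 + 1 + bcost b) + 1 + bcost b)" using t by (rule of_nat_mono)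
    also have "\<dots> = real (nat \<lceil>L\<rceil>) * (real (bcost b) + 5) + 1 + real (bcost b)" by simp
    also have "\<dots> \<le> (L + 1) * (real (bcost b) + 5) + 1 + real (bcost b)"
      using L by (intro add_right_mono mult_right_mono) linarith+
    finally have "real (2 + t) \<le> (L + 2) * (real (bcost b) + 5)" by (simp add: algebra_simps)
    then show "real (2 + t) \<le> (L + 2) * (real (bcost b) + 5) \<and> L \<le> real (nvar s' x) \<and>
      real (nvar s' x) \<le> L + 1 \<and> eqx {x} {} s s'"
      using b[OF I(2)] \<open>\<not> bval b s'\<close> I by auto
  qed
  then show ?thesis by simp
qed

definition m_guard :: bexp where
  "m_guard = RLess (RNat (NVar ''m'')) (RAdd (RMul (nat_lit 2) (RNat (NVar ''k'')))
     (RDiv (RMul (nat_lit 2) (RNat (NVar ''k''))) (scalar ''eps'')))"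

definition N_guard :: bexp where
  "N_guard = RLess (RMul (RNat (NVar ''N'')) (scalar ''delta'')) (nat_lit 1)"

definition m_com :: com where
  "m_com = Seq (NAssign ''m'' (NConst 0)) (While m_guard (NAssign ''m'' (NAdd (NVar ''m'') (NConst 1))))"

definition N_com :: com where
  "N_com = Seq (NAssign ''N'' (NConst 0)) (While N_guard (NAssign ''N'' (NAdd (NVar ''N'') (NConst 1))))"

text \<open>The radius N m k is kept as a real, where products exist. The offset k m enters array
  indices, so it must be an integer and is accumulated by additions.\<close>

definition param_com :: com where
  "param_com = Seq (put ''f'' (RDiv (RMul (scalar ''delta'') (scalar ''F'')) (RMul (RNat (NVar ''k'')) (RNat (NVar ''n'')))))
     (Seq (put ''R'' (RMul (RMul (RNat (NVar ''N'')) (RNat (NVar ''m''))) (RNat (NVar ''k''))))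
     (Seq (NAssign ''run'' (NConst 1)) (Seq (NAssign ''H'' (NConst 0))
     (Seq (For ''j'' ''k'' (NAssign ''H'' (NAdd (NVar ''H'') (NVar ''m''))))
     (NAssign ''Q'' (NAdd (NVar ''H'') (NVar ''H'')))))))"

lemma mods_params [simp]:
  "nmods m_com = {''m''}" "rmods m_com = {}" "nmods N_com = {''N''}" "rmods N_com = {}"
  "nmods param_com = {''run'', ''H'', ''j'', ''Q''}" "rmods param_com = {''f'', ''R''}"
  by (auto simp: m_com_def N_com_def param_com_def)

lemma wp_m_com:
  assumes "nvar s ''k'' = k" "cell s ''eps'' 0 0 = \<epsilon>" "0 < \<epsilon>"
  shows "wp m_com s (\<lambda>t s'. real t \<le> (2 * real k + 2 * real k / \<epsilon> + 2) * 23 \<and>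
     2 * real k + 2 * real k / \<epsilon> \<le> real (nvar s' ''m'') \<and>
     real (nvar s' ''m'') \<le> 2 * real k + 2 * real k / \<epsilon> + 1 \<and> eqx {''m''} {} s s')"
proof -
  have "bcost m_guard = 18" by (simp add: m_guard_def)
  then show ?thesis
    using wp_upto[of "''m''" s m_guard "2 * real k + 2 * real k / \<epsilon>"] assms
    by (simp add: m_com_def m_guard_def eqx_def)
qed

lemma wp_N_com:
  assumes "cell s ''delta'' 0 0 = \<delta>" "0 < \<delta>"
  shows "wp N_com s (\<lambda>t s'. real t \<le> (1 / \<delta> + 2) * 14 \<and> 1 / \<delta> \<le> real (nvar s' ''N'') \<and>
     real (nvar s' ''N'') \<le> 1 / \<delta> + 1 \<and> eqx {''N''} {} s s')"
proof -
  have "bcost N_guard = 9" by (simp add: N_guard_def)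
  moreover have "bval N_guard s' \<longleftrightarrow> real (nvar s' ''N'') < 1 / \<delta>" if "eqx {''N''} {} s s'" for s'
    using that assms by (simp add: N_guard_def eqx_def field_simps)
  ultimately show ?thesis
    using wp_upto[of "''N''" s N_guard "1 / \<delta>"] assms by (simp add: N_com_def)
qed

lemma wp_param_com:
  assumes s: "nvar s ''k'' = k" "nvar s ''m'' = m" "nvar s ''N'' = N" "nvar s ''n'' = n"
    "cell s ''delta'' 0 0 = \<delta>" "cell s ''F'' 0 0 = F"
  shows "wp param_com s (\<lambda>t s'. t \<le> k * 12 + 60 \<and> cell s' ''f'' 0 0 = \<delta> * F / (real k * real n) \<and>
     cell s' ''R'' 0 0 = real (N * m * k) \<and> nvar s' ''run'' = 1 \<and> nvar s' ''H'' = k * m \<and>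
     nvar s' ''Q'' = k * m + k * m \<and> eqx (nmods param_com) (rmods param_com) s s')"
proof (rule wp_mono[OF wp_frame])
  let ?b = "NAssign ''H'' (NAdd (NVar ''H'') (NVar ''m''))"
  define s1 where "s1 = set_nvar ''H'' 0 (set_nvar ''run'' 1 (set_cell ''R'' 0 0 (real N * real m * real k)
     (set_cell ''f'' 0 0 (\<delta> * F / (real k * real n)) s)))"
  have F: "wp (For ''j'' ''k'' ?b) s1 (\<lambda>t s'. t \<le> k * (4 + 8) + 6 \<and> nvar s' ''H'' = k * m \<and>
     eqx (insert ''j'' (nmods ?b)) (rmods ?b) s1 s')"
    by (rule wp_For[where I = "\<lambda>j s'. nvar s' ''H'' = j * m"]) (use s in \<open>auto simp: s1_def eqx_def\<close>)
  have F': "wp (For ''j'' ''k'' ?b) s1 (\<lambda>t s'. t \<le> k * 12 + 6 \<and> nvar s' ''H'' = k * m \<and> nvar s' ''run'' = 1 \<and>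
     cell s' ''f'' 0 0 = \<delta> * F / (real k * real n) \<and> cell s' ''R'' 0 0 = real N * real m * real k)"
    by (rule wp_mono[OF F]) (auto simp: s1_def eqx_def)
  show "wp param_com s (\<lambda>t s'. t \<le> k * 12 + 60 \<and> cell s' ''f'' 0 0 = \<delta> * F / (real k * real n) \<and>
     cell s' ''R'' 0 0 = real (N * m * k) \<and> nvar s' ''run'' = 1 \<and> nvar s' ''H'' = k * m \<and>
     nvar s' ''Q'' = k * m + k * m)"
    unfolding param_com_def wp_Seq wp_RAssign wp_NAssign
    using s by (simp add: s1_def[unfolded One_nat_def, symmetric]) (rule wp_mono[OF F'], auto)
qed simp

definition main_com :: com where
  "main_com = Seq m_com (Seq N_com (Seq param_com (Seq sketch_com (Seq search_com (Seq repair_com norm_com)))))"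

definition trivial_com :: com where
  "trivial_com = For ''j'' ''k'' (RAssign ''U'' (NVar ''j'') (NVar ''j'') (nat_lit 1))"

text \<open>For \<delta> \<ge> 1/2 the allowed error 4 \<delta> |A|^2 exceeds the cost of any
  feasible matrix, and for |A| = 0 that cost is 0. In the main branch 1/\<delta> > 2, so powers of
  1/\<delta> absorb constants, and the threshold \<open>f\<close> is positive.\<close>

definition pnmf_com :: com where
  "pnmf_com = Seq frob_com (Cond (BAnd (RLess (scalar ''delta'') (RDiv (nat_lit 1) (nat_lit 2)))
     (RLess (nat_lit 0) (scalar ''F''))) main_com trivial_com)"

lemma wp_trivial_com:
  assumes s: "nvar s ''k'' = k" "cell s ''U'' = (\<lambda>_ _. 0)"
  shows "wp trivial_com s (\<lambda>t s'. t \<le> k * 13 + 6 \<and>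
     cell s' ''U'' = (\<lambda>i j. if i = j \<and> j < k then 1 else 0))"
proof -
  let ?b = "RAssign ''U'' (NVar ''j'') (NVar ''j'') (nat_lit 1)"
  have "wp trivial_com s (\<lambda>t s'. t \<le> k * (5 + 8) + 6 \<and> cell s' ''U'' = (\<lambda>i j. if i = j \<and> j < k then 1 else 0) \<and>
     eqx (insert ''j'' (nmods ?b)) (rmods ?b) s s')"
    unfolding trivial_com_def
    by (rule wp_For[where I = "\<lambda>l s'. cell s' ''U'' = (\<lambda>i j. if i = j \<and> j < l then 1 else 0)"])
      (use s in \<open>auto simp: eqx_def fun_eq_iff less_Suc_eq\<close>)
  then show ?thesis by (rule wp_mono) auto
qed

section \<open>The complete run and its running time\<close>

definition main_time :: "nat \<Rightarrow> nat \<Rightarrow> nat \<Rightarrow> nat \<Rightarrow> real \<Rightarrow> real \<Rightarrow> real \<Rightarrow> real" where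
  "main_time d n k m \<epsilon> \<delta> C =
       (2 * real k + 2 * real k / \<epsilon> + 2) * 23 + (1 / \<delta> + 2) * 14 + (real k * 12 + 60) +
       (4 * (real m)\<^sup>2 * (real k * real n / \<delta>) + real n + 1) * (510 * (real m * real m * real d)) +
       (C + 1) * (510 * (real d * real k * real m)) +
       (real k * (300 * (real k * real d) + 8) + 6) + (real k * (real d * 45 + 30) + 6)"

lemma runs_main_com:
  assumes s: "nvar s ''d'' = d" "nvar s ''n'' = n" "nvar s ''k'' = k" "cell s ''A'' = a"
    "cell s ''eps'' 0 0 = \<epsilon>" "cell s ''delta'' 0 0 = \<delta>" "cell s ''F'' 0 0 = total_sq d n a" "nvar s ''c'' = 0"
    and init: "cell s ''B'' = (\<lambda>_ _. 0)" "cell s ''Z'' = (\<lambda>_ _. 0)" "cell s ''S'' 0 0 = 0"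
      "cell s ''U'' = (\<lambda>_ _. 0)" "cell s ''best'' 0 0 = 0"
    and k: "0 < k" "k \<le> d" and n: "0 < n" and e: "0 < \<epsilon>" and dl: "0 < \<delta>" and F: "0 < total_sq d n a"
  obtains t s' m N B D where "runs main_com s t s'"
    "fd_inv d m a (\<delta> * total_sq d n a / (real k * real n)) n B D"
    "2 * real k + 2 * real k / \<epsilon> \<le> real m" "real m \<le> 2 * real k + 2 * real k / \<epsilon> + 1"
    "1 / \<delta> \<le> real N" "real N \<le> 1 / \<delta> + 1"
    "\<And>z. z \<in> grid (k * m + k * m) (N * m * k) \<Longrightarrow>
       visited d m k B z (\<Sum>j<k. energy d m B (column (cell s' ''U'') j))"
    "orthonormal d k (cell s' ''U'')" "scattered d k (cell s' ''U'')"
    "real t \<le> main_time d n k m \<epsilon> \<delta> (real (card (grid (k * m + k * m) (N * m * k))))"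
proof -
  have d: "0 < d" using k by simp
  obtain t1 s1 where r1: "runs m_com s t1 s1" and t1: "real t1 \<le> (2 * real k + 2 * real k / \<epsilon> + 2) * 23"
    and m1: "2 * real k + 2 * real k / \<epsilon> \<le> real (nvar s1 ''m'')"
      "real (nvar s1 ''m'') \<le> 2 * real k + 2 * real k / \<epsilon> + 1" and e1: "eqx {''m''} {} s s1"
    using wp_m_com[OF s(3,5) e] unfolding wp_def by blast
  define m where "m = nvar s1 ''m''"
  have "0 < real m" using m1(1) k e by (simp add: m_def) (smt (verit) divide_nonneg_pos of_nat_0_less_iff)
  then have m0: "0 < m" by simp
  obtain t2 s2 where r2: "runs N_com s1 t2 s2" and t2: "real t2 \<le> (1 / \<delta> + 2) * 14"
    and N2: "1 / \<delta> \<le> real (nvar s2 ''N'')" "real (nvar s2 ''N'') \<le> 1 / \<delta> + 1" and e2: "eqx {''N''} {} s1 s2"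
    using wp_N_com[of s1 \<delta>] s e1 dl unfolding wp_def eqx_def by auto
  define N where "N = nvar s2 ''N''"
  have e12: "eqx {''m'', ''N''} {} s s2" using e1 e2 by (auto simp: eqx_def)
  have m2: "nvar s2 ''m'' = m" using e2 by (simp add: eqx_def m_def)
  \<comment> \<open>With this threshold the loss k n f from all overwritten columns is \<delta>
    |A|^2, and |A|^2 / f = k n / \<delta> makes the number of sketching moves linear in n.\<close>
  define f where "f = \<delta> * total_sq d n a / (real k * real n)"
  have f0: "0 < f" using dl F k n by (simp add: f_def)
  obtain t3 s3 where r3: "runs param_com s2 t3 s3" and t3: "t3 \<le> k * 12 + 60"
    and s3: "cell s3 ''f'' 0 0 = f" "cell s3 ''R'' 0 0 = real (N * m * k)" "nvar s3 ''run'' = 1"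
      "nvar s3 ''H'' = k * m" "nvar s3 ''Q'' = k * m + k * m" and e3: "eqx (nmods param_com) (rmods param_com) s2 s3"
    using wp_param_com[of s2 k m N n \<delta> "total_sq d n a"] s e12 m2 unfolding wp_def f_def N_def eqx_def by auto
  have e13: "eqx {''m'', ''N'', ''run'', ''H'', ''j'', ''Q''} {''f'', ''R''} s s3"
    using e12 e3 by (auto simp: eqx_def)
  have m3: "nvar s3 ''m'' = m" using m2 e3 by (simp add: eqx_def)
  have "wp sketch_com s3 (\<lambda>t s'. real t \<le> (4 * (real m)\<^sup>2 * (total_sq d n a / f) + real n + 1) * (510 * (real m * real m * real d)) \<and>
     (\<exists>D. fd_inv d m a f n (cell s' ''B'') D) \<and> eqx (nmods sketch_com) (rmods sketch_com) s3 s')"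
    by (rule wp_sketch_com) (use s init e13 m3 s3 d m0 f0 in \<open>auto simp: eqx_def\<close>)
  then obtain t4 s4 D where r4: "runs sketch_com s3 t4 s4"
    and t4: "real t4 \<le> (4 * (real m)\<^sup>2 * (total_sq d n a / f) + real n + 1) * (510 * (real m * real m * real d))"
    and inv: "fd_inv d m a f n (cell s4 ''B'') D" and e4: "eqx (nmods sketch_com) (rmods sketch_com) s3 s4"
    unfolding wp_def by blast
  define B where "B = cell s4 ''B''"
  have s4: "nvar s4 ''d'' = d" "nvar s4 ''m'' = m" "nvar s4 ''k'' = k" "nvar s4 ''H'' = k * m"
    "nvar s4 ''Q'' = k * m + k * m" "cell s4 ''R'' 0 0 = real (N * m * k)" "nvar s4 ''run'' = 1"
    "cell s4 ''Z'' = (\<lambda>_ _. 0)" "cell s4 ''S'' 0 0 = 0" "cell s4 ''U'' = (\<lambda>_ _. 0)" "cell s4 ''best'' 0 0 = 0"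
    using e4 e13 s init s3 m3 by (auto simp: eqx_def)
  have "wp search_com s4 (\<lambda>t s'. t \<le> (card (grid (k * m + k * m) (N * m * k)) + 1) * (510 * (d * k * m)) \<and>
     scattered d k (cell s' ''U'') \<and>
     (\<forall>z\<in>grid (k * m + k * m) (N * m * k). visited d m k B z (captured d m k B (cell s' ''U''))) \<and>
     eqx (nmods search_com) (rmods search_com) s4 s')"
    by (rule wp_search_com) (use s4 d m0 k in \<open>auto simp: B_def\<close>)
  then obtain t5 s5 where r5: "runs search_com s4 t5 s5"
    and t5: "t5 \<le> (card (grid (k * m + k * m) (N * m * k)) + 1) * (510 * (d * k * m))"
    and U5: "scattered d k (cell s5 ''U'')"
    and V: "\<And>z. z \<in> grid (k * m + k * m) (N * m * k) \<Longrightarrow> visited d m k B z (captured d m k B (cell s5 ''U''))"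
    and e5: "eqx (nmods search_com) (rmods search_com) s4 s5"
    unfolding wp_def by blast
  have s5: "nvar s5 ''k'' = k" "nvar s5 ''d'' = d" using e5 s4 by (auto simp: eqx_def)
  obtain t6 s6 where r6: "runs repair_com s5 t6 s6" and t6: "t6 \<le> k * (300 * (k * d) + 8) + 6"
    and U6: "scattered d k (cell s6 ''U'')" "captured d m k B (cell s5 ''U'') \<le> captured d m k B (cell s6 ''U'')"
      "\<forall>l<k. 0 < sq d (column (cell s6 ''U'') l)" and e6: "eqx (nmods repair_com) (rmods repair_com) s5 s6"
    using wp_repair_com[OF s5 refl k(2) U5, of m B] unfolding wp_def by blast
  have s6: "nvar s6 ''k'' = k" "nvar s6 ''d'' = d" using e6 s5 by (auto simp: eqx_def)
  obtain t7 s7 where r7: "runs norm_com s6 t7 s7" and t7: "t7 \<le> k * (d * 45 + 30) + 6"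
    and U7: "\<forall>i<d. \<forall>j<k. cell s7 ''U'' i j = cell s6 ''U'' i j / sqrt (sq d (column (cell s6 ''U'') j))"
    using wp_norm_com[OF s6 refl] unfolding wp_def by blast
  have U7': "\<And>i j. i < d \<Longrightarrow> j < k \<Longrightarrow> cell s7 ''U'' i j = cell s6 ''U'' i j / sqrt (sq d (column (cell s6 ''U'') j))"
    using U7 by blast
  have U6': "\<And>j. j < k \<Longrightarrow> 0 < sq d (column (cell s6 ''U'') j)" using U6(3) by blast
  note NU = normalise_columns[OF U6(1) U6' U7']
  have "runs main_com s (t1 + (t2 + (t3 + (t4 + (t5 + (t6 + t7)))))) s7"
    unfolding main_com_def
    by (rule runs_Seq[OF r1 runs_Seq[OF r2 runs_Seq[OF r3 runs_Seq[OF r4 runs_Seq[OF r5 runs_Seq[OF r6 r7]]]]]])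
  moreover have "visited d m k B z (\<Sum>j<k. energy d m B (column (cell s7 ''U'') j))"
    if "z \<in> grid (k * m + k * m) (N * m * k)" for z
    using visited_mono[OF V[OF that] U6(2)] NU(3)[of m B] by simp
  moreover have "real (t1 + (t2 + (t3 + (t4 + (t5 + (t6 + t7)))))) \<le>
      main_time d n k m \<epsilon> \<delta> (real (card (grid (k * m + k * m) (N * m * k))))"
  proof -
    have "total_sq d n a / f = real k * real n / \<delta>" using F dl by (simp add: f_def)
    note t4 = t4[unfolded this]
    note cast = of_nat_mono[where 'a = real, unfolded of_nat_add of_nat_mult of_nat_numeral of_nat_1]
    show ?thesis
      using t1 t2 t4 cast[OF t3] cast[OF t5] cast[OF t6] cast[OF t7] unfolding of_nat_add main_time_def
      by (simp only: of_nat_add of_nat_mult of_nat_numeral of_nat_1)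
  qed
  ultimately show ?thesis
    using that[of _ s7 m B D N] inv m1 N2 NU(1,2) unfolding f_def B_def m_def[symmetric] N_def[symmetric]
    by blast
qed

text \<open>There are 2 k m \<le> 10 k^2/\<epsilon> coordinates, and each contributes a factor 3 (N
  + 1) \<le> 8/\<delta> \<le> (1/\<delta>)^4 because 1/\<delta> > 2; hence 40.\<close>

lemma card_grid_powr_le:
  assumes N: "1 \<le> N" "real N \<le> 1 / \<delta> + 1" and m: "real m \<le> 5 * (real k / \<epsilon>)"
    and \<delta>: "0 < \<delta>" "\<delta> < 1 / 2"
  shows "real (card (grid (k * m + k * m) (N * m * k))) \<le> (1 / \<delta>) powr (40 * ((real k)\<^sup>2 / \<epsilon>))"
proof -
  have inv: "2 < 1 / \<delta>" using \<delta> by (simp add: field_simps)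
  have "real (card (grid (k * m + k * m) (N * m * k))) \<le> (3 * real (N + 1)) ^ (k * m + k * m)"
    by (rule card_grid_le[OF N(1)]) (simp add: algebra_simps)
  also have "\<dots> \<le> ((1 / \<delta>) ^ 4) ^ (k * m + k * m)"
  proof (rule power_mono)
    have "3 * real (N + 1) \<le> 8 * (1 / \<delta>)" using N(2) inv by simp
    also have "\<dots> \<le> (1 / \<delta>) ^ 3 * (1 / \<delta>)"
      using power_mono[of 2 "1 / \<delta>" 3] inv \<delta> by (intro mult_right_mono) auto
    finally show "3 * real (N + 1) \<le> (1 / \<delta>) ^ 4" by (simp add: power_numeral_reduce)
  qed simp
  also have "\<dots> = (1 / \<delta>) ^ (4 * (k * m + k * m))" by (simp only: power_mult)
  also have "\<dots> = (1 / \<delta>) powr real (4 * (k * m + k * m))"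
    using \<delta> by (intro powr_realpow[symmetric]) simp
  also have "\<dots> \<le> (1 / \<delta>) powr (40 * ((real k)\<^sup>2 / \<epsilon>))"
  proof (rule powr_mono)
    have "real k * real m \<le> real k * (5 * (real k / \<epsilon>))" by (rule mult_left_mono[OF m]) simp
    also have "\<dots> = 5 * ((real k)\<^sup>2 / \<epsilon>)" by (simp add: power2_eq_square)
    finally have "8 * (real k * real m) \<le> 40 * ((real k)\<^sup>2 / \<epsilon>)" by linarith
    then show "real (4 * (k * m + k * m)) \<le> 40 * ((real k)\<^sup>2 / \<epsilon>)" by simp
  qed (use inv in simp)
  finally show ?thesis .
qed

text \<open>\<open>C\<close> stands for the number of grid points. Let x = k/\<epsilon> and y =
  x/\<delta>. All stages except sketching fit into a constant times d k^2/\<epsilon> times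
  \<open>E\<close>. Sketching makes O(n x^2 y) moves of O(x^2 d) steps each, and x^4 y \<le> y^5
  explains the exponent 5.\<close>

lemma main_time_le:
  fixes k d n m :: nat and \<epsilon> \<delta> C :: real
  assumes k: "0 < k" "k \<le> d" "0 < n" and \<epsilon>: "0 < \<epsilon>" "\<epsilon> < 1" and \<delta>: "0 < \<delta>" "\<delta> < 1 / 2"
    and m: "real m \<le> 5 * (real k / \<epsilon>)" and C: "C \<le> E" and E: "1 / \<delta> \<le> E"
  shows "main_time d n k m \<epsilon> \<delta> C \<le> 9000 * (real d * (real k)\<^sup>2 / \<epsilon>) * E + 1400000 * (real n * real d) * (real k / (\<epsilon> * \<delta>)) ^ 5"
proof -
  define K where "K = real k"
  define x where "x = K / \<epsilon>"
  define D where "D = real d"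
  define X where "X = D * K\<^sup>2 / \<epsilon>"
  have K1: "1 \<le> K" and D1: "1 \<le> D" using k by (auto simp: K_def D_def)
  have E1: "2 \<le> E" using E \<delta> by (smt (verit) field_sum_of_halves less_divide_eq_1_pos divide_less_eq mult.commute pos_divide_less_eq)
  have Kx: "K \<le> x" using \<epsilon> K1 by (simp add: x_def pos_le_divide_eq mult_left_le)
  have x1: "1 \<le> x" using Kx K1 by linarith
  have Xe: "X = D * K * x" by (simp add: X_def x_def power2_eq_square)
  have DK1: "1 \<le> D * K" using mult_mono[OF D1 K1] D1 by simp
  have xX: "x \<le> X" using mult_right_mono[OF DK1, of x] x1 by (simp add: Xe)
  have X1: "1 \<le> X" using xX x1 by linarith
  define T where "T = X * E"
  have XE: "X \<le> T" "E \<le> T"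
    using mult_left_mono[of 1 E X] mult_right_mono[of 1 X E] X1 E1 by (auto simp: T_def)
  have "1 \<le> T" using XE(1) X1 by linarith
  note XE = XE this
  have DKX: "D * K \<le> X" using mult_left_mono[OF x1, of "D * K"] DK1 by (simp add: Xe)
  have KKDX: "K * (K * D) \<le> X" using mult_left_mono[OF Kx, of "D * K"] DK1 by (simp add: Xe mult.assoc mult.commute mult.left_commute)
  have p1: "(2 * K + 2 * K / \<epsilon> + 2) * 23 \<le> 138 * T"
  proof -
    have "2 * K + 2 * K / \<epsilon> + 2 \<le> 6 * T" using Kx x1 xX XE by (simp add: x_def)
    then show ?thesis by simp
  qed
  have p2: "(1 / \<delta> + 2) * 14 \<le> 28 * T"
  proof -
    have "1 / \<delta> + 2 \<le> 2 * T" using E E1 XE by linarith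
    then show ?thesis by simp
  qed
  have p3: "K * 12 + 60 \<le> 72 * T" using Kx xX XE by linarith
  have p5: "(C + 1) * (510 * (D * K * real m)) \<le> 5100 * T"
  proof -
    have "D * K * real m \<le> D * K * (5 * x)"
      using m DK1 by (intro mult_left_mono) (auto simp: x_def K_def)
    then have "510 * (D * K * real m) \<le> 2550 * X" by (simp add: Xe)
    moreover have "C + 1 \<le> 2 * E" using C E1 by linarith
    moreover have "0 \<le> 2 * E" "0 \<le> 510 * (D * K * real m)" using E1 D1 K1 by simp_all
    ultimately have "(C + 1) * (510 * (D * K * real m)) \<le> (2 * E) * (2550 * X)"
      by (intro mult_mono[of "C + 1" "2 * E" "510 * (D * K * real m)" "2550 * X"])
    then show ?thesis by (simp add: T_def mult.commute)
  qed
  have p6: "K * (300 * (K * D) + 8) + 6 \<le> 314 * T"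
    using KKDX Kx xX XE by (simp add: distrib_left mult.left_commute[of K 300])
  have p7: "K * (D * 45 + 30) + 6 \<le> 81 * T"
    using DKX Kx xX XE by (simp add: distrib_left mult.commute[of K D] mult.assoc[symmetric])
  define y where "y = K / (\<epsilon> * \<delta>)"
  have y: "y = x / \<delta>" by (simp add: y_def x_def)
  have xy: "x \<le> y" using \<delta> x1 by (simp add: y field_simps)
  have p4: "(4 * (real m)\<^sup>2 * (K * real n / \<delta>) + real n + 1) * (510 * (real m * real m * D))
     \<le> 1400000 * (real n * D) * y ^ 5"
  proof -
    have n1: "1 \<le> real n" using k by simp
    have mm: "real m * real m \<le> 25 * x\<^sup>2"
      using mult_mono[OF m m] x1 by (simp add: x_def K_def power2_eq_square)
    have Kd: "K / \<delta> \<le> y" unfolding y using Kx \<delta> by (intro divide_right_mono) auto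
    have "1 \<le> x\<^sup>2 * y"
      using mult_mono[of 1 "x\<^sup>2" 1 y] one_le_power[OF x1, of 2] x1 xy by simp
    then have "2 * real n * 1 \<le> 2 * real n * (x\<^sup>2 * y)" by (intro mult_left_mono) auto
    then have one: "real n + 1 \<le> 2 * real n * (x\<^sup>2 * y)" using n1 by linarith
    have "4 * (real m)\<^sup>2 * (K * real n / \<delta>) = 4 * real n * ((real m * real m) * (K / \<delta>))"
      by (simp add: power2_eq_square)
    also have "\<dots> \<le> 4 * real n * ((25 * x\<^sup>2) * y)"
    proof (rule mult_left_mono)
      show "real m * real m * (K / \<delta>) \<le> 25 * x\<^sup>2 * y"
        by (rule mult_mono[OF mm Kd]) (use K1 \<delta> in auto)
    qed simp
    finally have first: "4 * (real m)\<^sup>2 * (K * real n / \<delta>) + real n + 1 \<le> 102 * real n * (x\<^sup>2 * y)"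
      using one by simp
    have second: "510 * (real m * real m * D) \<le> 510 * (25 * x\<^sup>2 * D)"
      using mult_right_mono[OF mm, of D] D1 by simp
    have "(4 * (real m)\<^sup>2 * (K * real n / \<delta>) + real n + 1) * (510 * (real m * real m * D))
      \<le> (102 * real n * (x\<^sup>2 * y)) * (510 * (25 * x\<^sup>2 * D))"
      by (rule mult_mono[OF first second]) (use n1 D1 x1 xy in auto)
    also have "\<dots> = 1300500 * (real n * D) * (x\<^sup>2 * x\<^sup>2 * y)" by (simp add: algebra_simps)
    also have "\<dots> \<le> 1400000 * (real n * D) * (y\<^sup>2 * y\<^sup>2 * y)"
      using n1 D1 x1 xy by (intro mult_mono) (auto intro!: power_mono)
    also have "y\<^sup>2 * y\<^sup>2 * y = y ^ 5" by (simp add: power2_eq_square power_numeral_reduce)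
    finally show ?thesis .
  qed
  have "9000 * X * E = 9000 * T" by (simp add: T_def)
  then show ?thesis
    unfolding main_time_def K_def[symmetric] D_def[symmetric] X_def[symmetric] y_def[symmetric]
    using p1 p2 p3 p4 p5 p6 p7 XE by linarith
qed

theorem theorem25:
  shows "\<exists>(P :: com) (c0 :: real) (c1 :: real) (c2 :: real) (c3 :: real) (p :: nat).
    0 < c0 \<and> 0 < c1 \<and> 0 < c2 \<and> 0 < c3 \<and>
    (\<forall>(d :: nat) (n :: nat) (k :: nat) (A :: real mat) (\<epsilon> :: real) (\<delta> :: real).
       A \<in> carrier_mat d n \<longrightarrow> 0 < k \<longrightarrow> k \<le> d \<longrightarrow>
       0 < \<epsilon> \<longrightarrow> \<epsilon> < 1 \<longrightarrow> 0 < \<delta> \<longrightarrow> \<delta> < 1 \<longrightarrow>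
       (\<exists>T s. runs P (input_state A k \<epsilon> \<delta>) T s \<and>
          output_mat d k s \<in> pnmf_feasible d k \<and>
          pnmf_cost A (output_mat d k s) \<le> (1 + \<epsilon>) * pnmf_opt A k + c0 * (\<delta> * frob_sq A) \<and>
          real T \<le> c1 * (real d * (real k)\<^sup>2 / \<epsilon>) * (1 / \<delta>) powr (c2 * ((real k)\<^sup>2 / \<epsilon>))
                   + c3 * (real n * real d) * (real k / (\<epsilon> * \<delta>)) ^ p))"
proof (rule exI[of _ pnmf_com], rule exI[of _ 4], rule exI[of _ 10000], rule exI[of _ 40],
    rule exI[of _ 2000000], rule exI[of _ 5], intro conjI allI impI)
  \<comment> \<open>The constant 4 comes from \<open>sketch_cost_bound\<close>, 40 and 5 from the
    counting above. The factors 10000 and 2000000 exceed 9000 and 1400000 to leave room for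
    computing the Frobenius norm and for the branching.\<close>
  show "(0 :: real) < 4" "(0 :: real) < 10000" "(0 :: real) < 40" "(0 :: real) < 2000000" by simp_all
  fix d n k :: nat and A :: "real mat" and \<epsilon> \<delta> :: real
  assume A: "A \<in> carrier_mat d n" and k: "0 < k" "k \<le> d" and \<epsilon>: "0 < \<epsilon>" "\<epsilon> < 1" and \<delta>: "0 < \<delta>" "\<delta> < 1"
  define X where "X = real d * (real k)\<^sup>2 / \<epsilon>"
  define E where "E = (1 / \<delta>) powr (40 * ((real k)\<^sup>2 / \<epsilon>))"
  define Y where "Y = (real n * real d) * (real k / (\<epsilon> * \<delta>)) ^ 5"
  have k1: "1 \<le> (real k)\<^sup>2 / \<epsilon>"
  proof -
    have "1 \<le> (real k)\<^sup>2" using k by simp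
    then show ?thesis using \<epsilon> by (simp add: pos_le_divide_eq)
  qed
  have X1: "real k \<le> X" "1 \<le> X"
  proof -
    have "real d * 1 \<le> real d * ((real k)\<^sup>2 / \<epsilon>)" by (intro mult_left_mono k1) simp
    then show "real k \<le> X" "1 \<le> X" using k by (simp_all add: X_def)
  qed
  have E\<delta>: "1 / \<delta> \<le> E"
    using powr_mono[of 1 "40 * ((real k)\<^sup>2 / \<epsilon>)" "1 / \<delta>"] k1 \<delta> by (simp add: E_def)
  then have E1: "1 \<le> E" using \<delta> by (smt (verit) less_divide_eq_1_pos)
  have XE: "X \<le> X * E" using mult_left_mono[OF E1, of X] X1 by simp
  have q1: "1 \<le> (real k / (\<epsilon> * \<delta>)) ^ 5"
  proof (rule one_le_power)
    have "\<epsilon> * \<delta> \<le> 1 * real k" using k \<epsilon> \<delta> by (intro mult_mono[of \<epsilon> 1 \<delta> "real k"]) auto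
    then show "1 \<le> real k / (\<epsilon> * \<delta>)" using \<epsilon> \<delta> by (simp add: pos_le_divide_eq)
  qed
  have Y: "real n * real d \<le> Y" "real n \<le> real n * real d"
    using mult_left_mono[OF q1, of "real n * real d"] mult_left_mono[of 1 "real d" "real n"] k by (simp_all add: Y_def)
  let ?s = "input_state A k \<epsilon> \<delta>"
  have dims: "dim_row A = d" "dim_col A = n" using A by auto
  let ?a = "cell ?s ''A''"
  have F: "frob_sq A = total_sq d n ?a"
    unfolding frob_sq_total[OF A] total_sq_def sq_def by (simp add: input_state_def dims)
  have F0: "0 \<le> frob_sq A" by (simp add: F)
  obtain t0 s0 where r0: "runs frob_com ?s t0 s0" and t0: "t0 \<le> n * (d * 22 + 40) + 20"
    and F1: "cell s0 ''F'' 0 0 = total_sq d n ?a" and e0: "eqx {''i'', ''j''} {''t'', ''F''} ?s s0"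
    using wp_frob_com[of ?s d n] unfolding wp_def by (auto simp: input_state_def dims)
  have "real t0 \<le> real (n * (d * 22 + 40) + 20)" using t0 by (rule of_nat_mono)
  then have t0: "real t0 \<le> 62 * Y + 20 * X" using Y X1 by (simp add: algebra_simps)
  have s0: "nvar s0 ''d'' = d" "nvar s0 ''n'' = n" "nvar s0 ''k'' = k" "cell s0 ''A'' = ?a"
    "cell s0 ''eps'' 0 0 = \<epsilon>" "cell s0 ''delta'' 0 0 = \<delta>" "nvar s0 ''c'' = 0"
    "cell s0 ''B'' = (\<lambda>_ _. 0)" "cell s0 ''Z'' = (\<lambda>_ _. 0)" "cell s0 ''S'' 0 0 = 0"
    "cell s0 ''U'' = (\<lambda>_ _. 0)" "cell s0 ''best'' 0 0 = 0"
    using e0 by (auto simp: eqx_def input_state_def dims)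
  let ?b = "BAnd (RLess (scalar ''delta'') (RDiv (nat_lit 1) (nat_lit 2))) (RLess (nat_lit 0) (scalar ''F''))"
  have bc: "bcost ?b = 16" by simp
  have bv: "bval ?b s0 \<longleftrightarrow> \<delta> < 1 / 2 \<and> 0 < frob_sq A" using s0 F1 F by simp
  have out: "output_mat d k s \<in> carrier_mat d k" "\<And>i j. i < d \<Longrightarrow> j < k \<Longrightarrow> output_mat d k s $$ (i, j) = cell s ''U'' i j" for s
    by (simp_all add: output_mat_def)
  have outc: "dot d (column (entries (output_mat d k s)) j) v = dot d (column (cell s ''U'') j) v" if "j < k" for s j v
    using out(2) that by (intro dot_cong) auto
  have outo: "orthonormal d k (entries (output_mat d k s)) = orthonormal d k (cell s ''U'')" for s
    unfolding orthonormal_def using outc dot_commute by metis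
  have oute: "energy d m B (column (entries (output_mat d k s)) j) = energy d m B (column (cell s ''U'') j)"
    if "j < k" for s j m B
    using outc[OF that] by (simp add: energy_def)
  have "\<exists>T s. runs pnmf_com ?s T s \<and> output_mat d k s \<in> pnmf_feasible d k \<and>
      pnmf_cost A (output_mat d k s) \<le> (1 + \<epsilon>) * pnmf_opt A k + 4 * (\<delta> * frob_sq A) \<and>
      real T \<le> 10000 * (X * E) + 2000000 * Y"
  proof (cases "\<delta> < 1 / 2 \<and> 0 < frob_sq A")
    case False
    obtain t1 s1 where r1: "runs trivial_com s0 t1 s1" and t1: "t1 \<le> k * 13 + 6"
      and U1: "cell s1 ''U'' = (\<lambda>i j. if i = j \<and> j < k then 1 else 0)"
      using wp_trivial_com[OF s0(3,11)] unfolding wp_def by blast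
    have "runs pnmf_com ?s (t0 + (1 + bcost ?b + t1)) s1"
      unfolding pnmf_com_def using False bv by (intro runs_Seq[OF r0] runs_CondF r1) simp
    moreover have feas: "output_mat d k s1 \<in> pnmf_feasible d k"
      unfolding pnmf_feasible_iff outo
      using out k(2) by (auto simp: U1 orthonormal_def dot_def if_distrib[where f = "\<lambda>x. x * _"] cong: if_cong)
    moreover have "pnmf_cost A (output_mat d k s1) \<le> (1 + \<epsilon>) * pnmf_opt A k + 4 * (\<delta> * frob_sq A)"
    proof -
      have o: "orthonormal d k (entries (output_mat d k s1))" using feas by (simp add: pnmf_feasible_iff)
      have "pnmf_cost A (output_mat d k s1) \<le> frob_sq A"
        unfolding pnmf_cost_eq[OF A out(1) o] frob_sq_total[OF A] by (simp add: sum_nonneg)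
      also have "\<dots> \<le> 4 * (\<delta> * frob_sq A)"
      proof (cases "frob_sq A = 0")
        case False
        then have "1 / 2 \<le> \<delta>" using F0 \<open>\<not> (\<delta> < 1 / 2 \<and> 0 < frob_sq A)\<close> by linarith
        then have "1 * frob_sq A \<le> (4 * \<delta>) * frob_sq A" using F0 by (intro mult_right_mono) auto
        then show ?thesis by simp
      qed simp
      also have "\<dots> \<le> (1 + \<epsilon>) * pnmf_opt A k + 4 * (\<delta> * frob_sq A)"
        using pnmf_opt_nonneg[OF dims(1) k(2)] \<epsilon> by simp
      finally show ?thesis .
    qed
    moreover have "real (t0 + (1 + bcost ?b + t1)) \<le> 10000 * (X * E) + 2000000 * Y"
    proof -
      have "real t1 \<le> real (k * 13 + 6)" using t1 by (rule of_nat_mono)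
      then have "real (t0 + (1 + bcost ?b + t1)) \<le> 62 * Y + 100 * X" using t0 X1 bc by simp
      moreover have "0 \<le> Y" using Y by (meson of_nat_0_le_iff order_trans)
      ultimately show ?thesis using XE X1 by linarith
    qed
    ultimately show ?thesis by blast
  next
    case True
    have n: "0 < n"
      using True by (cases "n = 0") (auto simp: F total_sq_def)
    have Fp: "0 < total_sq d n ?a" using True F by simp
    obtain t1 s1 m N B D where r1: "runs main_com s0 t1 s1"
      and inv: "fd_inv d m ?a (\<delta> * total_sq d n ?a / (real k * real n)) n B D"
      and m: "2 * real k + 2 * real k / \<epsilon> \<le> real m" "real m \<le> 2 * real k + 2 * real k / \<epsilon> + 1"
      and N: "1 / \<delta> \<le> real N" "real N \<le> 1 / \<delta> + 1"
      and V: "\<And>z. z \<in> grid (k * m + k * m) (N * m * k) \<Longrightarrow>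
        visited d m k B z (\<Sum>j<k. energy d m B (column (cell s1 ''U'') j))"
      and U1: "orthonormal d k (cell s1 ''U'')" "scattered d k (cell s1 ''U'')"
      and t1: "real t1 \<le> main_time d n k m \<epsilon> \<delta> (real (card (grid (k * m + k * m) (N * m * k))))"
      by (rule runs_main_com[OF s0(1-6) F1 s0(7-12) k n \<epsilon>(1) \<delta>(1) Fp]) (rule that)
    have "runs pnmf_com ?s (t0 + (1 + bcost ?b + t1)) s1"
      unfolding pnmf_com_def using True bv by (intro runs_Seq[OF r0] runs_CondT r1) simp
    moreover have feas: "output_mat d k s1 \<in> pnmf_feasible d k"
      unfolding pnmf_feasible_iff outo using out U1 by (auto simp: scattered_def)
    moreover have "pnmf_cost A (output_mat d k s1) \<le> (1 + \<epsilon>) * pnmf_opt A k + 4 * (\<delta> * frob_sq A)"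
    proof (rule sketch_cost_bound[OF A k \<epsilon> \<delta>(1) _ _ m(1) _ _ feas])
      show "1 \<le> real N * \<delta>" using N(1) \<delta> by (simp add: field_simps)
      have "energy d n (entries A) u = energy d n ?a u" for u
        unfolding energy_def dot_def by (simp add: input_state_def dims)
      moreover have "total_sq d n (entries A) = total_sq d n ?a"
        unfolding total_sq_def sq_def by (simp add: input_state_def dims)
      ultimately show "fd_inv d m (entries A) (\<delta> * total_sq d n ?a / (real k * real n)) n B D"
        using inv by (simp add: fd_inv_def)
      show "real k * (real n * (\<delta> * total_sq d n ?a / (real k * real n))) \<le> \<delta> * frob_sq A"
        using k n by (simp add: F)
      show "(\<Sum>j<k. energy d m B (column (cell s1 ''U'') j)) \<le>
        (\<Sum>j<k. energy d m B (column (entries (output_mat d k s1)) j))"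
        by (simp add: oute)
      show "\<exists>Y. assigns d k (\<lambda>i j. \<Sum>p<m. coef m (k * m) z p j * B i p) Y \<and>
          captured d m k B Y \<le> (\<Sum>j<k. energy d m B (column (cell s1 ''U'') j))"
        if "z \<in> grid (k * m + k * m) (N * m * k)" for z
        using V[OF that] by (simp add: visited_def gvals_def[abs_def])
    qed
    moreover have "real (t0 + (1 + bcost ?b + t1)) \<le> 10000 * (X * E) + 2000000 * Y"
    proof -
      \<comment> \<open>Both k and the 1 from rounding up are at most k/\<epsilon>, so the total is
        2 + 2 + 1 = 5 times k/\<epsilon>.\<close>
      have m5: "real m \<le> 5 * (real k / \<epsilon>)"
      proof -
        have "real k \<le> real k / \<epsilon>" using \<epsilon> by (simp add: pos_le_divide_eq mult_left_le)
        moreover have "1 \<le> real k" using k by simp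
        ultimately show ?thesis using m(2) by simp
      qed
      have "1 < 1 / \<delta>" using \<delta> by simp
      then have N1: "1 \<le> N" using N(1) by linarith
      note C = card_grid_powr_le[OF N1 N(2) m5 \<delta>(1), folded E_def]
      have "real t1 \<le> 9000 * X * E + 1400000 * (real n * real d) * (real k / (\<epsilon> * \<delta>)) ^ 5"
        unfolding X_def using t1 main_time_le[OF k n \<epsilon> \<delta>(1) _ m5 C E\<delta>] True by linarith
      then have "real t1 \<le> 9000 * (X * E) + 1400000 * Y" by (simp add: Y_def)
      moreover have "real (t0 + (1 + bcost ?b + t1)) = real t0 + 17 + real t1" using bc by simp
      moreover have "0 \<le> Y" using Y by (meson of_nat_0_le_iff order_trans)
      ultimately show ?thesis using t0 XE X1 by linarith
    qed
    ultimately show ?thesis by blast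
  qed
  then show "\<exists>T s. runs pnmf_com (input_state A k \<epsilon> \<delta>) T s \<and>
      output_mat d k s \<in> pnmf_feasible d k \<and>
      pnmf_cost A (output_mat d k s) \<le> (1 + \<epsilon>) * pnmf_opt A k + 4 * (\<delta> * frob_sq A) \<and>
      real T \<le> 10000 * (real d * (real k)\<^sup>2 / \<epsilon>) * (1 / \<delta>) powr (40 * ((real k)\<^sup>2 / \<epsilon>))
        + 2000000 * (real n * real d) * (real k / (\<epsilon> * \<delta>)) ^ 5"
    by (simp add: X_def E_def Y_def mult.assoc)
qed

end
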